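(* Let $\mathbf{W}=\{\mathbf{W}(t):t\ge 0\}$ be standard planar Brownian motion started at the origin, and for $t\ge 0$ let $\mathsf{P}(t)$ be the perimeter of $\mathrm{H}(t)=\operatorname{conv}\{\mathbf{W}(s):s\in[0,t]\}$. Let $\Theta^{\mathsf{P}}=\inf\{t\ge 0:\mathsf{P}(t)>1\}$. Then $$0.0397\approx\frac{1}{8\pi}\le \mathbb{E}\left[\Theta^{\mathsf{P}}\right]\le \frac{1}{2\pi^2}\approx 0.0507.$$
   Context: Standard planar Brownian motion is $\mathbf{W}(t)=(W_1(t),W_2(t))$ with $W_1,W_2$ independent one-dimensional standard Brownian motions started at $0$. $\operatorname{conv}A$ is the convex hull of $A\subset\mathbb{R}^2$. The perimeter of a planar convex body is the length of its boundary. The symbol $\approx$ only indicates a numerical approximation of the exact expression. *)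

theory Defs
  imports "HOL-Probability.Probability"
begin

text \<open>One-dimensional standard Brownian motion started at 0. Only the values at times
  \<open>t \<ge> 0\<close> are constrained; path continuity is required almost surely.\<close>

locale standard_brownian_motion = prob_space M for M :: "'w measure" +
  fixes B :: "real \<Rightarrow> 'w \<Rightarrow> real"
  assumes random_variable: "\<And>t. 0 \<le> t \<Longrightarrow> B t \<in> borel_measurable M"
    and start: "AE \<omega> in M. B 0 \<omega> = 0"
    and independent_increments:
      "\<And>(n::nat) (t :: nat \<Rightarrow> real). 0 \<le> t 0 \<Longrightarrow> (\<And>i. i < n \<Longrightarrow> t i < t (Suc i)) \<Longrightarrow>
         indep_vars (\<lambda>_. borel) (\<lambda>i \<omega>. B (t (Suc i)) \<omega> - B (t i) \<omega>) {..<n}"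
    and gaussian_increments:
      "\<And>s t. 0 \<le> s \<Longrightarrow> s < t \<Longrightarrow>
         distributed M lborel (\<lambda>\<omega>. B t \<omega> - B s \<omega>) (normal_density 0 (sqrt (t - s)))"
    and continuous_paths: "AE \<omega> in M. continuous_on {0..} (\<lambda>t. B t \<omega>)"

text \<open>Independence of the coordinates is independence of the two processes, viewed as
  random elements of the product space indexed by \<open>[0, \<infinity>)\<close>.\<close>

locale planar_brownian_motion = prob_space M for M :: "'w measure" +
  fixes W :: "real \<Rightarrow> 'w \<Rightarrow> real ^ 2"
  assumes coordinates: "\<And>i. standard_brownian_motion M (\<lambda>t \<omega>. W t \<omega> $ i)"
    and independent_coordinates:
      "indep_var (\<Pi>\<^sub>M t\<in>{0::real..}. borel) (\<lambda>\<omega>. \<lambda>t\<in>{0..}. W t \<omega> $ 1)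
                 (\<Pi>\<^sub>M t\<in>{0::real..}. borel) (\<lambda>\<omega>. \<lambda>t\<in>{0..}. W t \<omega> $ 2)"

text \<open>Length of a curve parametrised by \<open>[0, 1]\<close>: supremum of the lengths of inscribed
  polygonal lines (possibly \<open>\<infinity>\<close>).\<close>

definition curve_length :: "(real \<Rightarrow> 'a::metric_space) \<Rightarrow> ennreal" where
  "curve_length g =
     (SUP (n, t) \<in> {(n::nat, t :: nat \<Rightarrow> real). mono t \<and> range t \<subseteq> {0..1}}.
        ennreal (\<Sum>i<n. dist (g (t i)) (g (t (Suc i)))))"

text \<open>The boundary of a compact convex set with nonempty interior is a simple closed curve, and
  all its simple closed parametrisations have the same length. A compact convex set with empty
  interior is a point or a segment; by the usual convention, a segment counts twice
  (as the limit of the boundary lengths of thin neighbourhoods), and a point has perimeter 0.\<close>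

definition perimeter :: "(real ^ 2) set \<Rightarrow> ennreal" where
  "perimeter K =
     (if interior K = {} then ennreal (2 * diameter K)
      else (THE l. \<exists>g. simple_path g \<and> pathfinish g = pathstart g \<and>
                       path_image g = frontier K \<and> curve_length g = l))"

definition path_hull :: "(real \<Rightarrow> 'w \<Rightarrow> real ^ 2) \<Rightarrow> real \<Rightarrow> 'w \<Rightarrow> (real ^ 2) set" where
  "path_hull W t \<omega> = convex hull {W s \<omega> |s. s \<in> {0..t}}"

text \<open>Extended-valued, so that the infimum of the empty set is \<open>\<infinity>\<close>.\<close>

definition perimeter_exit_time :: "(real \<Rightarrow> 'w \<Rightarrow> real ^ 2) \<Rightarrow> 'w \<Rightarrow> ennreal" where
  "perimeter_exit_time W \<omega> = Inf {ennreal t |t. 0 \<le> t \<and> perimeter (path_hull W t \<omega>) > 1}"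

end

theory Submission
  imports Defs "HOL-Complex_Analysis.Contour_Integration" "HOL-Real_Asymp.Real_Asymp"
begin

text \<open>By Cauchy's formula the perimeter of a convex body is the integral of its width over the
  directions \<open>\<theta> \<in> [0, \<pi>]\<close>, so \<open>P(t) = \<integral> R\<^sub>\<theta>(t) d\<theta>\<close> where \<open>R\<^sub>\<theta>\<close> is the range of the one-dimensional
  Brownian motion in direction \<open>\<theta>\<close>. As \<open>P(t)\<close> is distributed as \<open>\<surd>t P(1)\<close>, the expected exit time is
  \<open>E [P(1)\<^sup>-\<^sup>2]\<close>. Jensen's inequality bounds it below by \<open>(E P(1))\<^sup>-\<^sup>2\<close>, where \<open>E P(1) \<le> \<surd>(8\<pi>)\<close> follows
  from Levy's maximal inequality. Jensen's inequality over the directions bounds it above by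
  \<open>\<pi>\<^sup>-\<^sup>2\<close> times the average of \<open>E [R\<^sub>\<theta>(1)\<^sup>-\<^sup>2]\<close>, which by scaling is the expected time until the range of a
  one-dimensional Brownian motion exceeds \<open>1\<close>. That time has mean at most \<open>1/2\<close>, because both the
  squared drawdown and the squared drawup minus time are martingales. Everything about the process
  is derived from random walks with Gaussian steps on finite grids.\<close>

section \<open>The perimeter as the total width over all directions\<close>

text \<open>Measurability is given only for values at fixed times, while \<open>perimeter\<close> is
  a definite description over curves, so the hull is not directly accessible to probability. Every
  functional is therefore a supremum over nested dyadic grids of functions of finitely many
  increments: these are jointly measurable in path and direction, have an explicit law, and agree
  with the true widths on continuous paths, that is almost surely. The value 1/2 arises because
  drawdown and drawup add up to the range and, when the range reaches 1, one of them is 0 and the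
  other 1. On a grid this argument is disturbed twice: the squared reflected walk gains too little
  when it is reflected, which is repaired by adding the standard deviation of a step before
  squaring, and the walk overshoots the level 1, which fourth moments control. Both errors vanish
  with the mesh. A mean range of 2 sqrt(2/pi), integrated over directions of mass pi, gives sqrt(8
  pi).\<close>

definition dir :: "real \<Rightarrow> real ^ 2" where
  "dir \<theta> = vector [cos \<theta>, sin \<theta>]"

definition angles :: "real measure" where
  "angles = restrict_space lborel {0..pi}"

text \<open>\<open>ennreal\<close> cuts negative differences to 0, so reversed pairs do not disturb
  the supremum, and the extended supremum needs no boundedness.\<close>

definition width :: "('a::real_inner) set \<Rightarrow> 'a \<Rightarrow> ennreal" where
  "width S e = (SUP x\<in>S. SUP y\<in>S. ennreal ((x - y) \<bullet> e))"

lemma inner_dir: "v \<bullet> dir \<theta> = v $ 1 * cos \<theta> + v $ 2 * sin \<theta>"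
  by (simp add: dir_def inner_vec_def UNIV_2)

lemma norm_dir [simp]: "norm (dir \<theta>) = 1"
  by (simp add: norm_eq_sqrt_inner inner_dir) (simp add: dir_def flip: power2_eq_square)

lemma space_angles [simp]: "space angles = {0..pi}"
  by (simp add: angles_def space_restrict_space)

lemma borel_measurable_angles:
  assumes "f \<in> measurable borel M"
  shows "f \<in> measurable angles M"
  unfolding angles_def using assms by (intro measurable_restrict_space1) simp

lemma emeasure_angles: "emeasure angles {0..pi} = ennreal pi"
  by (simp add: angles_def emeasure_restrict_space)

lemma finite_measure_angles: "finite_measure angles"
  by (rule finite_measureI) (simp add: emeasure_angles)

section \<open>Cauchy's formula for a segment\<close>

lemma has_integral_abs_sin:
  assumes "0 \<le> \<psi>" "\<psi> \<le> pi"
  shows "((\<lambda>\<theta>. \<bar>sin (\<theta> - \<psi>)\<bar>) has_integral 2) {0..pi}"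
proof -
  have "((\<lambda>\<theta>. sin (\<psi> - \<theta>)) has_integral cos (\<psi> - \<psi>) - cos (\<psi> - 0)) {0..\<psi>}"
    using assms
    by (intro fundamental_theorem_of_calculus)
       (auto intro!: derivative_eq_intros simp flip: has_real_derivative_iff_has_vector_derivative)
  then have "((\<lambda>\<theta>. sin (\<psi> - \<theta>)) has_integral 1 - cos \<psi>) {0..\<psi>}" by simp
  then have 1: "((\<lambda>\<theta>. \<bar>sin (\<theta> - \<psi>)\<bar>) has_integral 1 - cos \<psi>) {0..\<psi>}"
  proof (rule has_integral_eq[rotated])
    fix \<theta> assume "\<theta> \<in> {0..\<psi>}"
    then have "0 \<le> sin (\<psi> - \<theta>)" using assms by (intro sin_ge_zero) auto
    moreover have "sin (\<theta> - \<psi>) = - sin (\<psi> - \<theta>)"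
      by (metis minus_diff_eq sin_minus)
    ultimately show "sin (\<psi> - \<theta>) = \<bar>sin (\<theta> - \<psi>)\<bar>" by simp
  qed
  have "((\<lambda>\<theta>. sin (\<theta> - \<psi>)) has_integral (- cos (pi - \<psi>)) - (- cos (\<psi> - \<psi>))) {\<psi>..pi}"
    using assms
    by (intro fundamental_theorem_of_calculus)
       (auto intro!: derivative_eq_intros simp flip: has_real_derivative_iff_has_vector_derivative)
  then have "((\<lambda>\<theta>. sin (\<theta> - \<psi>)) has_integral 1 + cos \<psi>) {\<psi>..pi}"
    by (simp add: add.commute)
  then have 2: "((\<lambda>\<theta>. \<bar>sin (\<theta> - \<psi>)\<bar>) has_integral 1 + cos \<psi>) {\<psi>..pi}"
  proof (rule has_integral_eq[rotated])
    fix \<theta> assume "\<theta> \<in> {\<psi>..pi}"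
    then have "0 \<le> sin (\<theta> - \<psi>)" using assms by (intro sin_ge_zero) auto
    then show "sin (\<theta> - \<psi>) = \<bar>sin (\<theta> - \<psi>)\<bar>" by simp
  qed
  show ?thesis
    using has_integral_combine[OF assms 1 2] by simp
qed

text \<open>The projection of a vector of length r has length r |sin(theta - psi)|, which integrates
  to 2r over half a turn. The factor 2 matches the convention that a segment counts twice, and all
  other lengths are assembled from segments.\<close>

lemma nn_integral_angles_abs_inner:
  "(\<integral>\<^sup>+\<theta>. ennreal \<bar>v \<bullet> dir \<theta>\<bar> \<partial>angles) = ennreal (2 * norm v)"
proof -
  \<comment> \<open>The integrand is even in \<open>v\<close>. With \<open>v $ 1 \<le> 0\<close> the
    angle psi by which \<open>v\<close> is turned from the vertical axis falls into
    \<open>{0..pi}\<close>, where the absolute sine has been integrated.\<close>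
  have main: "(\<integral>\<^sup>+\<theta>. ennreal \<bar>v \<bullet> dir \<theta>\<bar> \<partial>angles) = ennreal (2 * norm v)" if "v $ 1 \<le> 0" for v :: "real ^ 2"
  proof (cases "v = 0")
    case False
    define r where "r = norm v"
    have r: "r > 0" "r\<^sup>2 = (v $ 1)\<^sup>2 + (v $ 2)\<^sup>2"
      using False by (simp_all add: r_def power2_norm_eq_inner inner_vec_def UNIV_2 flip: power2_eq_square)
    have "(v $ 2 / r)\<^sup>2 + (- v $ 1 / r)\<^sup>2 = ((v $ 1)\<^sup>2 + (v $ 2)\<^sup>2) / r\<^sup>2"
      by (simp add: power_divide add_divide_distrib)
    then have "0 \<le> - v $ 1 / r" "(v $ 2 / r)\<^sup>2 + (- v $ 1 / r)\<^sup>2 = 1"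
      using that r(1) unfolding r(2)[symmetric] by (auto simp: divide_le_0_iff)
    then obtain \<psi> where \<psi>: "0 \<le> \<psi>" "\<psi> \<le> pi" "v $ 2 / r = cos \<psi>" "- v $ 1 / r = sin \<psi>"
      using sincos_total_pi by blast
    have v: "v $ 1 = - (r * sin \<psi>)" "v $ 2 = r * cos \<psi>"
      using r(1) \<psi>(3,4) by (auto simp: field_simps)
    have eq: "v \<bullet> dir \<theta> = r * sin (\<theta> - \<psi>)" for \<theta>
      by (simp add: v inner_dir sin_diff algebra_simps)
    have "((\<lambda>\<theta>. r * \<bar>sin (\<theta> - \<psi>)\<bar>) has_integral r * 2) {0..pi}"
      by (intro has_integral_mult_right has_integral_abs_sin \<psi>)
    then have "((\<lambda>\<theta>. if \<theta> \<in> {0..pi} then r * \<bar>sin (\<theta> - \<psi>)\<bar> else 0) has_integral r * 2) UNIV"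
      by (simp only: has_integral_restrict_UNIV)
    then have "(\<integral>\<^sup>+\<theta>. ennreal (if \<theta> \<in> {0..pi} then r * \<bar>sin (\<theta> - \<psi>)\<bar> else 0) \<partial>lborel) = ennreal (r * 2)"
      using r by (intro nn_integral_has_integral_lborel) auto
    also have "(\<integral>\<^sup>+\<theta>. ennreal (if \<theta> \<in> {0..pi} then r * \<bar>sin (\<theta> - \<psi>)\<bar> else 0) \<partial>lborel)
        = (\<integral>\<^sup>+\<theta>. ennreal \<bar>v \<bullet> dir \<theta>\<bar> * indicator {0..pi} \<theta> \<partial>lborel)"
      using r by (intro nn_integral_cong) (auto simp: eq abs_mult indicator_def)
    also have "\<dots> = (\<integral>\<^sup>+\<theta>. ennreal \<bar>v \<bullet> dir \<theta>\<bar> \<partial>angles)"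
      unfolding angles_def by (subst nn_integral_restrict_space) auto
    finally show ?thesis by (simp add: r_def mult.commute)
  qed simp
  show ?thesis
  proof (cases "v $ 1 \<le> 0")
    case False
    then show ?thesis using main[of "- v"] by simp
  qed (rule main)
qed


section \<open>Boundary length is at least the total width\<close>

lemma frontier_attains_max_inner:
  fixes K :: "'a::euclidean_space set"
  assumes "compact K" "K \<noteq> {}" "e \<noteq> 0"
  obtains y where "y \<in> frontier K" "y \<in> K" "\<And>x. x \<in> K \<Longrightarrow> x \<bullet> e \<le> y \<bullet> e"
proof -
  have "continuous_on K (\<lambda>x. x \<bullet> e)" by (intro continuous_intros)
  from continuous_attains_sup[OF assms(1,2) this]
  obtain y where y: "y \<in> K" "\<And>x. x \<in> K \<Longrightarrow> x \<bullet> e \<le> y \<bullet> e" by blast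
  have "y \<notin> interior K"
  proof
    assume "y \<in> interior K"
    then obtain r where r: "r > 0" "cball y r \<subseteq> K" by (auto simp: mem_interior_cball)
    define x where "x = y + (r / norm e) *\<^sub>R e"
    have "dist y x = r" using r assms(3) by (simp add: x_def dist_norm)
    then have "x \<in> K" using r by (auto simp: subset_iff)
    then have "x \<bullet> e \<le> y \<bullet> e" by (rule y(2))
    then have "(r / norm e) * (e \<bullet> e) \<le> 0" by (simp add: x_def inner_add_left)
    moreover have "(r / norm e) * (e \<bullet> e) > 0" using r assms(3) by simp
    ultimately show False by simp
  qed
  then have "y \<in> frontier K"
    using y(1) closure_subset by (auto simp: frontier_def)
  with y show thesis using that by blast
qed

lemma width_compact:
  fixes K :: "'a::euclidean_space set"
  assumes "compact K" "K \<noteq> {}" "e \<noteq> 0"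
  obtains y z where "y \<in> frontier K" "z \<in> frontier K" "width K e = ennreal ((y - z) \<bullet> e)"
    "\<And>x. x \<in> K \<Longrightarrow> z \<bullet> e \<le> x \<bullet> e \<and> x \<bullet> e \<le> y \<bullet> e" "y \<in> K" "z \<in> K"
proof -
  obtain y where y: "y \<in> frontier K" "y \<in> K" "\<And>x. x \<in> K \<Longrightarrow> x \<bullet> e \<le> y \<bullet> e"
    using frontier_attains_max_inner[OF assms] by blast
  obtain z where z: "z \<in> frontier K" "z \<in> K" "\<And>x. x \<in> K \<Longrightarrow> x \<bullet> (- e) \<le> z \<bullet> (- e)"
    using frontier_attains_max_inner[OF assms(1,2), of "- e"] assms(3) by auto
  have "width K e = ennreal ((y - z) \<bullet> e)"
    unfolding width_def
  proof (rule antisym)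
    show "(SUP x\<in>K. SUP y\<in>K. ennreal ((x - y) \<bullet> e)) \<le> ennreal ((y - z) \<bullet> e)"
      using y z by (intro SUP_least ennreal_leI) (auto simp: inner_diff_left intro!: diff_mono)
    show "ennreal ((y - z) \<bullet> e) \<le> (SUP x\<in>K. SUP y\<in>K. ennreal ((x - y) \<bullet> e))"
      using y z by (intro SUP_upper2[of y] SUP_upper2[of z]) auto
  qed
  moreover have "z \<bullet> e \<le> x \<bullet> e \<and> x \<bullet> e \<le> y \<bullet> e" if "x \<in> K" for x
    using y(3)[OF that] z(3)[OF that] by simp
  ultimately show thesis using y z that by blast
qed

lemma abs_diff_le_sum_increments:
  fixes a :: "nat \<Rightarrow> real"
  assumes "m \<le> n"
  shows "\<bar>a n - a m\<bar> \<le> (\<Sum>k\<in>{m..<n}. \<bar>a (Suc k) - a k\<bar>)"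
proof -
  have "a n - a m = (\<Sum>k\<in>{m..<n}. a (Suc k) - a k)" using assms by (rule sum_Suc_diff'[symmetric])
  then show ?thesis by (simp only: sum_abs)
qed

text \<open>A closed sequence passes between the two indices along one arc and returns along the
  other, and each arc has variation at least the difference. This is the source of the factor 2
  between width and boundary length.\<close>

lemma double_diff_le_sum_closed_increments:
  fixes a :: "nat \<Rightarrow> real"
  assumes "a 0 = a N" "i \<le> N" "j \<le> N"
  shows "2 * (a i - a j) \<le> (\<Sum>k<N. \<bar>a (Suc k) - a k\<bar>)"
proof -
  have *: "2 * \<bar>a j - a i\<bar> \<le> (\<Sum>k<N. \<bar>a (Suc k) - a k\<bar>)" if "i \<le> j" "j \<le> N" for i j
  proof -
    define d where "d = (\<lambda>k. \<bar>a (Suc k) - a k\<bar>)"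
    have "sum d {..<N} = sum d {0..<i} + sum d {i..<j} + sum d {j..<N}"
      using that by (simp add: sum.atLeastLessThan_concat lessThan_atLeast0)
    moreover have "\<bar>a i - a 0\<bar> \<le> sum d {0..<i}" "\<bar>a j - a i\<bar> \<le> sum d {i..<j}" "\<bar>a N - a j\<bar> \<le> sum d {j..<N}"
      using that by (auto intro!: abs_diff_le_sum_increments simp: d_def)
    moreover have "\<bar>a j - a i\<bar> \<le> \<bar>a i - a 0\<bar> + \<bar>a N - a j\<bar>" using assms(1) by linarith
    ultimately show ?thesis unfolding d_def[symmetric] by argo
  qed
  have "2 * (a i - a j) \<le> 2 * \<bar>a j - a i\<bar>" using abs_ge_minus_self[of "a j - a i"] by argo
  also have "\<dots> \<le> (\<Sum>k<N. \<bar>a (Suc k) - a k\<bar>)"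
    using *[of i j] *[of j i] assms(2,3) by (cases "i \<le> j") (simp_all only: abs_minus_commute nat_le_linear not_le less_imp_le)
  finally show ?thesis .
qed

lemma ennreal_half_mult: "ennreal (1/2) * ennreal x = ennreal (x / 2)"
  by (subst ennreal_mult'[symmetric]) auto

text \<open>The vertices of a fine inscribed polygon come close to the two extremal points in any
  direction, so the width is at most half the variation of the projected polygon plus an error.
  Integrated over directions, each edge contributes its length.\<close>

lemma width_le_curve_length:
  fixes K :: "(real ^ 2) set"
  assumes "compact K" "K \<noteq> {}"
    and g: "path g" "pathfinish g = pathstart g" "path_image g = frontier K"
  shows "(\<integral>\<^sup>+\<theta>. width K (dir \<theta>) \<partial>angles) \<le> curve_length g"
proof (rule ennreal_le_epsilon)
  fix \<epsilon> :: real assume "\<epsilon> > 0"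
  \<comment> \<open>An error of \<open>2 * \<eta>\<close> per direction, integrated over mass
    \<open>pi\<close>, amounts to \<open>\<epsilon>\<close>.\<close>
  define \<eta> where "\<eta> = \<epsilon> / (2 * pi)"
  have "\<eta> > 0" using \<open>\<epsilon> > 0\<close> by (simp add: \<eta>_def)
  have "uniformly_continuous_on {0..1} g"
    using g(1) by (intro compact_uniformly_continuous) (auto simp: path_def)
  then obtain d where d: "d > 0" "\<And>s t. s \<in> {0..1} \<Longrightarrow> t \<in> {0..1} \<Longrightarrow> dist t s < d \<Longrightarrow> dist (g t) (g s) < \<eta>"
    unfolding uniformly_continuous_on_def using \<open>\<eta> > 0\<close> by metis
  obtain N :: nat where "N > 0" "1 / real N < d"
    using d(1) by (metis nat_approx_posE zero_less_Suc)
  \<comment> \<open>\<open>curve_length\<close> asks for a monotone sequence indexed by all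
    naturals, so the grid is frozen at 1 from index \<open>N\<close> on.\<close>
  define t where "t i = min (real i / N) 1" for i
  have t01: "t i \<in> {0..1}" for i by (simp add: t_def)
  have mono_t: "mono t" unfolding t_def by (intro monoI min.mono divide_right_mono) auto
  have near: "\<exists>i\<le>N. dist (g (t i)) (g s) < \<eta>" if "s \<in> {0..1}" for s
  proof -
    define i where "i = nat \<lfloor>s * N\<rfloor>"
    have i: "real i \<le> s * N" "s * N < real i + 1"
      using that by (auto simp: i_def of_nat_nat)
    have "s * N \<le> N" using that by (auto intro: mult_left_le_one_le)
    then have "i \<le> N" using i(1) by linarith
    have "t i = real i / N" using \<open>i \<le> N\<close> \<open>N > 0\<close> by (simp add: t_def)
    moreover have "real i / N \<le> s" "s < real i / N + 1 / N"
      using i \<open>N > 0\<close> by (auto simp: field_simps)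
    ultimately have "dist (t i) s < d" using \<open>1 / real N < d\<close> by (simp add: dist_real_def)
    then show ?thesis using d(2)[OF that t01] \<open>i \<le> N\<close> by blast
  qed
  have bound: "width K e \<le> ennreal ((\<Sum>i<N. \<bar>(g (t (Suc i)) - g (t i)) \<bullet> e\<bar>) / 2) + ennreal (2 * \<eta>)"
    if e: "norm e = 1" for e
  proof -
    have "e \<noteq> 0" using e by auto
    with assms obtain y z where yz: "y \<in> frontier K" "z \<in> frontier K" "width K e = ennreal ((y - z) \<bullet> e)"
      using width_compact by metis
    obtain r s where rs: "r \<in> {0..1}" "s \<in> {0..1}" "y = g r" "z = g s"
      using yz(1,2) unfolding g(3)[symmetric] path_image_def by blast
    obtain i j where ij: "i \<le> N" "j \<le> N" "dist (g (t i)) y < \<eta>" "dist (g (t j)) z < \<eta>"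
      using near[OF rs(1)] near[OF rs(2)] rs by blast
    have cs: "\<bar>(p - q) \<bullet> e\<bar> \<le> dist p q" for p q
      using Cauchy_Schwarz_ineq2[of "p - q" e] e by (simp add: dist_norm)
    define T where "T = (\<Sum>i<N. \<bar>(g (t (Suc i)) - g (t i)) \<bullet> e\<bar>)"
    have "2 * (g (t i) \<bullet> e - g (t j) \<bullet> e) \<le> T"
      using ij g(2) \<open>N > 0\<close> unfolding T_def inner_diff_left
      by (intro double_diff_le_sum_closed_increments) (auto simp: t_def pathfinish_def pathstart_def)
    moreover have "\<bar>g (t i) \<bullet> e - y \<bullet> e\<bar> < \<eta>" "\<bar>g (t j) \<bullet> e - z \<bullet> e\<bar> < \<eta>"
      using cs[of "g (t i)" y] cs[of "g (t j)" z] ij by (auto simp: inner_diff_left)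
    ultimately have "(y - z) \<bullet> e \<le> T / 2 + 2 * \<eta>"
      unfolding inner_diff_left abs_less_iff by argo
    then show ?thesis
      unfolding yz(3) T_def using \<open>\<eta> > 0\<close>
      by (subst ennreal_plus[symmetric]) (auto simp del: ennreal_plus intro!: ennreal_leI sum_nonneg divide_nonneg_pos)
  qed
  have meas: "(\<lambda>\<theta>. \<bar>v \<bullet> dir \<theta>\<bar>) \<in> borel_measurable angles" for v
    unfolding inner_dir by (intro borel_measurable_angles) measurable
  have "(\<integral>\<^sup>+\<theta>. width K (dir \<theta>) \<partial>angles)
      \<le> (\<integral>\<^sup>+\<theta>. (\<Sum>i<N. ennreal (1/2) * ennreal \<bar>(g (t (Suc i)) - g (t i)) \<bullet> dir \<theta>\<bar>) + ennreal (2 * \<eta>) \<partial>angles)"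
  proof (rule nn_integral_mono)
    fix \<theta>
    have "ennreal ((\<Sum>i<N. \<bar>(g (t (Suc i)) - g (t i)) \<bullet> dir \<theta>\<bar>) / 2)
      = (\<Sum>i<N. ennreal (1/2) * ennreal \<bar>(g (t (Suc i)) - g (t i)) \<bullet> dir \<theta>\<bar>)"
      unfolding ennreal_half_mult by (simp add: sum_divide_distrib)
    then show "width K (dir \<theta>) \<le> (\<Sum>i<N. ennreal (1/2) * ennreal \<bar>(g (t (Suc i)) - g (t i)) \<bullet> dir \<theta>\<bar>) + ennreal (2 * \<eta>)"
      using bound[of "dir \<theta>"] by simp
  qed
  also have "\<dots> = (\<Sum>i<N. ennreal (1/2) * ennreal (2 * norm (g (t (Suc i)) - g (t i)))) + ennreal (2 * \<eta>) * ennreal pi"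
    using meas
    by (subst nn_integral_add) (auto simp: nn_integral_sum nn_integral_cmult nn_integral_angles_abs_inner emeasure_angles)
  also have "\<dots> = ennreal (\<Sum>i<N. dist (g (t i)) (g (t (Suc i)))) + ennreal \<epsilon>"
    using \<open>\<eta> > 0\<close>
    unfolding ennreal_half_mult by (auto simp flip: ennreal_mult' simp: dist_norm norm_minus_commute \<eta>_def)
  also have "\<dots> \<le> curve_length g + ennreal \<epsilon>"
    unfolding curve_length_def using mono_t t01
    by (intro add_right_mono SUP_upper2[of "(N, t)"]) auto
  finally show "(\<integral>\<^sup>+\<theta>. width K (dir \<theta>) \<partial>angles) \<le> curve_length g + ennreal \<epsilon>" .
qed


section \<open>Boundary length is at most the total width\<close>

lemma interior_level:
  fixes K :: "'a::euclidean_space set"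
  assumes "convex K" "interior K \<noteq> {}" "y \<in> K" "z \<in> K" "z \<bullet> e < c" "c < y \<bullet> e"
  obtains p where "p \<in> interior K" "p \<bullet> e = c"
proof -
  obtain q where q: "q \<in> interior K" using assms(2) by blast
  \<comment> \<open>On the segment from the interior point \<open>q\<close> to a point
    \<open>w\<close> of \<open>K\<close>, everything before \<open>w\<close> is interior; the
    parameter is solved from the level \<open>c\<close>.\<close>
  have *: "\<exists>p\<in>interior K. p \<bullet> e = c" if "w \<in> K" and c: "0 < (c - q \<bullet> e) / (w \<bullet> e - q \<bullet> e)" "(c - q \<bullet> e) / (w \<bullet> e - q \<bullet> e) < 1" for w
  proof -
    define u where "u = (c - q \<bullet> e) / (w \<bullet> e - q \<bullet> e)"
    have "w \<bullet> e - q \<bullet> e \<noteq> 0" using c by auto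
    have "q \<noteq> w" using \<open>w \<bullet> e - q \<bullet> e \<noteq> 0\<close> by auto
    have "(1 - u) *\<^sub>R q + u *\<^sub>R w \<in> open_segment q w"
      using c \<open>q \<noteq> w\<close> by (auto simp: in_segment u_def)
    then have "(1 - u) *\<^sub>R q + u *\<^sub>R w \<in> interior K"
      using in_interior_closure_convex_segment[OF assms(1) q, of w] \<open>w \<in> K\<close> closure_subset by blast
    moreover have "((1 - u) *\<^sub>R q + u *\<^sub>R w) \<bullet> e = q \<bullet> e + u * (w \<bullet> e - q \<bullet> e)"
      by (simp add: inner_add_left algebra_simps)
    then have "((1 - u) *\<^sub>R q + u *\<^sub>R w) \<bullet> e = c"
      using \<open>w \<bullet> e - q \<bullet> e \<noteq> 0\<close> by (simp add: u_def)
    ultimately show ?thesis by blast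
  qed
  consider "q \<bullet> e = c" | "q \<bullet> e < c" | "q \<bullet> e > c" by linarith
  then have "\<exists>p\<in>interior K. p \<bullet> e = c"
  proof cases
    case 1 then show ?thesis using q by blast
  next
    case 2 then show ?thesis using *[OF \<open>y \<in> K\<close>] assms by (simp add: field_simps)
  next
    case 3 then show ?thesis using *[OF \<open>z \<in> K\<close>] assms by (simp add: field_simps)
  qed
  then show thesis using that by blast
qed

text \<open>The level is a line through the interior point \<open>p\<close>. Of two frontier points
  on the same side of \<open>p\<close>, the nearer one would lie in the open segment from
  \<open>p\<close> to the other and so be interior; each side carries at most one.\<close>

lemma frontier_level_card_le_2:
  fixes K :: "(real ^ 2) set"
  assumes "convex K" "p \<in> interior K" "p \<bullet> dir \<theta> = c"
  shows "finite {x \<in> frontier K. x \<bullet> dir \<theta> = c}" "card {x \<in> frontier K. x \<bullet> dir \<theta> = c} \<le> 2"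
proof -
  define n :: "real ^ 2" where "n = vector [- sin \<theta>, cos \<theta>]"
  let ?L = "{x \<in> frontier K. x \<bullet> dir \<theta> = c}"
  \<comment> \<open>Signed coordinate along the line, measured from \<open>p\<close>; its sign tells
    the side.\<close>
  define s where "s x = (x - p) \<bullet> n" for x
  have decomp: "v = (v \<bullet> dir \<theta>) *\<^sub>R dir \<theta> + (v \<bullet> n) *\<^sub>R n" for v
  proof -
    have "v $ 1 = (v $ 1 * cos \<theta> + v $ 2 * sin \<theta>) * cos \<theta> + (v $ 2 * cos \<theta> - v $ 1 * sin \<theta>) * - sin \<theta>"
         "v $ 2 = (v $ 1 * cos \<theta> + v $ 2 * sin \<theta>) * sin \<theta> + (v $ 2 * cos \<theta> - v $ 1 * sin \<theta>) * cos \<theta>"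
      using sin_cos_squared_add[of \<theta>] by algebra+
    then show ?thesis
      by (simp add: vec_eq_iff forall_2 inner_dir) (simp add: dir_def n_def inner_vec_def UNIV_2 algebra_simps)
  qed
  have line: "x = p + s x *\<^sub>R n" if "x \<in> ?L" for x
    using decomp[of "x - p"] that assms(3) by (simp add: s_def inner_diff_left algebra_simps)
  have nz: "s x \<noteq> 0" if "x \<in> ?L" for x
    using line[OF that] that assms(2) by (auto simp: frontier_def)
  have no: False if x: "x \<in> ?L" "y \<in> ?L" "0 < s x / s y" "s x / s y < 1" for x y
  proof -
    have "x = (1 - s x / s y) *\<^sub>R p + (s x / s y) *\<^sub>R y"
      by (subst line[OF x(1)], subst (2) line[OF x(2)]) (use nz[OF x(2)] in \<open>simp add: algebra_simps\<close>)
    moreover have "p \<noteq> y" using x(2) assms(2) by (auto simp: frontier_def)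
    ultimately have "x \<in> open_segment p y" using x by (auto simp: in_segment)
    then have "x \<in> interior K"
      using in_interior_closure_convex_segment[OF assms(1,2), of y] x by (auto simp: frontier_def)
    with x(1) show False by (auto simp: frontier_def)
  qed
  have inj: "inj_on (\<lambda>x. sgn (s x)) ?L"
  proof (rule inj_onI)
    fix x y assume xy: "x \<in> ?L" "y \<in> ?L" "sgn (s x) = sgn (s y)"
    have pos: "s x / s y > 0" "s y / s x > 0"
      using nz[OF xy(1)] nz[OF xy(2)] xy(3) by (auto simp: sgn_if zero_less_divide_iff split: if_splits)
    consider "s x / s y < 1" | "s y / s x < 1" | "s x = s y"
      using pos nz[OF xy(1)] nz[OF xy(2)] by (fastforce simp: divide_less_eq_1 zero_less_divide_iff)
    then show "x = y"
    proof cases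
      case 3 then show ?thesis using line[OF xy(1)] line[OF xy(2)] by simp
    qed (use no[OF xy(1,2)] no[OF xy(2,1)] pos in auto)
  qed
  have sub: "(\<lambda>x. sgn (s x)) ` ?L \<subseteq> {-1, 1}" using nz by (auto simp: sgn_if)
  show "finite ?L" using inj finite_subset[OF sub] by (auto intro: finite_imageD)
  have "card ?L \<le> card {-1, 1::real}" by (rule card_inj_on_le[OF inj sub]) simp
  then show "card ?L \<le> 2" by simp
qed

text \<open>Levels strictly between the end values are crossed at interior times, so crossings in
  consecutive parameter intervals are distinct times.\<close>

lemma ivt_strict:
  fixes f :: "real \<Rightarrow> real"
  assumes "a \<le> b" "continuous_on {a..b} f" "min (f a) (f b) < c" "c < max (f a) (f b)"
  obtains s where "a < s" "s < b" "f s = c"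
proof -
  have "\<exists>s. a \<le> s \<and> s \<le> b \<and> f s = c"
    using IVT'[of f a c b] IVT2'[of f b c a] assms by (auto simp: min_def max_def split: if_splits)
  then obtain s where s: "a \<le> s" "s \<le> b" "f s = c" by blast
  moreover have "s \<noteq> a" "s \<noteq> b" using s assms by auto
  ultimately show thesis using that[of s] by auto
qed

text \<open>Every level strictly between the extremes is attained at most twice on the frontier, so the
  total variation of a coordinate along the curve is at most twice the width.\<close>
lemma sum_increments_le_width:
  fixes K :: "(real ^ 2) set"
  assumes K: "compact K" "convex K" "interior K \<noteq> {}"
    and g: "simple_path g" "path_image g = frontier K"
    and t: "mono t" "range t \<subseteq> {0..1}"
  shows "(\<Sum>i<N. ennreal \<bar>(g (t (Suc i)) - g (t i)) \<bullet> dir \<theta>\<bar>) \<le> 2 * width K (dir \<theta>)"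
proof -
  let ?e = "dir \<theta>"
  have "K \<noteq> {}" using K(3) by auto
  moreover have "?e \<noteq> 0" using norm_dir[of \<theta>] by (metis norm_zero zero_neq_one)
  ultimately obtain y z where yz: "y \<in> K" "z \<in> K" "width K ?e = ennreal ((y - z) \<bullet> ?e)"
    "\<And>x. x \<in> K \<Longrightarrow> z \<bullet> ?e \<le> x \<bullet> ?e \<and> x \<bullet> ?e \<le> y \<bullet> ?e"
    using width_compact[OF K(1), of ?e] by metis
  define f where "f s = g s \<bullet> ?e" for s
  \<comment> \<open>\<open>I i\<close> consists of the levels swept on the i-th piece and its
    Lebesgue measure is the increment, so the variation is the integral over levels of the number of
    pieces that sweep them.\<close>
  define I where "I i = {min (f (t i)) (f (t (Suc i)))<..<max (f (t i)) (f (t (Suc i)))}" for i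
  have t01: "t i \<in> {0..1}" for i using t(2) by blast
  have cont: "continuous_on {0..1} f"
    using g(1) unfolding f_def simple_path_def path_def by (intro continuous_intros) auto
  have gK: "g s \<in> frontier K" "g s \<in> K" if "s \<in> {0..1}" for s
    using that g(2) frontier_subset_closed[OF compact_imp_closed[OF K(1)]] by (auto simp: path_image_def)
  have I_sub: "I i \<subseteq> {z \<bullet> ?e<..<y \<bullet> ?e}" for i
    using yz(4)[OF gK(2)[OF t01[of i]]] yz(4)[OF gK(2)[OF t01[of "Suc i"]]] by (auto simp: I_def f_def)
  have count: "(\<Sum>i<N. indicator (I i) c) \<le> (2 * indicator {z \<bullet> ?e..y \<bullet> ?e} c :: ennreal)" for c
  proof (cases "c \<in> {z \<bullet> ?e<..<y \<bullet> ?e}")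
    case False
    then have "indicator (I i) c = (0::ennreal)" for i using I_sub[of i] False by (auto simp: indicator_def)
    then show ?thesis by simp
  next
    case True
    define J where "J = {i. i < N \<and> c \<in> I i}"
    obtain p where p: "p \<in> interior K" "p \<bullet> ?e = c"
      using interior_level[OF K(2,3) yz(1,2)] True by auto
    have "\<exists>s. t i < s \<and> s < t (Suc i) \<and> f s = c" if "i \<in> J" for i
    proof -
      have "t i \<le> t (Suc i)" using t(1) by (simp add: mono_def)
      moreover have "continuous_on {t i..t (Suc i)} f"
        using t01[of i] t01[of "Suc i"] by (intro continuous_on_subset[OF cont]) auto
      ultimately show ?thesis
        using ivt_strict[of "t i" "t (Suc i)" f c] that by (auto simp: J_def I_def)
    qed
    then obtain s where s: "\<And>i. i \<in> J \<Longrightarrow> t i < s i \<and> s i < t (Suc i) \<and> f (s i) = c" by metis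
    have s01: "0 < s i" "s i < 1" if "i \<in> J" for i
      using s[OF that] t01[of i] t01[of "Suc i"] by auto
    have less: "s i < s j" if "i \<in> J" "j \<in> J" "i < j" for i j
      using s[OF that(1)] s[OF that(2)] monoD[OF t(1), of "Suc i" j] that(3) by auto
    \<comment> \<open>The crossing times lie strictly inside \<open>{0..1}\<close>, where a simple
      path is injective even when it is closed.\<close>
    have "inj_on (\<lambda>i. g (s i)) J"
    proof (rule inj_onI)
      fix i j assume ij: "i \<in> J" "j \<in> J" "g (s i) = g (s j)"
      moreover have "s i \<in> {0..1}" "s j \<in> {0..1}" "s i \<noteq> 0" "s i \<noteq> 1"
        using s01[OF ij(1)] s01[OF ij(2)] by auto
      ultimately have "s i = s j"
        using g(1) unfolding simple_path_def loop_free_def by blast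
      then show "i = j" using less[OF ij(1,2)] less[OF ij(2,1)] by (metis less_irrefl linorder_neqE_nat)
    qed
    moreover have "(\<lambda>i. g (s i)) ` J \<subseteq> {x \<in> frontier K. x \<bullet> ?e = c}"
      using s s01 gK by (auto simp: f_def less_imp_le)
    ultimately have "card J \<le> card {x \<in> frontier K. x \<bullet> ?e = c}"
      using frontier_level_card_le_2(1)[OF K(2) p] by (rule card_inj_on_le)
    then have "card J \<le> 2" using frontier_level_card_le_2(2)[OF K(2) p] by linarith
    then have "of_nat (card J) \<le> (of_nat 2 :: ennreal)" by (simp only: of_nat_le_iff)
    moreover have "(\<Sum>i<N. indicator (I i) c) = (of_nat (card J) :: ennreal)"
    proof -
      have "(\<Sum>i<N. indicator (I i) c) = (\<Sum>i<N. if i \<in> J then 1 else 0 :: ennreal)"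
        by (intro sum.cong) (auto simp: J_def indicator_def)
      also have "\<dots> = of_nat (card ({..<N} \<inter> J))" by (simp add: sum.If_cases)
      also have "{..<N} \<inter> J = J" by (auto simp: J_def)
      finally show ?thesis .
    qed
    ultimately show ?thesis using True by (simp add: indicator_def)
  qed
  have "(\<Sum>i<N. ennreal \<bar>(g (t (Suc i)) - g (t i)) \<bullet> ?e\<bar>) = (\<Sum>i<N. emeasure lborel (I i))"
    by (intro sum.cong refl) (auto simp: I_def f_def inner_diff_left abs_if min_def max_def)
  also have "\<dots> = (\<integral>\<^sup>+c. (\<Sum>i<N. indicator (I i) c) \<partial>lborel)"
    by (subst nn_integral_sum) (auto simp: I_def)
  also have "\<dots> \<le> (\<integral>\<^sup>+c. 2 * indicator {z \<bullet> ?e..y \<bullet> ?e} c \<partial>lborel)"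
    by (intro nn_integral_mono count)
  also have "\<dots> = 2 * width K ?e"
    using yz(4)[OF yz(1)] by (simp add: nn_integral_cmult yz(3) inner_diff_left)
  finally show ?thesis .
qed

text \<open>Each chord is half the integral of its projections, and in each direction the projected
  chords sum to at most twice the width.\<close>

lemma curve_length_le_width:
  fixes K :: "(real ^ 2) set"
  assumes K: "compact K" "convex K" "interior K \<noteq> {}"
    and g: "simple_path g" "path_image g = frontier K"
  shows "curve_length g \<le> (\<integral>\<^sup>+\<theta>. width K (dir \<theta>) \<partial>angles)"
  unfolding curve_length_def
proof (rule SUP_least, clarify)
  fix N :: nat and t :: "nat \<Rightarrow> real" assume t: "mono t" "range t \<subseteq> {0..1}"
  have meas: "(\<lambda>\<theta>. \<bar>v \<bullet> dir \<theta>\<bar>) \<in> borel_measurable angles" for v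
    unfolding inner_dir by (intro borel_measurable_angles) measurable
  have "ennreal (\<Sum>i<N. dist (g (t i)) (g (t (Suc i))))
      = (\<Sum>i<N. ennreal (1/2) * ennreal (2 * norm (g (t (Suc i)) - g (t i))))"
    unfolding ennreal_half_mult by (simp add: dist_norm norm_minus_commute)
  also have "\<dots> = (\<integral>\<^sup>+\<theta>. (\<Sum>i<N. ennreal (1/2) * ennreal \<bar>(g (t (Suc i)) - g (t i)) \<bullet> dir \<theta>\<bar>) \<partial>angles)"
    using meas by (subst nn_integral_sum) (auto simp: nn_integral_cmult nn_integral_angles_abs_inner)
  also have "\<dots> \<le> (\<integral>\<^sup>+\<theta>. width K (dir \<theta>) \<partial>angles)"
  proof (rule nn_integral_mono)
    fix \<theta>
    have "(\<Sum>i<N. ennreal (1/2) * ennreal \<bar>(g (t (Suc i)) - g (t i)) \<bullet> dir \<theta>\<bar>)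
        \<le> ennreal (1/2) * (2 * width K (dir \<theta>))"
      unfolding sum_distrib_left[symmetric] by (intro mult_left_mono sum_increments_le_width[OF K g t]) simp
    also have "\<dots> = ennreal (1/2 * 2) * width K (dir \<theta>)"
      by (subst ennreal_mult) (auto simp: mult.assoc)
    finally show "(\<Sum>i<N. ennreal (1/2) * ennreal \<bar>(g (t (Suc i)) - g (t i)) \<bullet> dir \<theta>\<bar>) \<le> width K (dir \<theta>)"
      by simp
  qed
  finally show "ennreal (\<Sum>i<N. dist (g (t i)) (g (t (Suc i)))) \<le> (\<integral>\<^sup>+\<theta>. width K (dir \<theta>) \<partial>angles)" .
qed

text \<open>The definite description in \<open>perimeter\<close> needs a curve to exist: a
  homeomorphism of the unit circle onto the frontier carries \<open>circlepath\<close>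
  along.\<close>

lemma ex_simple_loop_frontier:
  fixes K :: "(real ^ 2) set"
  assumes "compact K" "convex K" "interior K \<noteq> {}"
  obtains g where "simple_path g" "pathfinish g = pathstart g" "path_image g = frontier K"
proof -
  have "aff_dim K = aff_dim (cball 0 1 :: complex set)"
    using assms(3) by (simp add: aff_dim_nonempty_interior aff_dim_cball)
  then have "rel_frontier (cball 0 1 :: complex set) homeomorphic rel_frontier K"
    using assms compact_imp_bounded by (intro homeomorphic_rel_frontiers_convex_bounded_sets) auto
  then have "sphere (0::complex) 1 homeomorphic frontier K"
    using rel_frontier_nonempty_interior[OF assms(3)] by simp
  then obtain h k where h: "homeomorphism (sphere (0::complex) 1) (frontier K) h k"
    by (auto simp: homeomorphic_def)
  show thesis
  proof
    show "simple_path (h \<circ> circlepath 0 1)"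
      using h by (intro simple_path_continuous_image)
        (auto simp: simple_path_circlepath homeomorphism_def intro: inj_on_inverseI)
    show "pathfinish (h \<circ> circlepath 0 1) = pathstart (h \<circ> circlepath 0 1)"
      by (simp add: pathfinish_compose pathstart_compose)
    show "path_image (h \<circ> circlepath 0 1) = frontier K"
      using h by (simp add: path_image_compose homeomorphism_def)
  qed
qed

section \<open>Degenerate bodies and the perimeter formula\<close>

lemma closed_segment_diffE:
  assumes "x \<in> closed_segment a b" "y \<in> closed_segment a b"
  obtains c where "\<bar>c\<bar> \<le> 1" "x - y = c *\<^sub>R (b - a)"
proof -
  obtain u v where uv: "0 \<le> u" "u \<le> 1" "x = (1 - u) *\<^sub>R a + u *\<^sub>R b" "0 \<le> v" "v \<le> 1" "y = (1 - v) *\<^sub>R a + v *\<^sub>R b"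
    using assms unfolding in_segment by blast
  have "x - y = (u - v) *\<^sub>R (b - a)" unfolding uv by (simp add: algebra_simps)
  then show thesis using uv(1,2,4,5) by (intro that[of "u - v"]) auto
qed

lemma diameter_closed_segment:
  fixes a b :: "'a::euclidean_space"
  shows "diameter (closed_segment a b) = norm (b - a)"
proof (rule antisym)
  show "diameter (closed_segment a b) \<le> norm (b - a)"
  proof (rule diameter_le)
    fix x y assume "x \<in> closed_segment a b" "y \<in> closed_segment a b"
    then obtain c where "\<bar>c\<bar> \<le> 1" "x - y = c *\<^sub>R (b - a)" by (rule closed_segment_diffE)
    then show "norm (x - y) \<le> norm (b - a)" by (simp add: mult_left_le_one_le)
  qed simp
  show "norm (b - a) \<le> diameter (closed_segment a b)"
    using diameter_bounded_bound[OF compact_imp_bounded[OF compact_segment(1)], of b a b a] by (simp add: dist_norm)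
qed

lemma width_closed_segment:
  "width (closed_segment a b) e = ennreal \<bar>(b - a) \<bullet> e\<bar>"
proof (rule antisym)
  have "(x - y) \<bullet> e \<le> \<bar>(b - a) \<bullet> e\<bar>" if xy: "x \<in> closed_segment a b" "y \<in> closed_segment a b" for x y
  proof -
    obtain c where c: "\<bar>c\<bar> \<le> 1" "x - y = c *\<^sub>R (b - a)" using xy by (rule closed_segment_diffE)
    have "(x - y) \<bullet> e \<le> \<bar>c\<bar> * \<bar>(b - a) \<bullet> e\<bar>" by (simp add: c(2) flip: abs_mult)
    also have "\<dots> \<le> 1 * \<bar>(b - a) \<bullet> e\<bar>" using c(1) by (intro mult_right_mono) auto
    finally show ?thesis by simp
  qed
  then show "width (closed_segment a b) e \<le> ennreal \<bar>(b - a) \<bullet> e\<bar>"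
    unfolding width_def by (intro SUP_least ennreal_leI)
  show "ennreal \<bar>(b - a) \<bullet> e\<bar> \<le> width (closed_segment a b) e"
  proof (cases "0 \<le> (b - a) \<bullet> e")
    case True then show ?thesis
      unfolding width_def by (intro SUP_upper2[of b] SUP_upper2[of a]) auto
  next
    case False then show ?thesis
      unfolding width_def by (intro SUP_upper2[of a] SUP_upper2[of b]) (auto simp: inner_diff_left)
  qed
qed

text \<open>With nonempty interior, the two inequalities force the same length on every simple loop
  around the frontier, so the description is well defined. Otherwise \<open>K\<close> has affine
  dimension at most 1, hence is a segment, and the formula for one segment applies.\<close>

lemma perimeter_eq_nn_integral_width:
  fixes K :: "(real ^ 2) set"
  assumes "compact K" "convex K" "K \<noteq> {}"
  shows "perimeter K = (\<integral>\<^sup>+\<theta>. width K (dir \<theta>) \<partial>angles)"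
proof (cases "interior K = {}")
  case True
  then have "affine hull K \<noteq> UNIV"
    using assms rel_interior_eq_empty rel_interior_interior by metis
  then have "aff_dim K \<noteq> 2" using aff_dim_eq_full[of K] by simp
  then have "aff_dim K \<le> 1" using aff_dim_le_DIM[of K] by simp
  then have "collinear K" by (simp add: collinear_aff_dim)
  then obtain a b where ab: "K = closed_segment a b"
    using compact_convex_collinear_segment assms by metis
  have "perimeter K = ennreal (2 * norm (b - a))"
    using True by (simp add: perimeter_def ab diameter_closed_segment dist_norm norm_minus_commute)
  then show ?thesis by (simp add: ab width_closed_segment nn_integral_angles_abs_inner)
next
  case False
  have len: "curve_length g = (\<integral>\<^sup>+\<theta>. width K (dir \<theta>) \<partial>angles)"
    if "simple_path g" "pathfinish g = pathstart g" "path_image g = frontier K" for g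
    using curve_length_le_width[OF assms(1,2) False that(1,3)] width_le_curve_length[OF assms(1,3) _ that(2,3)]
      that(1) by (auto simp: simple_path_def intro: antisym)
  obtain g where g: "simple_path g" "pathfinish g = pathstart g" "path_image g = frontier K"
    using ex_simple_loop_frontier[OF assms(1,2) False] .
  show ?thesis
    unfolding perimeter_def using False g len by (auto intro!: the_equality)
qed

section \<open>Gaussian random walks\<close>

lemma nn_integral_indicator_less:
  "(\<integral>\<^sup>+t. indicator {t. 0 < t \<and> ennreal t < c} t \<partial>lborel) = c"
  "(\<integral>\<^sup>+t. indicator {t. 0 < t \<and> ennreal t \<le> c} t \<partial>lborel) = c"
proof -
  have "(\<integral>\<^sup>+t. indicator {t. 0 < t \<and> ennreal t < c} t \<partial>lborel) = c \<and>
        (\<integral>\<^sup>+t. indicator {t. 0 < t \<and> ennreal t \<le> c} t \<partial>lborel) = c"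
  proof (cases c)
    case (real r)
    have "{t. 0 < t \<and> ennreal t < c} = {0<..<r}" "{t. 0 < t \<and> ennreal t \<le> c} = {0<..r}"
      using real by (auto simp: ennreal_less_iff)
    then show ?thesis using real by simp
  next
    case top
    have "{t. 0 < t \<and> ennreal t < c} = {0<..}" "{t. 0 < t \<and> ennreal t \<le> c} = {0<..}"
      using top by auto
    moreover have "emeasure lborel {0::real<..} = \<infinity>"
    proof (rule ccontr)
      assume "emeasure lborel {0::real<..} \<noteq> \<infinity>"
      then obtain r where r: "r \<ge> 0" "emeasure lborel {0::real<..} = ennreal r"
        by (cases "emeasure lborel {0::real<..}") auto
      have "ennreal (r + 1) = emeasure lborel {0<..<r + 1}" using r by simp
      also have "\<dots> \<le> ennreal r" unfolding r(2)[symmetric] by (intro emeasure_mono) auto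
      finally show False using r by (simp add: ennreal_le_iff del: ennreal_plus)
    qed
    ultimately show ?thesis using top by simp
  qed
  then show "(\<integral>\<^sup>+t. indicator {t. 0 < t \<and> ennreal t < c} t \<partial>lborel) = c"
    "(\<integral>\<^sup>+t. indicator {t. 0 < t \<and> ennreal t \<le> c} t \<partial>lborel) = c" by auto
qed

text \<open>Both the strict and the weak tail are provided: the exit time is squeezed between events
  that match one of them on each side.\<close>

lemma nn_integral_layer_cake:
  assumes "sigma_finite_measure M" and [measurable]: "f \<in> borel_measurable M"
  shows "(\<integral>\<^sup>+x. f x \<partial>M) = (\<integral>\<^sup>+t. indicator {0<..} t * emeasure M {x \<in> space M. ennreal t < f x} \<partial>lborel)"
    "(\<integral>\<^sup>+x. f x \<partial>M) = (\<integral>\<^sup>+t. indicator {0<..} t * emeasure M {x \<in> space M. ennreal t \<le> f x} \<partial>lborel)"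
proof -
  interpret sigma_finite_measure M by fact
  interpret pair_sigma_finite M lborel ..
  have "(\<integral>\<^sup>+x. f x \<partial>M) = (\<integral>\<^sup>+x. \<integral>\<^sup>+t. indicator {0<..} t * indicator {x \<in> space M. ennreal t < f x} x \<partial>lborel \<partial>M)"
    by (intro nn_integral_cong, subst (1) nn_integral_indicator_less(1)[symmetric], intro nn_integral_cong)
       (auto simp: indicator_def)
  also have "\<dots> = (\<integral>\<^sup>+t. \<integral>\<^sup>+x. indicator {0<..} t * indicator {x \<in> space M. ennreal t < f x} x \<partial>M \<partial>lborel)"
    by (rule Fubini'[symmetric]) measurable
  finally show "(\<integral>\<^sup>+x. f x \<partial>M) = (\<integral>\<^sup>+t. indicator {0<..} t * emeasure M {x \<in> space M. ennreal t < f x} \<partial>lborel)"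
    by (simp add: nn_integral_cmult)
  have "(\<integral>\<^sup>+x. f x \<partial>M) = (\<integral>\<^sup>+x. \<integral>\<^sup>+t. indicator {0<..} t * indicator {x \<in> space M. ennreal t \<le> f x} x \<partial>lborel \<partial>M)"
    by (intro nn_integral_cong, subst (1) nn_integral_indicator_less(2)[symmetric], intro nn_integral_cong)
       (auto simp: indicator_def)
  also have "\<dots> = (\<integral>\<^sup>+t. \<integral>\<^sup>+x. indicator {0<..} t * indicator {x \<in> space M. ennreal t \<le> f x} x \<partial>M \<partial>lborel)"
    by (rule Fubini'[symmetric]) measurable
  finally show "(\<integral>\<^sup>+x. f x \<partial>M) = (\<integral>\<^sup>+t. indicator {0<..} t * emeasure M {x \<in> space M. ennreal t \<le> f x} \<partial>lborel)"
    by (simp add: nn_integral_cmult)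
qed

text \<open>Fubini on the joint law: \<open>A\<close> is frozen and \<open>B\<close> integrated out,
  which replaces conditioning on the past.\<close>

lemma (in prob_space) nn_integral_indep_var:
  assumes indep: "indep_var S A T B" and [measurable]: "f \<in> borel_measurable (S \<Otimes>\<^sub>M T)"
  shows "(\<integral>\<^sup>+\<omega>. f (A \<omega>, B \<omega>) \<partial>M) = (\<integral>\<^sup>+\<omega>. \<integral>\<^sup>+\<omega>'. f (A \<omega>, B \<omega>') \<partial>M \<partial>M)"
proof -
  have [measurable]: "A \<in> measurable M S" "B \<in> measurable M T"
    using indep by (auto dest: indep_var_rv1 indep_var_rv2)
  interpret T: prob_space "distr M T B" by (rule prob_space_distr) measurable
  have "(\<integral>\<^sup>+\<omega>. f (A \<omega>, B \<omega>) \<partial>M) = (\<integral>\<^sup>+z. f z \<partial>distr M (S \<Otimes>\<^sub>M T) (\<lambda>\<omega>. (A \<omega>, B \<omega>)))"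
    by (subst nn_integral_distr) auto
  also have "\<dots> = (\<integral>\<^sup>+z. f z \<partial>(distr M S A \<Otimes>\<^sub>M distr M T B))"
    using indep by (simp add: indep_var_distribution_eq)
  also have "\<dots> = (\<integral>\<^sup>+a. \<integral>\<^sup>+b. f (a, b) \<partial>distr M T B \<partial>distr M S A)"
    by (subst T.nn_integral_fst[symmetric]) (auto simp: measurable_cong_sets[OF sets_pair_measure_cong[OF sets_distr sets_distr] refl])
  also have "\<dots> = (\<integral>\<^sup>+\<omega>. \<integral>\<^sup>+b. f (A \<omega>, b) \<partial>distr M T B \<partial>M)"
    by (subst nn_integral_distr) (auto intro!: T.borel_measurable_nn_integral)
  also have "\<dots> = (\<integral>\<^sup>+\<omega>. \<integral>\<^sup>+\<omega>'. f (A \<omega>, B \<omega>') \<partial>M \<partial>M)"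
    by (intro nn_integral_cong, subst nn_integral_distr) (auto intro: measurable_compose[OF measurable_Pair1'] dest: measurable_space)
  finally show ?thesis .
qed

section \<open>Gaussian moments and the reflected step\<close>

lemma has_bochner_integral_normal_abs:
  assumes "\<sigma> > 0"
  shows "has_bochner_integral lborel (\<lambda>x. normal_density 0 \<sigma> x * \<bar>x\<bar>) (\<sigma> * sqrt (2 / pi))"
  using normal_moment_abs_odd[OF assms, of 0 0] by simp

text \<open>Reflecting an overshoot z replaces \<open>(\<sigma> - z)\<^sup>2\<close> by
  \<open>\<sigma>\<^sup>2\<close>, a gain of \<open>2 * \<sigma> * z - z\<^sup>2\<close>. By
  symmetry its integral over positive z is half of the integral with |z| over the line, which is
  \<sigma>^2 (2 sqrt(2/pi) - 1).\<close>

lemma normal_pos_part_weight: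
  assumes "\<sigma> > 0"
  shows "integrable lborel (\<lambda>z. normal_density 0 \<sigma> z * (2 * \<sigma> * z - z\<^sup>2) * indicator {0<..} z)"
    and "0 \<le> (\<integral>z. normal_density 0 \<sigma> z * (2 * \<sigma> * z - z\<^sup>2) * indicator {0<..} z \<partial>lborel)"
proof -
  let ?h = "\<lambda>z. normal_density 0 \<sigma> z * (2 * \<sigma> * \<bar>z\<bar> - z\<^sup>2)"
  have "has_bochner_integral lborel (\<lambda>z. (normal_density 0 \<sigma> z * \<bar>z\<bar>) * (2 * \<sigma>) - normal_density 0 \<sigma> z * z\<^sup>2)
      (\<sigma> * sqrt (2 / pi) * (2 * \<sigma>) - \<sigma>\<^sup>2)"
    using normal_moment_even[OF assms, of 0 1]
    by (intro has_bochner_integral_diff has_bochner_integral_mult_left has_bochner_integral_normal_abs assms) simp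
  then have h: "has_bochner_integral lborel ?h (\<sigma>\<^sup>2 * (2 * sqrt (2 / pi) - 1))"
    by (simp add: algebra_simps power2_eq_square)
  have eq: "normal_density 0 \<sigma> z * (2 * \<sigma> * z - z\<^sup>2) * indicator {0<..} z = ?h z * indicator {0<..} z" for z
    by (auto simp: indicator_def)
  have int: "integrable lborel (\<lambda>z. ?h z * indicator A z)" if "A \<in> sets borel" for A
    using h that by (intro integrable_real_mult_indicator) (auto simp: has_bochner_integral_iff)
  show "integrable lborel (\<lambda>z. normal_density 0 \<sigma> z * (2 * \<sigma> * z - z\<^sup>2) * indicator {0<..} z)"
    unfolding eq by (rule int) simp
  have "(\<integral>z. ?h z * indicator {0<..} z \<partial>lborel) = (\<integral>z. ?h z * indicator {..<0} z \<partial>lborel)"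
    by (subst lborel_integral_real_affine[of "-1" _ 0]) (auto simp: normal_density_def indicator_def intro!: Bochner_Integration.integral_cong)
  moreover have "(\<integral>z. ?h z * indicator {0<..} z \<partial>lborel) + (\<integral>z. ?h z * indicator {..<0} z \<partial>lborel) = (\<integral>z. ?h z \<partial>lborel)"
    by (subst Bochner_Integration.integral_add[symmetric, OF int int])
       (auto intro!: Bochner_Integration.integral_cong simp: indicator_def)
  moreover have "1/2 \<le> sqrt (2 / pi)"
    using pi_less_4 by (intro real_le_rsqrt) (simp add: field_simps power2_eq_square)
  then have "0 \<le> \<sigma>\<^sup>2 * (2 * sqrt (2 / pi) - 1)" by simp
  then have "0 \<le> (\<integral>z. ?h z \<partial>lborel)" using h by (simp add: has_bochner_integral_iff)
  ultimately show "0 \<le> (\<integral>z. normal_density 0 \<sigma> z * (2 * \<sigma> * z - z\<^sup>2) * indicator {0<..} z \<partial>lborel)"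
    unfolding eq by linarith
qed

lemma normal_density_shift:
  assumes "\<sigma> > 0"
  shows "normal_density 0 \<sigma> (u + z) = normal_density 0 \<sigma> z * exp (- u\<^sup>2 / (2 * \<sigma>\<^sup>2)) * exp (- u * z / \<sigma>\<^sup>2)"
proof -
  have "- (u + z - 0)\<^sup>2 / (2 * \<sigma>\<^sup>2) = - (z - 0)\<^sup>2 / (2 * \<sigma>\<^sup>2) + - u\<^sup>2 / (2 * \<sigma>\<^sup>2) + - u * z / \<sigma>\<^sup>2"
    using assms by (simp add: field_simps power2_eq_square)
  then show ?thesis unfolding normal_density_def by (simp only: exp_add mult.assoc)
qed

text \<open>One step of the reflected walk \<open>u \<mapsto> max (u - y) 0\<close>. Its square grows by less than \<open>\<sigma>\<^sup>2\<close> on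
  average near \<open>0\<close>; shifting by \<open>\<sigma>\<close> before squaring makes up for this loss.\<close>
lemma nn_integral_normal_reflected_step:
  assumes "\<sigma> > 0" "0 \<le> u"
  shows "ennreal ((u + \<sigma>)\<^sup>2 + \<sigma>\<^sup>2) \<le> (\<integral>\<^sup>+y. ennreal (normal_density 0 \<sigma> y) * ennreal ((max (u - y) 0 + \<sigma>)\<^sup>2) \<partial>lborel)"
proof -
  let ?\<phi> = "normal_density 0 \<sigma>"
  let ?w = "\<lambda>z. 2 * \<sigma> * z - z\<^sup>2"
  define K where "K = exp (- u\<^sup>2 / (2 * \<sigma>\<^sup>2)) * exp (- 2 * u / \<sigma>)"
  \<comment> \<open>\<open>q\<close> is what the reflection adds, under the density, to the
    unreflected square \<open>(u - y + \<sigma>)\<^sup>2\<close>. The latter has mean exactly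
    \<open>(u + \<sigma>)\<^sup>2 + \<sigma>\<^sup>2\<close>, so only the sign of the integral of
    \<open>q\<close> matters.\<close>
  define q where "q y = ?\<phi> y * ?w (y - u) * indicator {u<..} y" for y
  have m1: "has_bochner_integral lborel (\<lambda>y. ?\<phi> y * y) 0"
    using normal_moment_nz_1[OF assms(1), of 0] by simp
  have m2: "has_bochner_integral lborel (\<lambda>y. ?\<phi> y * y\<^sup>2) (\<sigma>\<^sup>2)"
    using normal_moment_even[OF assms(1), of 0 1] by simp
  have m0: "has_bochner_integral lborel ?\<phi> 1"
    using assms by (simp add: has_bochner_integral_iff)
  have quad: "has_bochner_integral lborel (\<lambda>y. ?\<phi> y * (a + b * y + c * y\<^sup>2)) (a + c * \<sigma>\<^sup>2)" for a b c
  proof -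
    have "has_bochner_integral lborel (\<lambda>y. ?\<phi> y * a + (?\<phi> y * y) * b + (?\<phi> y * y\<^sup>2) * c) (1 * a + 0 * b + \<sigma>\<^sup>2 * c)"
      by (intro has_bochner_integral_add has_bochner_integral_mult_left m0 m1 m2)
    then show ?thesis by (simp add: algebra_simps)
  qed
  have "?w (y - u) = (- 2 * \<sigma> * u - u\<^sup>2) + (2 * \<sigma> + 2 * u) * y + (- 1) * y\<^sup>2" for y
    by (simp add: algebra_simps power2_eq_square)
  then have int_q: "integrable lborel q"
    unfolding q_def using quad
    by (intro integrable_real_mult_indicator) (simp_all only: has_bochner_integral_iff, auto)
  \<comment> \<open>Compared with u = 0 the density carries the factor exp(-u z / \<sigma>^2),
    nonincreasing in z, while the weight turns from positive to negative at z = 2 \<sigma>. Freezing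
    the factor at that point, as exp(-2 u / \<sigma>), lowers the integrand on both sides of
    it.\<close>
  have lower: "K * (?\<phi> z * ?w z * indicator {0<..} z) \<le> q (u + z)" for z
  proof (cases "z > 0")
    case True
    have "exp (- 2 * u / \<sigma>) * (2 * \<sigma> - z) \<le> exp (- u * z / \<sigma>\<^sup>2) * (2 * \<sigma> - z)"
    proof (cases "z \<le> 2 * \<sigma>")
      case True
      then have "u * z \<le> u * (2 * \<sigma>)" using assms by (intro mult_left_mono) auto
      then have "- 2 * u / \<sigma> \<le> - u * z / \<sigma>\<^sup>2" using assms by (simp add: field_simps power2_eq_square)
      then show ?thesis using True by (intro mult_right_mono) auto
    next
      case False
      then have "u * (2 * \<sigma>) \<le> u * z" using assms by (intro mult_left_mono) auto
      then have "- u * z / \<sigma>\<^sup>2 \<le> - 2 * u / \<sigma>" using assms by (simp add: field_simps power2_eq_square)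
      then show ?thesis using False by (intro mult_right_mono_neg) auto
    qed
    then have "(?\<phi> z * exp (- u\<^sup>2 / (2 * \<sigma>\<^sup>2)) * z) * (exp (- 2 * u / \<sigma>) * (2 * \<sigma> - z))
        \<le> (?\<phi> z * exp (- u\<^sup>2 / (2 * \<sigma>\<^sup>2)) * z) * (exp (- u * z / \<sigma>\<^sup>2) * (2 * \<sigma> - z))"
      using True by (intro mult_left_mono) auto
    then show ?thesis
      using True by (simp add: q_def K_def normal_density_shift[OF assms(1)] power2_eq_square algebra_simps)
  qed (simp add: q_def)
  have "0 \<le> K * (\<integral>z. ?\<phi> z * ?w z * indicator {0<..} z \<partial>lborel)"
    using normal_pos_part_weight(2)[OF assms(1)] by (simp add: K_def)
  also have "\<dots> = (\<integral>z. K * (?\<phi> z * ?w z * indicator {0<..} z) \<partial>lborel)" by simp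
  also have "\<dots> \<le> (\<integral>z. q (u + 1 * z) \<partial>lborel)"
    using lower normal_pos_part_weight(1)[OF assms(1)] int_q
    by (intro integral_mono) (simp_all add: lborel_integrable_real_affine[of q 1 u, simplified])
  also have "\<dots> = (\<integral>y. q y \<partial>lborel)"
    by (subst (2) lborel_integral_real_affine[of 1 _ u]) auto
  finally have q_ge: "0 \<le> (\<integral>y. q y \<partial>lborel)" .
  have "has_bochner_integral lborel (\<lambda>y. ?\<phi> y * ((u + \<sigma>)\<^sup>2 + (- 2 * (u + \<sigma>)) * y + 1 * y\<^sup>2) + q y)
     ((u + \<sigma>)\<^sup>2 + 1 * \<sigma>\<^sup>2 + (\<integral>y. q y \<partial>lborel))"
    using int_q by (intro has_bochner_integral_add quad) (simp add: has_bochner_integral_iff)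
  moreover have "?\<phi> y * ((u + \<sigma>)\<^sup>2 + (- 2 * (u + \<sigma>)) * y + 1 * y\<^sup>2) + q y = ?\<phi> y * (max (u - y) 0 + \<sigma>)\<^sup>2" for y
    by (auto simp: q_def indicator_def max_def power2_eq_square algebra_simps)
  ultimately have "has_bochner_integral lborel (\<lambda>y. ?\<phi> y * (max (u - y) 0 + \<sigma>)\<^sup>2) ((u + \<sigma>)\<^sup>2 + \<sigma>\<^sup>2 + (\<integral>y. q y \<partial>lborel))"
    by simp
  then have "(\<integral>\<^sup>+y. ennreal (?\<phi> y * (max (u - y) 0 + \<sigma>)\<^sup>2) \<partial>lborel) = ennreal ((u + \<sigma>)\<^sup>2 + \<sigma>\<^sup>2 + (\<integral>y. q y \<partial>lborel))"
    by (subst nn_integral_eq_integral) (auto simp: has_bochner_integral_iff)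
  moreover have "ennreal ((u + \<sigma>)\<^sup>2 + \<sigma>\<^sup>2) \<le> ennreal ((u + \<sigma>)\<^sup>2 + \<sigma>\<^sup>2 + (\<integral>y. q y \<partial>lborel))"
    using q_ge by (intro ennreal_leI) simp
  ultimately show ?thesis by (simp add: ennreal_mult)
qed

text \<open>With S the partial sums of \<open>x\<close>, this is the maximum of S_i over i \<le> k
  minus S_k. For the negated steps it is the drawup, S_k minus the minimum, and the two add up to
  the range.\<close>

primrec drawdown :: "(nat \<Rightarrow> real) \<Rightarrow> nat \<Rightarrow> real" where
  "drawdown x 0 = 0"
| "drawdown x (Suc k) = max (drawdown x k - x k) 0"

lemma drawdown_cong: "(\<And>i. i < k \<Longrightarrow> x i = y i) \<Longrightarrow> drawdown x k = drawdown y k"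
  by (induction k) auto

lemma drawdown_nonneg: "0 \<le> drawdown x k"
  by (cases k) auto

lemma drawdown_attained: "\<exists>i\<le>k. drawdown x k = (\<Sum>j<i. x j) - (\<Sum>j<k. x j)"
proof (induction k)
  case (Suc k)
  then obtain i where "i \<le> k" "drawdown x k = (\<Sum>j<i. x j) - (\<Sum>j<k. x j)" by blast
  then show ?case
  proof (cases "drawdown x k - x k \<ge> 0")
    case True
    with \<open>i \<le> k\<close> \<open>drawdown x k = _\<close> show ?thesis by (intro exI[of _ i]) auto
  next
    case False
    then show ?thesis by (intro exI[of _ "Suc k"]) auto
  qed
qed simp

lemma measurable_drawdown:
  "k \<le> m \<Longrightarrow> (\<lambda>x. drawdown x k) \<in> borel_measurable (\<Pi>\<^sub>M i\<in>{..<m}. borel)"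
  by (induction k) auto

locale gaussian_walk = prob_space M for M :: "'w measure" +
  fixes X :: "nat \<Rightarrow> 'w \<Rightarrow> real" and n :: nat and \<sigma> :: real
  assumes sigma_pos: "0 < \<sigma>"
    and indep: "indep_vars (\<lambda>_. borel) X {..<n}"
    and normal: "\<And>i. i < n \<Longrightarrow> distributed M lborel (X i) (normal_density 0 \<sigma>)"
begin

lemma measurable_step: "i < n \<Longrightarrow> X i \<in> borel_measurable M"
  using normal[of i] by (auto simp: distributed_def)

lemma measurable_sum: "k \<le> n \<Longrightarrow> (\<lambda>\<omega>. \<Sum>i<k. X i \<omega>) \<in> borel_measurable M"
  by (intro borel_measurable_sum measurable_step) auto

lemma gaussian_walk_uminus: "gaussian_walk M (\<lambda>i \<omega>. - X i \<omega>) n \<sigma>"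
proof
  show "indep_vars (\<lambda>_. borel) (\<lambda>i \<omega>. - X i \<omega>) {..<n}"
    using indep_vars_compose2[OF indep, of "\<lambda>_ x. - x" "\<lambda>_. borel"] by simp
  show "distributed M lborel (\<lambda>\<omega>. - X i \<omega>) (normal_density 0 \<sigma>)" if "i < n" for i
    using normal_density_affine[OF normal[OF that] sigma_pos, of "-1" 0] by simp
qed (rule sigma_pos)

lemma normal_block:
  assumes "a < b" "b \<le> n"
  shows "distributed M lborel (\<lambda>\<omega>. \<Sum>i\<in>{a..<b}. X i \<omega>) (normal_density 0 (\<sigma> * sqrt (real (b - a))))"
proof -
  have "distributed M lborel (\<lambda>\<omega>. \<Sum>i\<in>{a..<b}. X i \<omega>)
      (normal_density (\<Sum>i\<in>{a..<b}. 0) (sqrt (\<Sum>i\<in>{a..<b}. \<sigma>\<^sup>2)))"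
    using assms sigma_pos by (intro sum_indep_normal indep_vars_subset[OF indep] normal) auto
  moreover have "sqrt (\<Sum>i\<in>{a..<b}. \<sigma>\<^sup>2) = \<sigma> * sqrt (real (b - a))"
    using sigma_pos by (simp add: real_sqrt_mult del: of_nat_diff)
  ultimately show ?thesis by simp
qed

end

section \<open>Levy's maximal inequality\<close>

lemma (in prob_space) prob_normal_nonneg:
  assumes Y: "distributed M lborel Y (normal_density 0 s)" and "s > 0"
  shows "1 / 2 \<le> prob {\<omega>\<in>space M. 0 \<le> Y \<omega>}"
proof -
  have [measurable]: "Y \<in> borel_measurable M" using Y by (auto simp: distributed_def)
  have Y': "distributed M lborel (\<lambda>\<omega>. - Y \<omega>) (normal_density 0 s)"
    using normal_density_affine[OF Y \<open>s > 0\<close>, of "-1" 0] by simp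
  have "distr M lborel Y = distr M lborel (\<lambda>\<omega>. - Y \<omega>)"
    using Y Y' by (simp add: distributed_distr_eq_density)
  then have "measure (distr M lborel Y) {0..} = measure (distr M lborel (\<lambda>\<omega>. - Y \<omega>)) {0..}" by simp
  then have "prob {\<omega>\<in>space M. 0 \<le> Y \<omega>} = prob {\<omega>\<in>space M. Y \<omega> \<le> 0}"
    by (simp add: measure_distr vimage_def Int_def conj_commute)
  moreover have "{\<omega>\<in>space M. 0 \<le> Y \<omega>} \<union> {\<omega>\<in>space M. Y \<omega> \<le> 0} = space M"
    by auto
  then have "prob ({\<omega>\<in>space M. 0 \<le> Y \<omega>} \<union> {\<omega>\<in>space M. Y \<omega> \<le> 0}) = 1"
    by (simp only: prob_space)
  moreover have "prob ({\<omega>\<in>space M. 0 \<le> Y \<omega>} \<union> {\<omega>\<in>space M. Y \<omega> \<le> 0})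
      \<le> prob {\<omega>\<in>space M. 0 \<le> Y \<omega>} + prob {\<omega>\<in>space M. Y \<omega> \<le> 0}"
    by (rule measure_Un_le) measurable
  ultimately show ?thesis by linarith
qed

context gaussian_walk
begin

text \<open>Decompose at the first passage time above \<open>a\<close>; the remaining increment
  is independent of the past and nonnegative with probability at least one half.\<close>
lemma prob_max_le:
  assumes "0 \<le> a"
  shows "prob {\<omega>\<in>space M. \<exists>k\<le>n. a < (\<Sum>i<k. X i \<omega>)} \<le> 2 * prob {\<omega>\<in>space M. a < (\<Sum>i<n. X i \<omega>)}"
proof -
  \<comment> \<open>\<open>F k\<close> is the first-passage event on the space of the first
    \<open>k\<close> steps and \<open>A k\<close> its preimage; independence speaks about such sets
    of step sequences.\<close>
  define F where "F (k::nat) = {x \<in> space (\<Pi>\<^sub>M i\<in>{..<k}. borel :: real measure). (\<forall>j<k. (\<Sum>i<j. x i) \<le> a) \<and> a < (\<Sum>i<k. x i)}" for k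
  define A where "A k = {\<omega>\<in>space M. (\<forall>j<k. (\<Sum>i<j. X i \<omega>) \<le> a) \<and> a < (\<Sum>i<k. X i \<omega>)}" for k
  define G where "G k = {\<omega>\<in>space M. 0 \<le> (\<Sum>i\<in>{k..<n}. X i \<omega>)}" for k
  have A: "A k \<in> events" if "k \<le> n" for k
  proof -
    have sum: "(\<lambda>\<omega>. \<Sum>i<j. X i \<omega>) \<in> borel_measurable M" if "j \<le> k" for j
      using that \<open>k \<le> n\<close> by (intro measurable_sum) simp
    have "{\<omega>\<in>space M. \<forall>j\<in>{..<k}. (\<Sum>i<j. X i \<omega>) \<le> a} \<in> events"
      by (intro sets.sets_Collect_finite_All borel_measurable_le borel_measurable_const sum) auto
    moreover have "{\<omega>\<in>space M. a < (\<Sum>i<k. X i \<omega>)} \<in> events"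
      by (intro borel_measurable_less borel_measurable_const sum) auto
    moreover have "A k = {\<omega>\<in>space M. \<forall>j\<in>{..<k}. (\<Sum>i<j. X i \<omega>) \<le> a} \<inter> {\<omega>\<in>space M. a < (\<Sum>i<k. X i \<omega>)}"
      by (auto simp: A_def)
    ultimately show ?thesis by auto
  qed
  have G: "G k \<in> events" for k
    unfolding G_def by (intro borel_measurable_le borel_measurable_sum measurable_step) auto
  have F: "F k \<in> sets (\<Pi>\<^sub>M i\<in>{..<k}. borel)" for k
  proof -
    let ?P = "\<Pi>\<^sub>M i\<in>{..<k}. borel :: real measure"
    have sum: "(\<lambda>x. \<Sum>i<j. x i) \<in> borel_measurable ?P" if "j \<le> k" for j
      using that by (intro borel_measurable_sum measurable_component_singleton) auto
    have "{x\<in>space ?P. \<forall>j\<in>{..<k}. (\<Sum>i<j. x i) \<le> a} \<in> sets ?P"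
      by (intro sets.sets_Collect_finite_All borel_measurable_le borel_measurable_const sum) auto
    moreover have "{x\<in>space ?P. a < (\<Sum>i<k. x i)} \<in> sets ?P"
      by (intro borel_measurable_less borel_measurable_const sum) auto
    moreover have "F k = {x\<in>space ?P. \<forall>j\<in>{..<k}. (\<Sum>i<j. x i) \<le> a} \<inter> {x\<in>space ?P. a < (\<Sum>i<k. x i)}"
      by (auto simp: F_def)
    ultimately show ?thesis by auto
  qed
  have half: "prob (A k) \<le> 2 * prob (A k \<inter> G k)" if "k \<le> n" for k
  proof (cases "k = n")
    \<comment> \<open>The remaining increment is an empty sum here and has no normal density, but
      \<open>G k\<close> is then the whole space.\<close>
    case True
    then have "G k = space M" by (simp add: G_def)
    moreover have "A k \<subseteq> space M" using A[OF that] by (rule sets.sets_into_space)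
    ultimately have "A k \<inter> G k = A k" by blast
    then show ?thesis by simp
  next
    case False
    with that have "k < n" by simp
    have "indep_var (PiM {..<k} (\<lambda>_. borel)) (\<lambda>\<omega>. restrict (\<lambda>i. X i \<omega>) {..<k})
       (PiM {k..<n} (\<lambda>_. borel)) (\<lambda>\<omega>. restrict (\<lambda>i. X i \<omega>) {k..<n})"
      using that by (intro indep_var_restrict[OF indep]) auto
    from indep_varD[OF this F, of "{x \<in> space (PiM {k..<n} (\<lambda>_. borel)). 0 \<le> (\<Sum>i\<in>{k..<n}. x i)}"]
    have "prob ((\<lambda>\<omega>. (restrict (\<lambda>i. X i \<omega>) {..<k}, restrict (\<lambda>i. X i \<omega>) {k..<n})) -`
        (F k \<times> {x \<in> space (PiM {k..<n} (\<lambda>_. borel)). 0 \<le> (\<Sum>i\<in>{k..<n}. x i)}) \<inter> space M)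
      = prob ((\<lambda>\<omega>. restrict (\<lambda>i. X i \<omega>) {..<k}) -` F k \<inter> space M) *
        prob ((\<lambda>\<omega>. restrict (\<lambda>i. X i \<omega>) {k..<n}) -` {x \<in> space (PiM {k..<n} (\<lambda>_. borel)). 0 \<le> (\<Sum>i\<in>{k..<n}. x i)} \<inter> space M)"
      by measurable
    moreover have "(\<lambda>\<omega>. restrict (\<lambda>i. X i \<omega>) {..<k}) -` F k \<inter> space M = A k"
      by (auto simp: F_def A_def space_PiM cong: sum.cong_simp conj_cong)
    moreover have "(\<lambda>\<omega>. restrict (\<lambda>i. X i \<omega>) {k..<n}) -` {x \<in> space (PiM {k..<n} (\<lambda>_. borel)). 0 \<le> (\<Sum>i\<in>{k..<n}. x i)} \<inter> space M = G k"
      by (auto simp: G_def space_PiM)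
    moreover have "(\<lambda>\<omega>. (restrict (\<lambda>i. X i \<omega>) {..<k}, restrict (\<lambda>i. X i \<omega>) {k..<n})) -`
        (F k \<times> {x \<in> space (PiM {k..<n} (\<lambda>_. borel)). 0 \<le> (\<Sum>i\<in>{k..<n}. x i)}) \<inter> space M = A k \<inter> G k"
      by (auto simp: G_def F_def A_def space_PiM cong: sum.cong_simp conj_cong)
    ultimately have "prob (A k \<inter> G k) = prob (A k) * prob (G k)" by (simp only:)
    moreover have "1 / 2 \<le> prob (G k)"
      unfolding G_def
    proof (rule prob_normal_nonneg)
      show "distributed M lborel (\<lambda>\<omega>. \<Sum>i\<in>{k..<n}. X i \<omega>) (normal_density 0 (\<sigma> * sqrt (real (n - k))))"
        by (rule normal_block[OF \<open>k < n\<close> order_refl])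
      show "0 < \<sigma> * sqrt (real (n - k))" using sigma_pos \<open>k < n\<close> by simp
    qed
    ultimately show ?thesis
      using mult_left_mono[of "1/2" "prob (G k)" "2 * prob (A k)"] by simp
  qed
  have disj: "disjoint_family_on (\<lambda>k. A k \<inter> G k) {..n}"
    unfolding disjoint_family_on_def
  proof (intro ballI impI)
    have "A i \<inter> A j = {}" if "i < j" for i j
    proof -
      have "a < (\<Sum>l<i. X l \<omega>)" "(\<Sum>l<i. X l \<omega>) \<le> a" if "\<omega> \<in> A i" "\<omega> \<in> A j" for \<omega>
        using that \<open>i < j\<close> unfolding A_def by blast+
      then show ?thesis by (meson disjoint_iff not_less)
    qed
    then have "A i \<inter> A j = {}" if "i \<noteq> j" for i j
      using that by (metis Int_commute linorder_neqE_nat)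
    then show "A i \<inter> G i \<inter> (A j \<inter> G j) = {}" if "i \<noteq> j" for i j
      using that by blast
  qed
  have "{\<omega>\<in>space M. \<exists>k\<le>n. a < (\<Sum>i<k. X i \<omega>)} \<subseteq> (\<Union>k\<in>{..n}. A k)"
  proof
    fix \<omega> assume \<omega>: "\<omega> \<in> {\<omega>\<in>space M. \<exists>k\<le>n. a < (\<Sum>i<k. X i \<omega>)}"
    define k where "k = (LEAST k. a < (\<Sum>i<k. X i \<omega>))"
    have "a < (\<Sum>i<k. X i \<omega>)" using \<omega> unfolding k_def by (auto intro: LeastI)
    moreover have "k \<le> n" using \<omega> unfolding k_def by (auto intro: Least_le order_trans)
    moreover have "(\<Sum>i<j. X i \<omega>) \<le> a" if "j < k" for j
      using not_less_Least[of j "\<lambda>k. a < (\<Sum>i<k. X i \<omega>)"] that by (simp add: k_def)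
    ultimately show "\<omega> \<in> (\<Union>k\<in>{..n}. A k)" using \<omega> by (auto simp: A_def)
  qed
  then have "prob {\<omega>\<in>space M. \<exists>k\<le>n. a < (\<Sum>i<k. X i \<omega>)} \<le> prob (\<Union>k\<in>{..n}. A k)"
    using A by (intro finite_measure_mono) auto
  also have "\<dots> \<le> (\<Sum>k\<in>{..n}. prob (A k))"
    using A by (intro finite_measure_subadditive_finite) auto
  also have "\<dots> \<le> (\<Sum>k\<in>{..n}. 2 * prob (A k \<inter> G k))"
    by (intro sum_mono half) simp
  also have "\<dots> = 2 * prob (\<Union>k\<in>{..n}. A k \<inter> G k)"
    using disj A G by (subst finite_measure_finite_Union) (auto simp: sum_distrib_left)
  also have "prob (\<Union>k\<in>{..n}. A k \<inter> G k) \<le> prob {\<omega>\<in>space M. a < (\<Sum>i<n. X i \<omega>)}"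
  proof (intro finite_measure_mono subsetI)
    fix \<omega> assume "\<omega> \<in> (\<Union>k\<in>{..n}. A k \<inter> G k)"
    then obtain k where k: "k \<le> n" "\<omega> \<in> space M" "a < (\<Sum>i<k. X i \<omega>)" "0 \<le> (\<Sum>i\<in>{k..<n}. X i \<omega>)"
      by (auto simp: A_def G_def)
    have "(\<Sum>i<n. X i \<omega>) = (\<Sum>i<k. X i \<omega>) + (\<Sum>i\<in>{k..<n}. X i \<omega>)"
      using k(1) by (simp add: sum.atLeastLessThan_concat lessThan_atLeast0)
    with k show "\<omega> \<in> {\<omega>\<in>space M. a < (\<Sum>i<n. X i \<omega>)}" by auto
  next
    show "{\<omega>\<in>space M. a < (\<Sum>i<n. X i \<omega>)} \<in> events"
      by (intro borel_measurable_less borel_measurable_const measurable_sum) simp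
  qed
  finally show ?thesis by simp
qed

text \<open>\<open>ennreal\<close> keeps the positive part of the sum, and by symmetry twice its
  mean is the mean absolute value.\<close>

lemma nn_integral_end_pos_part:
  "2 * (\<integral>\<^sup>+\<omega>. ennreal (\<Sum>i<n. X i \<omega>) \<partial>M) = ennreal (\<sigma> * sqrt n * sqrt (2 / pi))"
proof (cases "n = 0")
  case False
  define s where "s = \<sigma> * sqrt n"
  have "s > 0" using False sigma_pos by (simp add: s_def)
  define Y where "Y \<omega> = (\<Sum>i<n. X i \<omega>)" for \<omega>
  have Y: "distributed M lborel Y (normal_density 0 s)"
    using normal_block[of 0 n] False by (simp add: s_def Y_def[abs_def] lessThan_atLeast0)
  then have Y': "distributed M lborel (\<lambda>\<omega>. - Y \<omega>) (normal_density 0 s)"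
    using normal_density_affine[OF Y \<open>s > 0\<close>, of "-1" 0] by simp
  have [measurable]: "Y \<in> borel_measurable M" unfolding Y_def by (rule measurable_sum) simp
  have "(\<integral>\<^sup>+\<omega>. ennreal (Y \<omega>) \<partial>M) = (\<integral>\<^sup>+\<omega>. ennreal (- Y \<omega>) \<partial>M)"
    using distributed_nn_integral[OF Y, of ennreal] distributed_nn_integral[OF Y', of ennreal] by simp
  then have "2 * (\<integral>\<^sup>+\<omega>. ennreal (Y \<omega>) \<partial>M) = (\<integral>\<^sup>+\<omega>. ennreal (Y \<omega>) + ennreal (- Y \<omega>) \<partial>M)"
    by (simp add: nn_integral_add mult_2)
  also have "\<dots> = (\<integral>\<^sup>+\<omega>. ennreal \<bar>Y \<omega>\<bar> \<partial>M)"
    by (intro nn_integral_cong) (auto simp: abs_if ennreal_neg)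
  also have "\<dots> = (\<integral>\<^sup>+y. ennreal (normal_density 0 s y) * ennreal \<bar>y\<bar> \<partial>lborel)"
    by (rule distributed_nn_integral[OF Y, symmetric]) simp
  also have "\<dots> = ennreal (s * sqrt (2 / pi))"
    using has_bochner_integral_normal_abs[OF \<open>s > 0\<close>]
    by (simp add: nn_integral_eq_integral has_bochner_integral_iff flip: ennreal_mult)
  finally show ?thesis by (simp add: Y_def s_def)
qed simp

text \<open>The tail inequality is integrated over all levels; its factor 2 turns the positive part
  of the last partial sum into the absolute value.\<close>

lemma nn_integral_max_le:
  "(\<integral>\<^sup>+\<omega>. (SUP k\<in>{..n}. ennreal (\<Sum>i<k. X i \<omega>)) \<partial>M) \<le> ennreal (\<sigma> * sqrt n * sqrt (2 / pi))"
proof -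
  have [measurable]: "(\<lambda>\<omega>. SUP k\<in>{..n}. ennreal (\<Sum>i<k. X i \<omega>)) \<in> borel_measurable M"
    by (intro borel_measurable_SUP measurable_compose[OF measurable_sum]) auto
  have [measurable]: "(\<lambda>\<omega>. \<Sum>i<n. X i \<omega>) \<in> borel_measurable M" by (rule measurable_sum) simp
  have sf: "sigma_finite_measure M" by unfold_locales
  have "(\<integral>\<^sup>+\<omega>. (SUP k\<in>{..n}. ennreal (\<Sum>i<k. X i \<omega>)) \<partial>M)
     = (\<integral>\<^sup>+t. indicator {0<..} t * emeasure M {\<omega>\<in>space M. ennreal t < (SUP k\<in>{..n}. ennreal (\<Sum>i<k. X i \<omega>))} \<partial>lborel)"
    by (rule nn_integral_layer_cake(1)[OF sf]) measurable
  also have "\<dots> \<le> (\<integral>\<^sup>+t. 2 * (indicator {0<..} t * emeasure M {\<omega>\<in>space M. ennreal t < ennreal (\<Sum>i<n. X i \<omega>)}) \<partial>lborel)"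
  proof (rule nn_integral_mono)
    fix t :: real
    show "indicator {0<..} t * emeasure M {\<omega>\<in>space M. ennreal t < (SUP k\<in>{..n}. ennreal (\<Sum>i<k. X i \<omega>))}
       \<le> 2 * (indicator {0<..} t * emeasure M {\<omega>\<in>space M. ennreal t < ennreal (\<Sum>i<n. X i \<omega>)})"
    proof (cases "0 < t")
      case True
      have "emeasure M {\<omega>\<in>space M. ennreal t < (SUP k\<in>{..n}. ennreal (\<Sum>i<k. X i \<omega>))}
         = prob {\<omega>\<in>space M. \<exists>k\<le>n. t < (\<Sum>i<k. X i \<omega>)}"
        using True by (auto simp: emeasure_eq_measure less_SUP_iff ennreal_less_iff intro!: arg_cong[where f=prob])
      also have "\<dots> \<le> ennreal (2 * prob {\<omega>\<in>space M. t < (\<Sum>i<n. X i \<omega>)})"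
        using True by (intro ennreal_leI prob_max_le) simp
      also have "\<dots> = 2 * emeasure M {\<omega>\<in>space M. ennreal t < ennreal (\<Sum>i<n. X i \<omega>)}"
        using True by (simp add: emeasure_eq_measure ennreal_less_iff ennreal_mult)
      finally show ?thesis using True by simp
    qed simp
  qed
  also have "\<dots> = 2 * (\<integral>\<^sup>+t. indicator {0<..} t * emeasure M {\<omega>\<in>space M. ennreal t < ennreal (\<Sum>i<n. X i \<omega>)} \<partial>lborel)"
    by (rule nn_integral_cmult) measurable
  also have "\<dots> = ennreal (\<sigma> * sqrt n * sqrt (2 / pi))"
    by (subst nn_integral_layer_cake(1)[OF sf, symmetric]) (auto simp: nn_integral_end_pos_part)
  finally show ?thesis .
qed

end

section \<open>Exit of the range of a walk\<close>

abbreviation (input) drawrange :: "(nat \<Rightarrow> real) \<Rightarrow> nat \<Rightarrow> real" where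
  "drawrange x k \<equiv> drawdown x k + drawdown (\<lambda>i. - x i) k"

lemma drawrange_le:
  assumes "\<And>i j. i \<le> k \<Longrightarrow> j \<le> k \<Longrightarrow> (\<Sum>l<i. x l) - (\<Sum>l<j. x l) \<le> c"
  shows "drawrange x k \<le> c"
proof -
  obtain i where "i \<le> k" "drawdown x k = (\<Sum>l<i. x l) - (\<Sum>l<k. x l)"
    using drawdown_attained by blast
  moreover obtain j where "j \<le> k" "drawdown (\<lambda>i. - x i) k = (\<Sum>l<k. x l) - (\<Sum>l<j. x l)"
    using drawdown_attained[of k "\<lambda>i. - x i"] by (auto simp: sum_negf)
  ultimately show ?thesis using assms[of i j] by simp
qed

lemma drawrange_Suc:
  "drawrange x k \<le> drawrange x (Suc k)" "drawrange x (Suc k) \<le> drawrange x k + \<bar>x k\<bar>"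
  using drawdown_nonneg[of x k] drawdown_nonneg[of "\<lambda>i. - x i" k] by auto

text \<open>A discrete substitute for the sum of the squared drawdown and drawup. The shift, taken
  as the standard deviation of a step, secures a mean gain of at least
  \<open>2 * \<sigma>\<^sup>2\<close> per step in spite of the reflection.\<close>

definition potential :: "real \<Rightarrow> (nat \<Rightarrow> real) \<Rightarrow> nat \<Rightarrow> real" where
  "potential \<sigma> x k = (drawdown x k + \<sigma>)\<^sup>2 + (drawdown (\<lambda>i. - x i) k + \<sigma>)\<^sup>2"

lemma potential_nonneg: "0 \<le> potential \<sigma> x k"
  by (simp add: potential_def)

text \<open>The squares are merged by p^2 + q^2 \<le> (p + q)^2. Nothing is lost in the limit: the
  range grows only at a new extremum, and there one of drawdown and drawup is 0.\<close>

lemma potential_le: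
  assumes "0 \<le> \<sigma>" "drawrange x k \<le> r"
  shows "potential \<sigma> x k \<le> (r + 2 * \<sigma>)\<^sup>2"
proof -
  have sq: "p\<^sup>2 + q\<^sup>2 \<le> (p + q)\<^sup>2" if "0 \<le> p" "0 \<le> q" for p q :: real
    using that by (simp add: power2_sum)
  have "potential \<sigma> x k \<le> (drawdown x k + \<sigma> + (drawdown (\<lambda>i. - x i) k + \<sigma>))\<^sup>2"
    unfolding potential_def using assms(1) by (intro sq add_nonneg_nonneg drawdown_nonneg)
  also have "\<dots> \<le> (r + 2 * \<sigma>)\<^sup>2"
    using drawdown_nonneg[of x k] drawdown_nonneg[of "\<lambda>i. - x i" k] assms by (intro power_mono) auto
  finally show ?thesis .
qed

text \<open>An overshoot \<open>y\<close> up to \<open>\<eta>\<close> is absorbed into the first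
  square. A larger one satisfies 1 + 2 \<sigma> \<le> 3 y / \<eta>, and one more factor y / \<eta>
  \<ge> 1 raises the square to a fourth power, whose mean is of smaller order in the mesh.\<close>

lemma square_overshoot_le:
  fixes \<eta> \<sigma> y :: real
  assumes "0 < \<eta>" "0 \<le> \<sigma>" "\<sigma> \<le> 1" "0 \<le> y"
  shows "(1 + y + 2 * \<sigma>)\<^sup>2 \<le> (1 + 2 * \<sigma> + \<eta>)\<^sup>2 + (3 / \<eta> + 1)\<^sup>2 / \<eta>\<^sup>2 * y ^ 4"
proof (cases "y \<le> \<eta>")
  case True
  then have "(1 + y + 2 * \<sigma>)\<^sup>2 \<le> (1 + 2 * \<sigma> + \<eta>)\<^sup>2" using assms by (intro power_mono) auto
  also have "\<dots> \<le> (1 + 2 * \<sigma> + \<eta>)\<^sup>2 + (3 / \<eta> + 1)\<^sup>2 / \<eta>\<^sup>2 * y ^ 4" by simp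
  finally show ?thesis .
next
  case False
  have "1 \<le> y / \<eta>" using False assms by simp
  have "1 + y + 2 * \<sigma> \<le> 3 * (y / \<eta>) + y" using \<open>1 \<le> y / \<eta>\<close> assms by argo
  also have "\<dots> = (3 / \<eta> + 1) * y" by (simp add: algebra_simps)
  also have "\<dots> \<le> (3 / \<eta> + 1) * y * (y / \<eta>)"
    using mult_left_mono[of 1 "y / \<eta>" "(3 / \<eta> + 1) * y"] \<open>1 \<le> y / \<eta>\<close> assms by simp
  finally have "(1 + y + 2 * \<sigma>)\<^sup>2 \<le> ((3 / \<eta> + 1) * y * (y / \<eta>))\<^sup>2"
    using assms by (intro power_mono) auto
  also have "\<dots> = (3 / \<eta> + 1)\<^sup>2 / \<eta>\<^sup>2 * y ^ 4"
    by (simp add: power_mult_distrib power_divide power2_eq_square power4_eq_xxxx)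
  finally show ?thesis by (simp add: add_increasing)
qed

context
  fixes \<sigma> \<eta> :: real and x :: "nat \<Rightarrow> real"
  assumes "0 < \<eta>" "0 \<le> \<sigma>" "\<sigma> \<le> 1"
begin

text \<open>Exactly one of the indicators on the left is 1, since they telescope to the initial
  value 1. The main constant is thus counted once, while the fourth powers of all steps pay for the
  overshoot.\<close>

lemma stopped_potential_le:
  "of_bool (drawrange x n \<le> 1) * potential \<sigma> x n
    + (\<Sum>k<n. of_bool (drawrange x k \<le> 1 \<and> \<not> drawrange x (Suc k) \<le> 1) * potential \<sigma> x (Suc k))
   \<le> (1 + 2 * \<sigma> + \<eta>)\<^sup>2 + (\<Sum>k<n. (3 / \<eta> + 1)\<^sup>2 / \<eta>\<^sup>2 * x k ^ 4)"
proof -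
  define I :: "nat \<Rightarrow> real" where "I k = of_bool (drawrange x k \<le> 1)" for k
  define B where "B = (1 + 2 * \<sigma> + \<eta>)\<^sup>2"
  define C where "C = (3 / \<eta> + 1)\<^sup>2 / \<eta>\<^sup>2"
  have J: "of_bool (drawrange x k \<le> 1 \<and> \<not> drawrange x (Suc k) \<le> 1) = I k - I (Suc k)" for k
    using drawrange_Suc(1)[of x k] by (auto simp: I_def)
  have "(I k - I (Suc k)) * potential \<sigma> x (Suc k) \<le> (I k - I (Suc k)) * B + C * x k ^ 4" for k
  proof (cases "drawrange x k \<le> 1 \<and> \<not> drawrange x (Suc k) \<le> 1")
    case True
    then have "drawrange x (Suc k) \<le> 1 + \<bar>x k\<bar>" using drawrange_Suc(2)[of x k] by simp
    then have "potential \<sigma> x (Suc k) \<le> (1 + \<bar>x k\<bar> + 2 * \<sigma>)\<^sup>2"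
      using \<open>0 \<le> \<sigma>\<close> by (rule potential_le[rotated])
    also have "\<dots> \<le> B + C * \<bar>x k\<bar> ^ 4"
      unfolding B_def C_def using \<open>0 < \<eta>\<close> \<open>0 \<le> \<sigma>\<close> \<open>\<sigma> \<le> 1\<close> by (intro square_overshoot_le) auto
    finally show ?thesis using True J[of k] by (simp add: power_even_abs)
  next
    case False
    then have eq: "I k - I (Suc k) = 0" using J[of k] by auto
    show ?thesis unfolding eq by (simp add: C_def)
  qed
  then have "(\<Sum>k<n. (I k - I (Suc k)) * potential \<sigma> x (Suc k)) \<le> (\<Sum>k<n. (I k - I (Suc k)) * B + C * x k ^ 4)"
    by (intro sum_mono)
  also have "\<dots> = (I 0 - I n) * B + (\<Sum>k<n. C * x k ^ 4)"
    by (simp add: sum.distrib sum_lessThan_telescope' flip: sum_distrib_right)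
  finally have "(\<Sum>k<n. (I k - I (Suc k)) * potential \<sigma> x (Suc k)) \<le> (I 0 - I n) * B + (\<Sum>k<n. C * x k ^ 4)" .
  moreover have "I n * potential \<sigma> x n \<le> I n * B"
  proof (cases "drawrange x n \<le> 1")
    case True
    then have "potential \<sigma> x n \<le> (1 + 2 * \<sigma>)\<^sup>2" using \<open>0 \<le> \<sigma>\<close> by (rule potential_le[rotated])
    also have "\<dots> \<le> B" unfolding B_def using \<open>0 < \<eta>\<close> \<open>0 \<le> \<sigma>\<close> by (intro power_mono) auto
    finally show ?thesis by (simp add: I_def)
  qed (simp add: I_def)
  moreover have "I 0 = 1" by (simp add: I_def)
  ultimately show ?thesis
    unfolding J I_def[symmetric] B_def[symmetric] C_def[symmetric] by (simp add: algebra_simps)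
qed

end

context gaussian_walk
begin

lemma measurable_drawdown_walk:
  assumes "k \<le> n"
  shows "(\<lambda>\<omega>. drawdown (\<lambda>i. X i \<omega>) k) \<in> borel_measurable M"
  using assms
proof (induction k)
  case (Suc k)
  then have "(\<lambda>\<omega>. drawdown (\<lambda>i. X i \<omega>) k) \<in> borel_measurable M" "X k \<in> borel_measurable M"
    by (auto intro: measurable_step)
  then show ?case unfolding drawdown.simps by measurable
qed simp

lemma measurable_drawup_walk:
  assumes "k \<le> n"
  shows "(\<lambda>\<omega>. drawdown (\<lambda>i. - X i \<omega>) k) \<in> borel_measurable M"
  using gaussian_walk.measurable_drawdown_walk[OF gaussian_walk_uminus assms] .

text \<open>Both components of \<^const>\<open>indep_var\<close> must have the same type, hence the duplicated \<open>X k\<close>.\<close>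
lemma indep_var_drawdown_step:
  assumes "k < n"
  shows "indep_var (borel \<Otimes>\<^sub>M borel) (\<lambda>\<omega>. (drawdown (\<lambda>i. X i \<omega>) k, drawdown (\<lambda>i. - X i \<omega>) k))
    (borel \<Otimes>\<^sub>M borel) (\<lambda>\<omega>. (X k \<omega>, X k \<omega>))"
proof -
  have "indep_var (PiM {..<k} (\<lambda>_. borel)) (\<lambda>\<omega>. restrict (\<lambda>i. X i \<omega>) {..<k})
     (PiM {k} (\<lambda>_. borel)) (\<lambda>\<omega>. restrict (\<lambda>i. X i \<omega>) {k})"
    using assms by (intro indep_var_restrict[OF indep]) auto
  moreover have "(\<lambda>x. (drawdown x k, drawdown (\<lambda>i. - x i) k)) \<in> measurable (PiM {..<k} (\<lambda>_. borel)) (borel \<Otimes>\<^sub>M borel)"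
  proof -
    have "(\<lambda>x. drawdown (\<lambda>i. - x i) j) \<in> borel_measurable (\<Pi>\<^sub>M i\<in>{..<k}. borel)" if "j \<le> k" for j
      using that by (induction j) auto
    then show ?thesis by (intro measurable_Pair measurable_drawdown) auto
  qed
  moreover have "(\<lambda>x. (x k, x k)) \<in> measurable (PiM {k} (\<lambda>_. borel :: real measure)) (borel \<Otimes>\<^sub>M borel)" by measurable
  ultimately have "indep_var (borel \<Otimes>\<^sub>M borel) ((\<lambda>x. (drawdown x k, drawdown (\<lambda>i. - x i) k)) \<circ> (\<lambda>\<omega>. restrict (\<lambda>i. X i \<omega>) {..<k}))
      (borel \<Otimes>\<^sub>M borel) ((\<lambda>x. (x k, x k)) \<circ> (\<lambda>\<omega>. restrict (\<lambda>i. X i \<omega>) {k}))"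
    by (rule indep_var_compose)
  moreover have "((\<lambda>x. (drawdown x k, drawdown (\<lambda>i. - x i) k)) \<circ> (\<lambda>\<omega>. restrict (\<lambda>i. X i \<omega>) {..<k}))
     = (\<lambda>\<omega>. (drawdown (\<lambda>i. X i \<omega>) k, drawdown (\<lambda>i. - X i \<omega>) k))"
    by (auto simp: fun_eq_iff intro!: drawdown_cong)
  moreover have "((\<lambda>x. (x k, x k)) \<circ> (\<lambda>\<omega>. restrict (\<lambda>i. X i \<omega>) {k})) = (\<lambda>\<omega>. (X k \<omega>, X k \<omega>))"
    by (auto simp: fun_eq_iff)
  ultimately show ?thesis by simp
qed

text \<open>Whether the range is still at most 1 is decided by the past. With the past frozen, the
  independent step acts on the drawdown and, negated but with the same law, on the drawup; each
  shifted square gains at least \<sigma>^2 on average.\<close>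

lemma potential_step:
  assumes "k < n"
  shows "(\<integral>\<^sup>+\<omega>. ennreal (of_bool (drawrange (\<lambda>i. X i \<omega>) k \<le> 1) * (potential \<sigma> (\<lambda>i. X i \<omega>) k + 2 * \<sigma>\<^sup>2)) \<partial>M)
    \<le> (\<integral>\<^sup>+\<omega>. ennreal (of_bool (drawrange (\<lambda>i. X i \<omega>) k \<le> 1) * potential \<sigma> (\<lambda>i. X i \<omega>) (Suc k)) \<partial>M)"
proof -
  define f :: "(real \<times> real) \<times> (real \<times> real) \<Rightarrow> ennreal" where
    "f z = ennreal (of_bool (fst (fst z) + snd (fst z) \<le> 1) *
      ((max (fst (fst z) - fst (snd z)) 0 + \<sigma>)\<^sup>2 + (max (snd (fst z) + fst (snd z)) 0 + \<sigma>)\<^sup>2))" for z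
  have [measurable]: "f \<in> borel_measurable ((borel \<Otimes>\<^sub>M borel) \<Otimes>\<^sub>M (borel \<Otimes>\<^sub>M borel))"
    unfolding f_def by measurable
  have [measurable]: "X k \<in> borel_measurable M" by (rule measurable_step[OF assms])
  have Xk: "distributed M lborel (X k) (normal_density 0 \<sigma>)" by (rule normal[OF assms])
  have Xk': "distributed M lborel (\<lambda>\<omega>. - X k \<omega>) (normal_density 0 \<sigma>)"
    using normal_density_affine[OF Xk sigma_pos, of "-1" 0] by simp
  have step: "ennreal ((u + \<sigma>)\<^sup>2 + \<sigma>\<^sup>2) \<le> (\<integral>\<^sup>+\<omega>. ennreal ((max (u - X k \<omega>) 0 + \<sigma>)\<^sup>2) \<partial>M)"
     "ennreal ((u + \<sigma>)\<^sup>2 + \<sigma>\<^sup>2) \<le> (\<integral>\<^sup>+\<omega>. ennreal ((max (u + X k \<omega>) 0 + \<sigma>)\<^sup>2) \<partial>M)" if "0 \<le> u" for u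
  proof -
    note * = nn_integral_normal_reflected_step[OF sigma_pos that]
    have "(\<integral>\<^sup>+y. ennreal (normal_density 0 \<sigma> y) * ennreal ((max (u - y) 0 + \<sigma>)\<^sup>2) \<partial>lborel)
      = (\<integral>\<^sup>+\<omega>. ennreal ((max (u - X k \<omega>) 0 + \<sigma>)\<^sup>2) \<partial>M)"
      by (rule distributed_nn_integral[OF Xk]) measurable
    with * show "ennreal ((u + \<sigma>)\<^sup>2 + \<sigma>\<^sup>2) \<le> (\<integral>\<^sup>+\<omega>. ennreal ((max (u - X k \<omega>) 0 + \<sigma>)\<^sup>2) \<partial>M)" by simp
    have "(\<integral>\<^sup>+y. ennreal (normal_density 0 \<sigma> y) * ennreal ((max (u - y) 0 + \<sigma>)\<^sup>2) \<partial>lborel)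
      = (\<integral>\<^sup>+\<omega>. ennreal ((max (u - - X k \<omega>) 0 + \<sigma>)\<^sup>2) \<partial>M)"
      by (rule distributed_nn_integral[OF Xk']) measurable
    with * show "ennreal ((u + \<sigma>)\<^sup>2 + \<sigma>\<^sup>2) \<le> (\<integral>\<^sup>+\<omega>. ennreal ((max (u + X k \<omega>) 0 + \<sigma>)\<^sup>2) \<partial>M)" by simp
  qed
  have "(\<integral>\<^sup>+\<omega>. ennreal (of_bool (drawrange (\<lambda>i. X i \<omega>) k \<le> 1) * potential \<sigma> (\<lambda>i. X i \<omega>) (Suc k)) \<partial>M)
     = (\<integral>\<^sup>+\<omega>. f ((drawdown (\<lambda>i. X i \<omega>) k, drawdown (\<lambda>i. - X i \<omega>) k), (X k \<omega>, X k \<omega>)) \<partial>M)"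
    by (simp add: f_def potential_def)
  also have "\<dots> = (\<integral>\<^sup>+\<omega>. \<integral>\<^sup>+\<omega>'. f ((drawdown (\<lambda>i. X i \<omega>) k, drawdown (\<lambda>i. - X i \<omega>) k), (X k \<omega>', X k \<omega>')) \<partial>M \<partial>M)"
    by (rule nn_integral_indep_var[OF indep_var_drawdown_step[OF assms]]) measurable
  also have "\<dots> \<ge> (\<integral>\<^sup>+\<omega>. ennreal (of_bool (drawrange (\<lambda>i. X i \<omega>) k \<le> 1) * (potential \<sigma> (\<lambda>i. X i \<omega>) k + 2 * \<sigma>\<^sup>2)) \<partial>M)"
  proof (rule nn_integral_mono)
    fix \<omega>
    let ?u = "drawdown (\<lambda>i. X i \<omega>) k" and ?v = "drawdown (\<lambda>i. - X i \<omega>) k"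
    show "ennreal (of_bool (?u + ?v \<le> 1) * (potential \<sigma> (\<lambda>i. X i \<omega>) k + 2 * \<sigma>\<^sup>2)) \<le> (\<integral>\<^sup>+\<omega>'. f ((?u, ?v), (X k \<omega>', X k \<omega>')) \<partial>M)"
    proof (cases "?u + ?v \<le> 1")
      case True
      have "ennreal (potential \<sigma> (\<lambda>i. X i \<omega>) k + 2 * \<sigma>\<^sup>2) = ennreal ((?u + \<sigma>)\<^sup>2 + \<sigma>\<^sup>2) + ennreal ((?v + \<sigma>)\<^sup>2 + \<sigma>\<^sup>2)"
        by (simp add: potential_def algebra_simps flip: ennreal_plus)
      also have "\<dots> \<le> (\<integral>\<^sup>+\<omega>. ennreal ((max (?u - X k \<omega>) 0 + \<sigma>)\<^sup>2) \<partial>M) + (\<integral>\<^sup>+\<omega>. ennreal ((max (?v + X k \<omega>) 0 + \<sigma>)\<^sup>2) \<partial>M)"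
        by (intro add_mono step drawdown_nonneg)
      also have "\<dots> = (\<integral>\<^sup>+\<omega>'. f ((?u, ?v), (X k \<omega>', X k \<omega>')) \<partial>M)"
        using True by (subst nn_integral_add[symmetric]) (auto simp: f_def)
      finally show ?thesis using True by simp
    qed simp
  qed
  finally show ?thesis .
qed

lemma nn_integral_pow4: "k < n \<Longrightarrow> (\<integral>\<^sup>+\<omega>. ennreal (X k \<omega> ^ 4) \<partial>M) = ennreal (3 * \<sigma> ^ 4)"
proof -
  assume "k < n"
  have "has_bochner_integral lborel (\<lambda>y. normal_density 0 \<sigma> y * y ^ 4) (3 * \<sigma> ^ 4)"
  proof -
    have "fact (2 * 2) / ((2 / \<sigma>\<^sup>2)\<^sup>2 * fact 2) = 3 * \<sigma> ^ 4"
      using sigma_pos by (simp add: fact_numeral power_divide)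
    then show ?thesis using normal_moment_even[OF sigma_pos, of 0 2] by simp
  qed
  then have "(\<integral>\<^sup>+y. ennreal (normal_density 0 \<sigma> y) * ennreal (y ^ 4) \<partial>lborel) = ennreal (3 * \<sigma> ^ 4)"
    by (simp add: nn_integral_eq_integral has_bochner_integral_iff flip: ennreal_mult)
  then show ?thesis
    using distributed_nn_integral[OF normal[OF \<open>k < n\<close>], of "\<lambda>y. ennreal (y ^ 4)"] by simp
qed

text \<open>Optional stopping in discrete form: the sum is the mean number of steps taken while the
  range is at most 1, each adding at least \<open>2 * \<sigma>\<^sup>2\<close> to the mean
  potential, and the stopped potential is bounded up to fourth moments
  \<open>3 * \<sigma> ^ 4\<close>.\<close>

lemma sum_prob_drawrange_le:
  assumes "0 < \<eta>" "\<sigma> \<le> 1"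
  shows "2 * \<sigma>\<^sup>2 * (\<Sum>k<n. prob {\<omega>\<in>space M. drawrange (\<lambda>i. X i \<omega>) k \<le> 1})
    \<le> (1 + 2 * \<sigma> + \<eta>)\<^sup>2 + (3 / \<eta> + 1)\<^sup>2 / \<eta>\<^sup>2 * (3 * n * \<sigma> ^ 4)"
proof -
  define I :: "nat \<Rightarrow> 'w \<Rightarrow> real" where "I k \<omega> = of_bool (drawrange (\<lambda>i. X i \<omega>) k \<le> 1)" for k \<omega>
  define J :: "nat \<Rightarrow> 'w \<Rightarrow> real" where "J k \<omega> = of_bool (drawrange (\<lambda>i. X i \<omega>) k \<le> 1 \<and> \<not> drawrange (\<lambda>i. X i \<omega>) (Suc k) \<le> 1)" for k \<omega>
  define V where "V k \<omega> = potential \<sigma> (\<lambda>i. X i \<omega>) k" for k \<omega>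
  define C where "C = (3 / \<eta> + 1)\<^sup>2 / \<eta>\<^sup>2"
  have C: "C \<ge> 0" by (simp add: C_def)
  have V0: "0 \<le> V k \<omega>" for k \<omega> by (simp add: V_def potential_nonneg)
  have I0: "0 \<le> I k \<omega>" "0 \<le> J k \<omega>" for k \<omega> by (simp_all add: I_def J_def)
  have mV: "V k \<in> borel_measurable M" if "k \<le> n" for k
    unfolding V_def potential_def
    using measurable_drawdown_walk[OF that] measurable_drawup_walk[OF that] by measurable
  have mI: "I k \<in> borel_measurable M" if "k \<le> n" for k
    unfolding I_def
    using measurable_drawdown_walk[OF that] measurable_drawup_walk[OF that] by measurable
  have mJ: "J k \<in> borel_measurable M" if "k < n" for k
  proof -
    have "k \<le> n" "Suc k \<le> n" using that by auto
    note [measurable] = measurable_drawdown_walk[OF \<open>k \<le> n\<close>] measurable_drawup_walk[OF \<open>k \<le> n\<close>]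
      measurable_drawdown_walk[OF \<open>Suc k \<le> n\<close>] measurable_drawup_walk[OF \<open>Suc k \<le> n\<close>]
    show ?thesis unfolding J_def by measurable
  qed
  have mX: "X k \<in> borel_measurable M" if "k < n" for k by (rule measurable_step[OF that])
  have eI: "(\<integral>\<^sup>+\<omega>. ennreal (I k \<omega>) \<partial>M) = ennreal (prob {\<omega>\<in>space M. drawrange (\<lambda>i. X i \<omega>) k \<le> 1})" if "k \<le> n" for k
  proof -
    have "{\<omega>\<in>space M. drawrange (\<lambda>i. X i \<omega>) k \<le> 1} \<in> events"
      using measurable_drawdown_walk[OF that] measurable_drawup_walk[OF that] by measurable
    then have "(\<integral>\<^sup>+\<omega>. indicator {\<omega>\<in>space M. drawrange (\<lambda>i. X i \<omega>) k \<le> 1} \<omega> \<partial>M) = ennreal (prob {\<omega>\<in>space M. drawrange (\<lambda>i. X i \<omega>) k \<le> 1})"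
      by (simp add: emeasure_eq_measure)
    moreover have "(\<integral>\<^sup>+\<omega>. ennreal (I k \<omega>) \<partial>M) = (\<integral>\<^sup>+\<omega>. indicator {\<omega>\<in>space M. drawrange (\<lambda>i. X i \<omega>) k \<le> 1} \<omega> \<partial>M)"
      by (intro nn_integral_cong) (simp add: I_def indicator_def)
    ultimately show ?thesis by simp
  qed
  have step: "(\<integral>\<^sup>+\<omega>. ennreal (I k \<omega> * V k \<omega>) \<partial>M) + ennreal (2 * \<sigma>\<^sup>2 * prob {\<omega>\<in>space M. drawrange (\<lambda>i. X i \<omega>) k \<le> 1})
      \<le> (\<integral>\<^sup>+\<omega>. ennreal (I (Suc k) \<omega> * V (Suc k) \<omega>) \<partial>M) + (\<integral>\<^sup>+\<omega>. ennreal (J k \<omega> * V (Suc k) \<omega>) \<partial>M)" if "k < n" for k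
  proof -
    have [measurable]: "V k \<in> borel_measurable M" "V (Suc k) \<in> borel_measurable M" "I k \<in> borel_measurable M"
      "I (Suc k) \<in> borel_measurable M" "J k \<in> borel_measurable M"
      using that by (auto intro: mV mI mJ)
    have "(\<integral>\<^sup>+\<omega>. ennreal (I k \<omega> * V k \<omega>) \<partial>M) + ennreal (2 * \<sigma>\<^sup>2 * prob {\<omega>\<in>space M. drawrange (\<lambda>i. X i \<omega>) k \<le> 1})
       = (\<integral>\<^sup>+\<omega>. ennreal (I k \<omega> * V k \<omega>) \<partial>M) + (\<integral>\<^sup>+\<omega>. ennreal (2 * \<sigma>\<^sup>2) * ennreal (I k \<omega>) \<partial>M)"
      using that by (subst nn_integral_cmult) (auto simp: eI simp flip: ennreal_mult)
    also have "\<dots> = (\<integral>\<^sup>+\<omega>. ennreal (I k \<omega> * (V k \<omega> + 2 * \<sigma>\<^sup>2)) \<partial>M)"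
      using I0 V0 by (subst nn_integral_add[symmetric]) (auto simp: algebra_simps simp flip: ennreal_mult ennreal_plus intro!: nn_integral_cong)
    also have "\<dots> \<le> (\<integral>\<^sup>+\<omega>. ennreal (I k \<omega> * V (Suc k) \<omega>) \<partial>M)"
      unfolding I_def V_def by (rule potential_step[OF that])
    also have "\<dots> = (\<integral>\<^sup>+\<omega>. ennreal (I (Suc k) \<omega> * V (Suc k) \<omega>) + ennreal (J k \<omega> * V (Suc k) \<omega>) \<partial>M)"
    proof (intro nn_integral_cong)
      fix \<omega>
      have "I k \<omega> = I (Suc k) \<omega> + J k \<omega>"
        using drawrange_Suc(1)[of "\<lambda>i. X i \<omega>" k] by (auto simp: I_def J_def)
      then show "ennreal (I k \<omega> * V (Suc k) \<omega>) = ennreal (I (Suc k) \<omega> * V (Suc k) \<omega>) + ennreal (J k \<omega> * V (Suc k) \<omega>)"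
        using I0 V0 by (simp add: algebra_simps flip: ennreal_plus)
    qed
    also have "\<dots> = (\<integral>\<^sup>+\<omega>. ennreal (I (Suc k) \<omega> * V (Suc k) \<omega>) \<partial>M) + (\<integral>\<^sup>+\<omega>. ennreal (J k \<omega> * V (Suc k) \<omega>) \<partial>M)"
      by (rule nn_integral_add) measurable
    finally show ?thesis .
  qed
  \<comment> \<open>Telescoping by induction inside \<open>ennreal\<close>, without subtracting
    potentials; the \<open>J\<close> terms store the potential at the exit step.\<close>
  have "(\<Sum>k<m. ennreal (2 * \<sigma>\<^sup>2 * prob {\<omega>\<in>space M. drawrange (\<lambda>i. X i \<omega>) k \<le> 1}))
      \<le> (\<integral>\<^sup>+\<omega>. ennreal (I m \<omega> * V m \<omega>) \<partial>M) + (\<Sum>k<m. \<integral>\<^sup>+\<omega>. ennreal (J k \<omega> * V (Suc k) \<omega>) \<partial>M)" if "m \<le> n" for m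
    using that
  proof (induction m)
    case (Suc m)
    let ?p = "\<lambda>k. ennreal (2 * \<sigma>\<^sup>2 * prob {\<omega>\<in>space M. drawrange (\<lambda>i. X i \<omega>) k \<le> 1})"
    let ?b = "\<lambda>k. \<integral>\<^sup>+\<omega>. ennreal (J k \<omega> * V (Suc k) \<omega>) \<partial>M"
    let ?a = "\<lambda>k. \<integral>\<^sup>+\<omega>. ennreal (I k \<omega> * V k \<omega>) \<partial>M"
    have "(\<Sum>k<Suc m. ?p k) \<le> (?a m + (\<Sum>k<m. ?b k)) + ?p m"
      using Suc by (simp add: add_right_mono)
    also have "\<dots> = (?a m + ?p m) + (\<Sum>k<m. ?b k)" by (simp add: ac_simps)
    also have "\<dots> \<le> (?a (Suc m) + ?b m) + (\<Sum>k<m. ?b k)"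
      using Suc.prems by (intro add_right_mono step) simp
    finally show ?case by (simp add: ac_simps)
  qed simp
  from this[of n] have "(\<Sum>k<n. ennreal (2 * \<sigma>\<^sup>2 * prob {\<omega>\<in>space M. drawrange (\<lambda>i. X i \<omega>) k \<le> 1}))
      \<le> (\<integral>\<^sup>+\<omega>. ennreal (I n \<omega> * V n \<omega>) \<partial>M) + (\<Sum>k<n. \<integral>\<^sup>+\<omega>. ennreal (J k \<omega> * V (Suc k) \<omega>) \<partial>M)"
    by simp
  also have "\<dots> = (\<integral>\<^sup>+\<omega>. ennreal (I n \<omega> * V n \<omega>) + (\<Sum>k<n. ennreal (J k \<omega> * V (Suc k) \<omega>)) \<partial>M)"
  proof -
    have *: "(\<lambda>\<omega>. ennreal (J k \<omega> * V (Suc k) \<omega>)) \<in> borel_measurable M" if "k < n" for k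
      using mJ[OF that] mV[OF Suc_leI[OF that]] by measurable
    have "(\<integral>\<^sup>+\<omega>. (\<Sum>k<n. ennreal (J k \<omega> * V (Suc k) \<omega>)) \<partial>M) = (\<Sum>k<n. \<integral>\<^sup>+\<omega>. ennreal (J k \<omega> * V (Suc k) \<omega>) \<partial>M)"
      using * by (intro nn_integral_sum) auto
    then show ?thesis
      using * mI[OF order_refl] mV[OF order_refl] by (subst nn_integral_add) auto
  qed
  also have "\<dots> \<le> (\<integral>\<^sup>+\<omega>. ennreal ((1 + 2 * \<sigma> + \<eta>)\<^sup>2) + (\<Sum>k<n. ennreal C * ennreal (X k \<omega> ^ 4)) \<partial>M)"
  proof (rule nn_integral_mono)
    fix \<omega>
    have "I n \<omega> * V n \<omega> + (\<Sum>k<n. J k \<omega> * V (Suc k) \<omega>) \<le> (1 + 2 * \<sigma> + \<eta>)\<^sup>2 + (\<Sum>k<n. C * X k \<omega> ^ 4)"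
      unfolding I_def J_def V_def C_def using assms sigma_pos by (intro stopped_potential_le) auto
    then show "ennreal (I n \<omega> * V n \<omega>) + (\<Sum>k<n. ennreal (J k \<omega> * V (Suc k) \<omega>))
        \<le> ennreal ((1 + 2 * \<sigma> + \<eta>)\<^sup>2) + (\<Sum>k<n. ennreal C * ennreal (X k \<omega> ^ 4))"
      using I0 V0 C by (simp add: sum_nonneg flip: ennreal_mult ennreal_plus)
  qed
  also have "\<dots> = ennreal ((1 + 2 * \<sigma> + \<eta>)\<^sup>2) + (\<Sum>k<n. ennreal C * ennreal (3 * \<sigma> ^ 4))"
  proof -
    have *: "(\<lambda>\<omega>. ennreal (X k \<omega> ^ 4)) \<in> borel_measurable M" if "k < n" for k
      using mX[OF that] by measurable
    have "(\<integral>\<^sup>+\<omega>. (\<Sum>k<n. ennreal C * ennreal (X k \<omega> ^ 4)) \<partial>M) = (\<Sum>k<n. \<integral>\<^sup>+\<omega>. ennreal C * ennreal (X k \<omega> ^ 4) \<partial>M)"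
      using * by (intro nn_integral_sum) auto
    also have "\<dots> = (\<Sum>k<n. ennreal C * ennreal (3 * \<sigma> ^ 4))"
      using * by (intro sum.cong refl) (subst nn_integral_cmult, auto simp: nn_integral_pow4)
    finally have eq: "(\<integral>\<^sup>+\<omega>. (\<Sum>k<n. ennreal C * ennreal (X k \<omega> ^ 4)) \<partial>M) = (\<Sum>k<n. ennreal C * ennreal (3 * \<sigma> ^ 4))" .
    show ?thesis
      using * by (subst nn_integral_add) (auto simp: emeasure_space_1 eq)
  qed
  also have "\<dots> = ennreal ((1 + 2 * \<sigma> + \<eta>)\<^sup>2 + C * (3 * n * \<sigma> ^ 4))"
    using C sigma_pos by (simp add: algebra_simps ennreal_of_nat_eq_real_of_nat flip: ennreal_mult ennreal_plus)
  finally have "ennreal (\<Sum>k<n. 2 * \<sigma>\<^sup>2 * prob {\<omega>\<in>space M. drawrange (\<lambda>i. X i \<omega>) k \<le> 1}) \<le> ennreal ((1 + 2 * \<sigma> + \<eta>)\<^sup>2 + C * (3 * n * \<sigma> ^ 4))"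
    by (simp add: sum_nonneg)
  moreover have "0 \<le> (1 + 2 * \<sigma> + \<eta>)\<^sup>2 + C * (3 * n * \<sigma> ^ 4)" using C sigma_pos by simp
  ultimately have "(\<Sum>k<n. 2 * \<sigma>\<^sup>2 * prob {\<omega>\<in>space M. drawrange (\<lambda>i. X i \<omega>) k \<le> 1}) \<le> (1 + 2 * \<sigma> + \<eta>)\<^sup>2 + C * (3 * n * \<sigma> ^ 4)"
    by (simp only: ennreal_le_iff)
  then show ?thesis by (simp only: C_def sum_distrib_left)
qed

end

section \<open>Planar Brownian motion on grids\<close>

context planar_brownian_motion
begin

lemma measurable_coordinate: "0 \<le> t \<Longrightarrow> (\<lambda>\<omega>. W t \<omega> $ c) \<in> borel_measurable M"
  using standard_brownian_motion.random_variable[OF coordinates] .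

text \<open>Pairing step and coordinate lets the increments of both coordinates form one independent
  family.\<close>

definition increment :: "real \<Rightarrow> nat \<times> 2 \<Rightarrow> 'w \<Rightarrow> real" where
  "increment h p \<omega> = W (real (Suc (fst p)) * h) \<omega> $ snd p - W (real (fst p) * h) \<omega> $ snd p"

lemma measurable_increment [measurable]: "0 < h \<Longrightarrow> increment h p \<in> borel_measurable M"
  unfolding increment_def by (intro borel_measurable_diff measurable_coordinate) auto

lemma normal_increment:
  assumes "0 < h"
  shows "distributed M lborel (increment h p) (normal_density 0 (sqrt h))"
proof -
  have "real (Suc (fst p)) * h - real (fst p) * h = h" by (simp add: algebra_simps)
  then show ?thesis
    using standard_brownian_motion.gaussian_increments[OF coordinates, of "real (fst p) * h" "real (Suc (fst p)) * h" "snd p"] assms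
    unfolding increment_def[abs_def] by simp
qed

text \<open>Independence over time within a coordinate and independence between the coordinate
  processes are merged by checking the product formula for one Borel set per increment.\<close>

lemma indep_vars_increment:
  assumes "0 < h" "0 < n"
  shows "indep_vars (\<lambda>_. borel) (increment h) ({..<n} \<times> UNIV)"
proof -
  let ?I = "{..<n} \<times> (UNIV :: 2 set)"
  have main: "\<forall>A\<in>?I \<rightarrow> sets borel. prob (\<Inter>p\<in>?I. increment h p -` A p \<inter> space M)
      = (\<Prod>p\<in>?I. prob (increment h p -` A p \<inter> space M))"
  proof
    fix A :: "nat \<times> 2 \<Rightarrow> real set" assume A: "A \<in> ?I \<rightarrow> sets borel"
    define E where "E c = (\<Inter>i<n. increment h (i, c) -` A (i, c) \<inter> space M)" for c
    have prob_E: "prob (E c) = (\<Prod>i<n. prob (increment h (i, c) -` A (i, c) \<inter> space M))" for c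
    proof -
      have "indep_vars (\<lambda>_. borel) (\<lambda>i \<omega>. W (real (Suc i) * h) \<omega> $ c - W (real i * h) \<omega> $ c) {..<n}"
        using standard_brownian_motion.independent_increments[OF coordinates, of "\<lambda>i. real i * h" n c] assms by simp
      from indep_varsD_finite[OF this, of "\<lambda>i. A (i, c)"] show ?thesis
        using assms(2) A by (auto simp: E_def increment_def[abs_def])
    qed
    let ?P = "\<Pi>\<^sub>M t\<in>{0::real..}. borel :: real measure"
    \<comment> \<open>The coordinates are independent as random elements of path space, so
      constraints on increments are pulled back from measurable sets of paths.\<close>
    define F where "F c = (\<Inter>i<n. {f \<in> space ?P. f (real (Suc i) * h) - f (real i * h) \<in> A (i, c)})" for c
    have F: "F c \<in> sets ?P" for c
    proof -
      have "{f \<in> space ?P. f (real (Suc i) * h) - f (real i * h) \<in> A (i, c)} \<in> sets ?P" if "i < n" for i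
      proof (rule measurable_sets_Collect[where P = "\<lambda>y. y \<in> A (i, c)" and N = borel])
        show "(\<lambda>f. f (real (Suc i) * h) - f (real i * h)) \<in> borel_measurable ?P"
          using assms(1) by (intro borel_measurable_diff measurable_component_singleton) auto
        show "{x \<in> space borel. x \<in> A (i, c)} \<in> sets borel" using A that by auto
      qed
      then show ?thesis unfolding F_def using assms(2) by (intro sets.finite_INT) auto
    qed
    have vim: "(\<lambda>\<omega>. \<lambda>t\<in>{0..}. W t \<omega> $ c) -` F c \<inter> space M = E c" for c
      using assms by (auto simp: F_def E_def increment_def space_PiM)
    have "prob ((\<lambda>\<omega>. (\<lambda>t\<in>{0..}. W t \<omega> $ 1, \<lambda>t\<in>{0..}. W t \<omega> $ 2)) -` (F 1 \<times> F 2) \<inter> space M)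
        = prob (E 1) * prob (E 2)"
      using indep_varD[OF independent_coordinates F F, of 1 2] by (simp add: vim)
    moreover have "(\<lambda>\<omega>. (\<lambda>t\<in>{0..}. W t \<omega> $ 1, \<lambda>t\<in>{0..}. W t \<omega> $ 2)) -` (F 1 \<times> F 2) \<inter> space M = E 1 \<inter> E 2"
      unfolding vim[symmetric] by auto
    moreover have "(\<Inter>p\<in>?I. increment h p -` A p \<inter> space M) = E 1 \<inter> E 2"
      unfolding E_def UNIV_2 by auto
    moreover have "(\<Prod>p\<in>?I. prob (increment h p -` A p \<inter> space M)) = prob (E 1) * prob (E 2)"
      unfolding prob_E prod.cartesian_product'
      by (simp add: UNIV_2 prod.distrib)
    ultimately show "prob (\<Inter>p\<in>?I. increment h p -` A p \<inter> space M)
      = (\<Prod>p\<in>?I. prob (increment h p -` A p \<inter> space M))" by simp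
  qed
  show ?thesis
  proof (rule indep_vars_finite[THEN iffD2, OF _ _ _ _ _ _ _ main])
    show "?I \<noteq> {}" using assms(2) by auto
    show "sets borel = sigma_sets (space borel) (sets borel)" by (rule sets.sigma_sets_eq[symmetric])
  qed (use assms(1) in \<open>auto simp: Int_stable_def\<close>)
qed

definition normalized_increments :: "nat \<Rightarrow> real \<Rightarrow> 'w \<Rightarrow> nat \<times> 2 \<Rightarrow> real" where
  "normalized_increments n h \<omega> = (\<lambda>p\<in>{..<n} \<times> UNIV. increment h p \<omega> / sqrt h)"

lemma measurable_normalized_increments:
  "0 < h \<Longrightarrow> normalized_increments n h \<in> measurable M (\<Pi>\<^sub>M p\<in>{..<n} \<times> UNIV. borel)"
  unfolding normalized_increments_def[abs_def] by (intro measurable_restrict) measurable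

text \<open>The right-hand side does not involve \<open>h\<close>; in this form Brownian scaling
  enters.\<close>

lemma distr_normalized_increments:
  assumes "0 < h" "0 < n"
  shows "distr M (\<Pi>\<^sub>M p\<in>{..<n} \<times> UNIV. borel) (normalized_increments n h)
    = (\<Pi>\<^sub>M p\<in>{..<n} \<times> UNIV. density lborel std_normal_density)"
proof -
  let ?Z = "\<lambda>p \<omega>. increment h p \<omega> / sqrt h"
  have Z: "distributed M lborel (?Z p) std_normal_density" for p
    using normal_density_affine[OF normal_increment[OF assms(1)], of "1 / sqrt h" 0] assms(1) by simp
  have "indep_vars (\<lambda>_. borel) ?Z ({..<n} \<times> UNIV)"
    using indep_vars_compose2[OF indep_vars_increment[OF assms], of "\<lambda>_ x. x / sqrt h" "\<lambda>_. borel"] by simp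
  moreover have "?Z p \<in> borel_measurable M" for p using assms(1) by measurable
  ultimately have "distr M (\<Pi>\<^sub>M p\<in>{..<n} \<times> UNIV. borel) (\<lambda>\<omega>. \<lambda>p\<in>{..<n} \<times> UNIV. ?Z p \<omega>)
     = (\<Pi>\<^sub>M p\<in>{..<n} \<times> UNIV. distr M borel (?Z p))"
    using assms(2) by (subst indep_vars_iff_distr_eq_PiM'[symmetric]) auto
  moreover have "distr M borel (?Z p) = density lborel std_normal_density" for p
    using Z[of p] by (simp add: distributed_distr_eq_density[symmetric] cong: distr_cong)
  ultimately show ?thesis by (simp add: normalized_increments_def[abs_def])
qed

text \<open>Nonzero components make every summand of the inner product a nondegenerate normal
  variable, as the addition of independent normals requires. Only three angles in
  \<open>{0..pi}\<close> are excluded.\<close>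

lemma gaussian_walk_inner:
  assumes "0 < h" "norm e = 1" "\<And>c. e $ c \<noteq> 0"
  shows "gaussian_walk M (\<lambda>i \<omega>. (W (real (Suc i) * h) \<omega> - W (real i * h) \<omega>) \<bullet> e) n (sqrt h)"
proof
  have inner: "(W (real (Suc i) * h) \<omega> - W (real i * h) \<omega>) \<bullet> e = (\<Sum>c\<in>UNIV. increment h (i, c) \<omega> * e $ c)" for i \<omega>
    by (simp add: inner_vec_def increment_def)
  show "0 < sqrt h" using assms by simp
  have indep: "indep_vars (\<lambda>_. borel) (increment h) ({..<Suc n} \<times> UNIV)"
    using assms(1) by (rule indep_vars_increment) simp
  have "indep_vars (\<lambda>i. PiM ({i} \<times> UNIV) (\<lambda>_. borel)) (\<lambda>i \<omega>. restrict (\<lambda>p. increment h p \<omega>) ({i} \<times> UNIV)) {..<n}"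
    by (rule indep_vars_restrict[OF indep]) (auto simp: disjoint_family_on_def)
  then have "indep_vars (\<lambda>_. borel) (\<lambda>i \<omega>. \<Sum>c\<in>UNIV. (restrict (\<lambda>p. increment h p \<omega>) ({i} \<times> UNIV)) (i, c) * e $ c) {..<n}"
  proof (rule indep_vars_compose2)
    fix i
    show "(\<lambda>x. \<Sum>c\<in>UNIV. x (i, c) * e $ c) \<in> measurable (PiM ({i} \<times> UNIV) (\<lambda>_. borel)) borel"
      by (intro borel_measurable_sum borel_measurable_times borel_measurable_const measurable_component_singleton) auto
  qed
  then show "indep_vars (\<lambda>_. borel) (\<lambda>i \<omega>. (W (real (Suc i) * h) \<omega> - W (real i * h) \<omega>) \<bullet> e) {..<n}"
    by (simp add: inner del: of_nat_Suc)
  fix i assume "i < n"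
  have "distributed M lborel (\<lambda>\<omega>. \<Sum>p\<in>{i} \<times> UNIV. increment h p \<omega> * e $ snd p)
     (normal_density (\<Sum>p\<in>{i} \<times> (UNIV :: 2 set). 0) (sqrt (\<Sum>p\<in>{i} \<times> (UNIV :: 2 set). (\<bar>e $ snd p\<bar> * sqrt h)\<^sup>2)))"
  proof (rule sum_indep_normal)
    have "indep_vars (\<lambda>_. borel) (increment h) ({i} \<times> UNIV)"
      using \<open>i < n\<close> by (intro indep_vars_subset[OF indep]) auto
    from indep_vars_compose2[OF this, of "\<lambda>p x. x * e $ snd p" "\<lambda>_. borel"]
    show "indep_vars (\<lambda>_. borel) (\<lambda>p \<omega>. increment h p \<omega> * e $ snd p) ({i} \<times> UNIV)" by simp
    show "distributed M lborel (\<lambda>\<omega>. increment h p \<omega> * e $ snd p) (normal_density 0 (\<bar>e $ snd p\<bar> * sqrt h))" for p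
      using normal_density_affine[OF normal_increment[OF assms(1)], of "e $ snd p" 0] assms by (simp add: mult.commute)
  qed (use assms in auto)
  moreover have "(\<Sum>p\<in>{i} \<times> (UNIV :: 2 set). (\<bar>e $ snd p\<bar> * sqrt h)\<^sup>2) = h"
  proof -
    have "(\<Sum>c\<in>UNIV. (e $ c)\<^sup>2) = 1"
      using assms(2) by (simp add: norm_vec_def L2_set_def)
    then show ?thesis
      using assms(1) by (simp add: sum.cartesian_product' power_mult_distrib flip: sum_distrib_right)
  qed
  ultimately show "distributed M lborel (\<lambda>\<omega>. (W (real (Suc i) * h) \<omega> - W (real i * h) \<omega>) \<bullet> e) (normal_density 0 (sqrt h))"
    by (simp add: inner sum.cartesian_product' del: of_nat_Suc)
qed

end

section \<open>Widths of paths through dyadic grids\<close>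

lemma width_mono: "S \<subseteq> T \<Longrightarrow> width S e \<le> width T e"
  unfolding width_def by (intro SUP_subset_mono order_refl)

lemma inner_diff_le_width: "x \<in> S \<Longrightarrow> y \<in> S \<Longrightarrow> ennreal ((x - y) \<bullet> e) \<le> width S e"
  unfolding width_def by (intro SUP_upper2[of x] SUP_upper2[of y]) auto

text \<open>Half-spaces absorb the hull in two rounds: first hull points against points of
  \<open>S\<close>, then, with a hull point fixed, the other argument.\<close>

lemma width_convex_hull:
  fixes S :: "'a::real_inner set"
  shows "width (convex hull S) e = width S e"
proof (rule antisym)
  show "width S e \<le> width (convex hull S) e" by (intro width_mono hull_subset)
  show "width (convex hull S) e \<le> width S e"
  proof (cases "width S e")
    case (real r)
    have 1: "e \<bullet> x \<le> r + e \<bullet> y" if "x \<in> S" "y \<in> S" for x y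
      using inner_diff_le_width[OF that, of e] real by (simp add: inner_commute inner_diff_right algebra_simps)
    have "convex hull S \<subseteq> (\<Inter>y\<in>S. {x. e \<bullet> x \<le> r + e \<bullet> y})"
      using 1 by (intro hull_minimal convex_INT convex_halfspace_le) auto
    then have 2: "e \<bullet> y \<ge> e \<bullet> x - r" if "x \<in> convex hull S" "y \<in> S" for x y
      using that by (force simp: algebra_simps)
    have "convex hull S \<subseteq> (\<Inter>x\<in>convex hull S. {y. e \<bullet> y \<ge> e \<bullet> x - r})"
      using 2 by (intro hull_minimal convex_INT convex_halfspace_ge) auto
    then have "(x - y) \<bullet> e \<le> r" if "x \<in> convex hull S" "y \<in> convex hull S" for x y
      using that by (force simp: inner_commute inner_diff_right algebra_simps)
    then show ?thesis unfolding width_def[of "convex hull S"] real(2) by (intro SUP_least ennreal_leI)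
  qed simp
qed

definition grid_width :: "(real \<Rightarrow> 'a::real_inner) \<Rightarrow> real \<Rightarrow> nat \<Rightarrow> 'a \<Rightarrow> ennreal" where
  "grid_width f t n e = width ((\<lambda>k. f (real k * (t / 2 ^ n))) ` {..2 ^ n}) e"

text \<open>A countable supremum, which keeps joint measurability in path and direction; as the
  dyadic grids are nested it is also a monotone limit.\<close>

definition path_width :: "(real \<Rightarrow> 'a::real_inner) \<Rightarrow> real \<Rightarrow> 'a \<Rightarrow> ennreal" where
  "path_width f t e = (SUP n. grid_width f t n e)"

lemma incseq_grid_width: "incseq (\<lambda>n. grid_width f t n e)"
proof (rule incseq_SucI)
  fix n
  have "(\<lambda>k. f (real k * (t / 2 ^ n))) ` {..2 ^ n} \<subseteq> (\<lambda>k. f (real k * (t / 2 ^ Suc n))) ` {..2 ^ Suc n}"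
  proof (intro subsetI, elim imageE)
    fix x k assume k: "x = f (real k * (t / 2 ^ n))" "k \<in> {..2 ^ n :: nat}"
    have "x = f (real (2 * k) * (t / 2 ^ Suc n))" using k by simp
    then show "x \<in> (\<lambda>k. f (real k * (t / 2 ^ Suc n))) ` {..2 ^ Suc n}"
      using k by (intro image_eqI[of _ _ "2 * k"]) auto
  qed
  then show "grid_width f t n e \<le> grid_width f t (Suc n) e"
    unfolding grid_width_def by (rule width_mono)
qed

lemma path_width_eq_width:
  fixes f :: "real \<Rightarrow> 'a::real_inner"
  assumes f: "continuous_on {0..t} f" and "0 \<le> t" "norm e = 1"
  shows "path_width f t e = width (f ` {0..t}) e"
proof (rule antisym)
  have "real k * (t / 2 ^ n) \<in> {0..t}" if "k \<le> 2 ^ n" for k n :: nat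
  proof -
    have "real k / 2 ^ n \<le> 1" using of_nat_mono[OF that, where ?'a = real] by simp
    then have "t * (real k / 2 ^ n) \<le> t * 1" using \<open>0 \<le> t\<close> by (intro mult_left_mono)
    then show ?thesis using \<open>0 \<le> t\<close> by (simp add: mult.commute)
  qed
  then show "path_width f t e \<le> width (f ` {0..t}) e"
    unfolding path_width_def grid_width_def by (intro SUP_least width_mono) auto
  show "width (f ` {0..t}) e \<le> path_width f t e"
    unfolding width_def
  proof (intro SUP_least, elim imageE)
    fix x y r s assume xy: "x = f r" "r \<in> {0..t}" "y = f s" "s \<in> {0..t}"
    show "ennreal ((x - y) \<bullet> e) \<le> path_width f t e"
    proof (rule ennreal_le_epsilon)
      fix \<epsilon> :: real assume "\<epsilon> > 0"
      have "uniformly_continuous_on {0..t} f" using f by (intro compact_uniformly_continuous) auto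
      then obtain d where d: "d > 0" "\<And>s r. s \<in> {0..t} \<Longrightarrow> r \<in> {0..t} \<Longrightarrow> dist r s < d \<Longrightarrow> dist (f r) (f s) < \<epsilon> / 2"
        unfolding uniformly_continuous_on_def using \<open>\<epsilon> > 0\<close> by (metis half_gt_zero)
      obtain n where n: "t / 2 ^ n < d"
      proof -
        obtain n where "(1/2) ^ n < d / (t + 1)"
          using real_arch_pow_inv[of "d / (t + 1)" "1/2"] d(1) \<open>0 \<le> t\<close> by auto
        then have "(t + 1) * (1/2) ^ n < d" using \<open>0 \<le> t\<close> by (simp add: field_simps)
        moreover have "t * (1/2) ^ n \<le> (t + 1) * (1/2) ^ n" by (intro mult_right_mono) auto
        ultimately show thesis by (intro that[of n]) (simp add: power_one_over field_simps)
      qed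
      have near: "\<exists>k\<le>2 ^ n. dist (f (real k * (t / 2 ^ n))) (f r) < \<epsilon> / 2" if r: "r \<in> {0..t}" for r
      proof (cases "t = 0")
        case True
        then show ?thesis using r \<open>\<epsilon> > 0\<close> by (intro exI[of _ 0]) auto
      next
        case False
        define h where "h = t / 2 ^ n"
        have "h > 0" using False \<open>0 \<le> t\<close> by (simp add: h_def)
        define k where "k = nat \<lfloor>r / h\<rfloor>"
        have k: "real k \<le> r / h" "r / h < real k + 1"
          using r \<open>h > 0\<close> by (auto simp: k_def of_nat_nat)
        have "r / h \<le> t / h" using r \<open>h > 0\<close> by (intro divide_right_mono) auto
        also have "t / h = 2 ^ n" using False by (simp add: h_def)
        finally have "real k \<le> 2 ^ n" using k(1) by linarith
        then have "k \<le> 2 ^ n" by simp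
        have kh: "real k * h \<le> r" "r < real k * h + h"
          using k \<open>h > 0\<close> by (auto simp: field_simps)
        then have "dist (real k * h) r < d" using n by (simp add: dist_real_def h_def)
        moreover have "real k * h \<in> {0..t}" using kh r \<open>h > 0\<close> by auto
        ultimately show ?thesis using d(2)[OF r] \<open>k \<le> 2 ^ n\<close> by (auto simp: h_def)
      qed
      obtain k j where kj: "k \<le> 2 ^ n" "dist (f (real k * (t / 2 ^ n))) x < \<epsilon> / 2"
          "j \<le> 2 ^ n" "dist (f (real j * (t / 2 ^ n))) y < \<epsilon> / 2"
        using near xy by metis
      define a where "a = f (real k * (t / 2 ^ n))"
      define b where "b = f (real j * (t / 2 ^ n))"
      have cs: "\<bar>(p - q) \<bullet> e\<bar> \<le> dist p q" for p q
        using Cauchy_Schwarz_ineq2[of "p - q" e] assms(3) by (simp add: dist_norm)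
      have "\<bar>a \<bullet> e - x \<bullet> e\<bar> < \<epsilon> / 2" "\<bar>b \<bullet> e - y \<bullet> e\<bar> < \<epsilon> / 2"
        using cs[of a x] cs[of b y] kj by (auto simp: inner_diff_left a_def b_def)
      then have "(x - y) \<bullet> e \<le> (a - b) \<bullet> e + \<epsilon>"
        unfolding inner_diff_left abs_less_iff by argo
      then have "ennreal ((x - y) \<bullet> e) \<le> ennreal ((a - b) \<bullet> e + \<epsilon>)" by (rule ennreal_leI)
      \<comment> \<open>The inner product may be negative, whereas \<open>ennreal\<close> is
        additive only on nonnegative reals.\<close>
      also have "\<dots> \<le> ennreal (max 0 ((a - b) \<bullet> e) + \<epsilon>)" by (intro ennreal_leI) simp
      also have "\<dots> = ennreal ((a - b) \<bullet> e) + ennreal \<epsilon>"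
        using \<open>\<epsilon> > 0\<close> by (simp add: max_def ennreal_neg)
      also have "ennreal ((a - b) \<bullet> e) \<le> grid_width f t n e"
        unfolding grid_width_def a_def b_def using kj by (intro inner_diff_le_width) auto
      also have "\<dots> \<le> path_width f t e" unfolding path_width_def by (rule SUP_upper) simp
      finally show "ennreal ((x - y) \<bullet> e) \<le> path_width f t e + ennreal \<epsilon>" by (simp add: add_right_mono)
    qed
  qed
qed

text \<open>Width of the planar walk with steps \<open>z\<close>. As a function of finitely many
  steps it inherits measurability and law from the increments.\<close>

definition lattice_width :: "nat \<Rightarrow> (nat \<times> 2 \<Rightarrow> real) \<Rightarrow> real ^ 2 \<Rightarrow> ennreal" where
  "lattice_width N z e = (SUP k\<in>{..N}. SUP j\<in>{..N}.
     ennreal (\<Sum>c\<in>UNIV. e $ c * ((\<Sum>i<k. z (i, c)) - (\<Sum>i<j. z (i, c)))))"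

lemma measurable_lattice_width [measurable]:
  "(\<lambda>(z, e). lattice_width N z e) \<in> borel_measurable ((\<Pi>\<^sub>M p\<in>{..<N} \<times> UNIV. borel) \<Otimes>\<^sub>M borel)"
proof -
  have e: "(\<lambda>e. e $ c) \<in> borel_measurable borel" for c :: 2
    by (intro borel_measurable_continuous_onI continuous_intros)
  have s: "(\<lambda>z. \<Sum>i<k. z (i, c)) \<in> borel_measurable (\<Pi>\<^sub>M p\<in>{..<N} \<times> UNIV. borel :: real measure)" if "k \<le> N" for k c
    using that by (intro borel_measurable_sum measurable_component_singleton) auto
  show ?thesis
    unfolding lattice_width_def case_prod_beta
    by (intro borel_measurable_SUP measurable_compose[OF _ measurable_ennreal] borel_measurable_sum
        borel_measurable_times borel_measurable_diff measurable_compose[OF measurable_snd e]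
        measurable_compose[OF measurable_fst s]) auto
qed

section \<open>Inverse squares and Jensen's inequality\<close>

lemma nn_integral_inverse_square:
  fixes x :: ennreal
  shows "(\<integral>\<^sup>+t. indicator {t. 0 < t \<and> ennreal (sqrt t) * x \<le> 1} t \<partial>lborel) = (inverse x)\<^sup>2"
proof (cases "x = 0 \<or> x = \<top>")
  case True
  \<comment> \<open>The conventions fit: for \<open>x = 0\<close> every \<open>t > 0\<close>
    qualifies and \<open>inverse 0 = \<top>\<close>; for \<open>x = \<top>\<close> none does and the
    inverse is 0.\<close>
  have "(\<integral>\<^sup>+t. indicator {0::real<..} t \<partial>lborel) = \<top>"
    using nn_integral_indicator_less(2)[of \<top>] by (simp add: greaterThan_def)
  moreover have "(\<integral>\<^sup>+t. indicator {t::real. False} t \<partial>lborel) = 0" by simp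
  ultimately show ?thesis using True
    by (auto simp: greaterThan_def ennreal_mult_top top_unique cong: conj_cong)
next
  case False
  then obtain r where r: "x = ennreal r" "r > 0"
    by (cases x) (auto simp: less_le)
  have "{t. 0 < t \<and> ennreal (sqrt t) * x \<le> 1} = {0<..(1 / r)\<^sup>2}"
  proof -
    have "ennreal (sqrt t) * x \<le> 1 \<longleftrightarrow> t \<le> (1 / r)\<^sup>2" if "0 < t" for t
    proof -
      have "ennreal (sqrt t) * x \<le> 1 \<longleftrightarrow> sqrt t * r \<le> 1"
        using that r by (simp flip: ennreal_mult)
      also have "\<dots> \<longleftrightarrow> sqrt t \<le> 1 / r" using r by (simp add: field_simps)
      also have "\<dots> \<longleftrightarrow> sqrt t \<le> sqrt ((1 / r)\<^sup>2)" using r by (subst real_sqrt_abs) simp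
      also have "\<dots> \<longleftrightarrow> t \<le> (1 / r)\<^sup>2" by (simp only: real_sqrt_le_iff)
      finally show ?thesis .
    qed
    then show ?thesis by auto
  qed
  then have "(\<integral>\<^sup>+t. indicator {t. 0 < t \<and> ennreal (sqrt t) * x \<le> 1} t \<partial>lborel) = ennreal ((1 / r)\<^sup>2)"
    using r by simp
  also have "\<dots> = (inverse x)\<^sup>2"
    using r by (simp add: inverse_ennreal ennreal_power divide_inverse)
  finally show ?thesis .
qed

text \<open>This is the tangent to x^-2 at \<open>c\<close>, with the linear term moved next to x^-2
  because \<open>ennreal\<close> has no negative values. For real r it amounts to (c - r)^2 (c + 2
  r) \<ge> 0.\<close>

lemma inverse_square_tangent:
  fixes x :: ennreal
  assumes "c > 0"
  shows "ennreal (3 / c\<^sup>2) \<le> (inverse x)\<^sup>2 + ennreal (2 / c ^ 3) * x"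
proof (cases "x = 0 \<or> x = \<top>")
  case True
  then show ?thesis using assms by (auto simp: ennreal_mult_top)
next
  case False
  then obtain r where r: "x = ennreal r" "r > 0"
    by (cases x) (auto simp: less_le)
  have "0 \<le> (c - r)\<^sup>2 * (c + 2 * r)" using assms r by simp
  then have "3 * c * r\<^sup>2 \<le> c ^ 3 + 2 * r ^ 3"
    by (simp add: power2_eq_square power3_eq_cube algebra_simps)
  then have "(3 * c * r\<^sup>2) / (c ^ 3 * r\<^sup>2) \<le> (c ^ 3 + 2 * r ^ 3) / (c ^ 3 * r\<^sup>2)"
    using assms r by (intro divide_right_mono) auto
  also have "(3 * c * r\<^sup>2) / (c ^ 3 * r\<^sup>2) = 3 / c\<^sup>2"
    using assms r by (simp add: power2_eq_square power3_eq_cube)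
  also have "(c ^ 3 + 2 * r ^ 3) / (c ^ 3 * r\<^sup>2) = (1 / r)\<^sup>2 + 2 / c ^ 3 * r"
    using assms r by (simp add: power2_eq_square power3_eq_cube field_simps)
  finally have "ennreal (3 / c\<^sup>2) \<le> ennreal ((1 / r)\<^sup>2 + 2 / c ^ 3 * r)" by (rule ennreal_leI)
  also have "\<dots> = ennreal ((1 / r)\<^sup>2) + ennreal (2 / c ^ 3 * r)"
    using assms r by (intro ennreal_plus) auto
  also have "\<dots> = (inverse x)\<^sup>2 + ennreal (2 / c ^ 3) * x"
    using assms r by (simp add: inverse_ennreal ennreal_power divide_inverse flip: ennreal_mult')
  finally show ?thesis .
qed

text \<open>Jensen's inequality for x^-2 by the tangent at the mean. The cube of the mass is one
  factor from the total and two from normalizing the mean. It serves with mass 1 on the probability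
  space and mass \<open>pi\<close> on the angles.\<close>

lemma inverse_square_nn_integral_le:
  assumes [measurable]: "f \<in> borel_measurable M" and m: "emeasure M (space M) = ennreal m" "m > 0"
  shows "ennreal (m ^ 3) * (inverse (\<integral>\<^sup>+x. f x \<partial>M))\<^sup>2 \<le> (\<integral>\<^sup>+x. (inverse (f x))\<^sup>2 \<partial>M)"
proof -
  let ?F = "\<integral>\<^sup>+x. f x \<partial>M"
  consider "?F = \<top>" | "?F = 0" | "?F \<noteq> \<top>" "?F \<noteq> 0" by blast
  then show ?thesis
  proof cases
    case 2
    then have "AE x in M. (inverse (f x))\<^sup>2 = \<top>"
      by (subst (asm) nn_integral_0_iff_AE) auto
    then have "(\<integral>\<^sup>+x. (inverse (f x))\<^sup>2 \<partial>M) = (\<integral>\<^sup>+x. \<top> \<partial>M)" by (rule nn_integral_cong_AE)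
    also have "\<dots> = \<top>" using m by (simp add: ennreal_top_mult)
    finally show ?thesis by simp
  next
    case 3
    then obtain r where r: "?F = ennreal r" "r > 0"
      by (cases ?F) (auto simp: less_le)
    define c where "c = r / m"
    have "c > 0" using r m by (simp add: c_def)
    have "ennreal (3 / c\<^sup>2) * ennreal m = (\<integral>\<^sup>+x. ennreal (3 / c\<^sup>2) \<partial>M)" using m by simp
    also have "\<dots> \<le> (\<integral>\<^sup>+x. (inverse (f x))\<^sup>2 + ennreal (2 / c ^ 3) * f x \<partial>M)"
      by (intro nn_integral_mono inverse_square_tangent[OF \<open>c > 0\<close>])
    also have "\<dots> = (\<integral>\<^sup>+x. (inverse (f x))\<^sup>2 \<partial>M) + ennreal (2 / c ^ 3) * ennreal r"
      using r by (simp add: nn_integral_add nn_integral_cmult)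
    finally have "ennreal (3 / c\<^sup>2 * m) \<le> (\<integral>\<^sup>+x. (inverse (f x))\<^sup>2 \<partial>M) + ennreal (2 / c ^ 3 * r)"
      using \<open>c > 0\<close> r m by (simp flip: ennreal_mult)
    moreover have "3 / c\<^sup>2 * m = m ^ 3 / r\<^sup>2 + 2 / c ^ 3 * r"
      using r m by (simp add: c_def power2_eq_square power3_eq_cube field_simps)
    then have "ennreal (3 / c\<^sup>2 * m) = ennreal (m ^ 3 / r\<^sup>2) + ennreal (2 / c ^ 3 * r)"
      using r m \<open>c > 0\<close> by (simp only:) (intro ennreal_plus, auto)
    ultimately have "ennreal (m ^ 3 / r\<^sup>2) \<le> (\<integral>\<^sup>+x. (inverse (f x))\<^sup>2 \<partial>M)"
      by (simp add: ennreal_add_left_cancel_le add.commute)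
    then show ?thesis
      using r m by (simp add: inverse_ennreal ennreal_power divide_inverse power_inverse flip: ennreal_mult)
  qed simp
qed

lemma ennreal_plus_le: "ennreal (a + b) \<le> ennreal a + ennreal b"
  by (cases "0 \<le> a"; cases "0 \<le> b")
     (auto simp: ennreal_neg intro: ennreal_leI)

section \<open>Measurability of the widths of Brownian paths\<close>

context planar_brownian_motion
begin

lemma inner_diff_grid:
  assumes "0 < h" "k \<le> N" "j \<le> N"
  shows "(W (real k * h) \<omega> - W (real j * h) \<omega>) \<bullet> e = sqrt h * (\<Sum>c\<in>UNIV. e $ c *
    ((\<Sum>i<k. normalized_increments N h \<omega> (i, c)) - (\<Sum>i<j. normalized_increments N h \<omega> (i, c))))"
proof -
  have tel: "sqrt h * (\<Sum>i<k. normalized_increments N h \<omega> (i, c)) = W (real k * h) \<omega> $ c - W 0 \<omega> $ c"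
    if "k \<le> N" for k c
  proof -
    have "sqrt h * (\<Sum>i<k. normalized_increments N h \<omega> (i, c)) = (\<Sum>i<k. increment h (i, c) \<omega>)"
      unfolding sum_distrib_left using that assms(1)
      by (intro sum.cong refl) (simp add: normalized_increments_def)
    also have "\<dots> = (\<Sum>i<k. W (real (Suc i) * h) \<omega> $ c - W (real i * h) \<omega> $ c)"
      by (simp add: increment_def)
    also have "\<dots> = W (real k * h) \<omega> $ c - W (real 0 * h) \<omega> $ c"
      by (rule sum_lessThan_telescope)
    finally show ?thesis by simp
  qed
  have "(W (real k * h) \<omega> - W (real j * h) \<omega>) \<bullet> e
      = (\<Sum>c\<in>UNIV. e $ c * ((W (real k * h) \<omega> $ c - W 0 \<omega> $ c) - (W (real j * h) \<omega> $ c - W 0 \<omega> $ c)))"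
    by (simp add: inner_vec_def mult.commute)
  also have "\<dots> = sqrt h * (\<Sum>c\<in>UNIV. e $ c *
    ((\<Sum>i<k. normalized_increments N h \<omega> (i, c)) - (\<Sum>i<j. normalized_increments N h \<omega> (i, c))))"
    unfolding tel[OF assms(2), symmetric] tel[OF assms(3), symmetric] sum_distrib_left
    by (intro sum.cong refl) (simp add: sum_distrib_left[symmetric] algebra_simps)
  finally show ?thesis .
qed

text \<open>The mesh is split off from the normalized increments; joint measurability and scaling
  are both read off from this product.\<close>

lemma grid_width_eq:
  assumes "0 < t"
  shows "grid_width (\<lambda>s. W s \<omega>) t n e =
    ennreal (sqrt (t / 2 ^ n)) * lattice_width (2 ^ n) (normalized_increments (2 ^ n) (t / 2 ^ n) \<omega>) e"
proof -
  have h: "0 < t / 2 ^ n" using assms by simp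
  show ?thesis
    unfolding grid_width_def width_def lattice_width_def SUP_mult_left_ennreal image_image
    by (intro SUP_cong refl, subst inner_diff_grid[OF h, where N = "2 ^ n"]) (use assms in \<open>auto intro!: ennreal_mult'\<close>)
qed

lemma measurable_grid_width:
  assumes "0 < t"
  shows "(\<lambda>(\<omega>, e). grid_width (\<lambda>s. W s \<omega>) t n e) \<in> borel_measurable (M \<Otimes>\<^sub>M borel)"
proof -
  have h: "0 < t / 2 ^ n" using assms by simp
  have "(\<lambda>x. (normalized_increments (2 ^ n) (t / 2 ^ n) (fst x), snd x))
      \<in> measurable (M \<Otimes>\<^sub>M borel) ((\<Pi>\<^sub>M p\<in>{..<2 ^ n} \<times> UNIV. borel) \<Otimes>\<^sub>M (borel :: (real ^ 2) measure))"
    by (intro measurable_Pair measurable_compose[OF measurable_fst measurable_normalized_increments[OF h]] measurable_snd)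
  from measurable_compose[OF this measurable_lattice_width]
  have [measurable]: "(\<lambda>x. lattice_width (2 ^ n) (normalized_increments (2 ^ n) (t / 2 ^ n) (fst x)) (snd x))
      \<in> borel_measurable (M \<Otimes>\<^sub>M borel)" by simp
  show ?thesis
    unfolding grid_width_eq[OF assms] case_prod_beta by measurable
qed

lemma measurable_path_width:
  assumes "0 < t"
  shows "(\<lambda>(\<omega>, e). path_width (\<lambda>s. W s \<omega>) t e) \<in> borel_measurable (M \<Otimes>\<^sub>M borel)"
  using measurable_grid_width[OF assms] unfolding path_width_def case_prod_beta
  by (intro borel_measurable_SUP) auto

end

text \<open>The measure \<open>\<mu>\<close> on directions is the uniform one for the perimeter and a point mass for the
  range of a one-dimensional projection.\<close>
locale planar_brownian_motion_directions = planar_brownian_motion M W + directions: sigma_finite_measure \<mu>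
  for M :: "'w measure" and W :: "real \<Rightarrow> 'w \<Rightarrow> real ^ 2" and \<mu> :: "(real ^ 2) measure" +
  assumes sets_directions [simp, measurable_cong]: "sets \<mu> = sets borel"
begin

definition total_width :: "real \<Rightarrow> 'w \<Rightarrow> ennreal" where
  "total_width t \<omega> = (\<integral>\<^sup>+e. path_width (\<lambda>s. W s \<omega>) t e \<partial>\<mu>)"

lemma measurable_total_width: "0 < t \<Longrightarrow> total_width t \<in> borel_measurable M"
proof -
  assume "0 < t"
  have "borel_measurable (M \<Otimes>\<^sub>M \<mu>) = borel_measurable (M \<Otimes>\<^sub>M borel)"
    by (intro measurable_cong_sets sets_pair_measure_cong) auto
  then show ?thesis
    using measurable_path_width[OF \<open>0 < t\<close>] unfolding total_width_def[abs_def]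
    by (intro directions.borel_measurable_nn_integral) simp
qed

lemma total_width_SUP:
  assumes "0 < t" "\<omega> \<in> space M"
  shows "total_width t \<omega> = (SUP n. \<integral>\<^sup>+e. grid_width (\<lambda>s. W s \<omega>) t n e \<partial>\<mu>)"
  unfolding total_width_def path_width_def
proof (rule nn_integral_monotone_convergence_SUP)
  show "incseq (\<lambda>n e. grid_width (\<lambda>s. W s \<omega>) t n e)"
    unfolding incseq_def le_fun_def using incseqD[OF incseq_grid_width] by blast
  show "(\<lambda>e. grid_width (\<lambda>s. W s \<omega>) t n e) \<in> borel_measurable \<mu>" for n
    using measurable_compose[OF measurable_Pair1'[OF assms(2)] measurable_grid_width[OF assms(1)]]
    by simp
qed

text \<open>Brownian scaling: the grid functionals only depend on the normalized increments, whose law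
  does not depend on the mesh.\<close>
lemma emeasure_total_width_scaling:
  assumes "0 < t"
  shows "emeasure M {\<omega>\<in>space M. total_width t \<omega> \<le> 1}
    = emeasure M {\<omega>\<in>space M. ennreal (sqrt t) * total_width 1 \<omega> \<le> 1}"
proof -
  define \<Phi> where "\<Phi> n z = (\<integral>\<^sup>+e. lattice_width (2 ^ n) z e \<partial>\<mu>)" for n z
  define Z where "Z n s = normalized_increments (2 ^ n) (s / 2 ^ n)" for n s
  let ?P = "\<lambda>n. \<Pi>\<^sub>M p\<in>{..<2 ^ n :: nat} \<times> (UNIV :: 2 set). borel :: real measure"
  let ?a = "\<lambda>n. ennreal (sqrt t) * ennreal (sqrt (1 / 2 ^ n))"
  have \<Phi> [measurable]: "\<Phi> n \<in> borel_measurable (?P n)" for n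
    unfolding \<Phi>_def[abs_def] by (intro directions.borel_measurable_nn_integral) measurable
  have Z: "Z n s \<in> measurable M (?P n)" if "0 < s" for n s
    unfolding Z_def using that by (intro measurable_normalized_increments) simp
  have grid: "(\<integral>\<^sup>+e. grid_width (\<lambda>u. W u \<omega>) s n e \<partial>\<mu>) = ennreal (sqrt (s / 2 ^ n)) * \<Phi> n (Z n s \<omega>)"
    if "0 < s" "\<omega> \<in> space M" for s n \<omega>
  proof -
    have "Z n s \<omega> \<in> space (?P n)" using measurable_space[OF Z[OF that(1)] that(2)] .
    from measurable_compose[OF measurable_Pair1'[OF this] measurable_lattice_width]
    have "lattice_width (2 ^ n) (Z n s \<omega>) \<in> borel_measurable \<mu>" by simp
    then show ?thesis
      unfolding grid_width_eq[OF that(1)] \<Phi>_def Z_def by (rule nn_integral_cmult)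
  qed
  \<comment> \<open>The factor contains \<open>t\<close> for every horizon \<open>s\<close>, so the
    probability of \<open>E n s\<close> does not depend on \<open>s\<close>.\<close>
  define E where "E n s = {\<omega>\<in>space M. ?a n * \<Phi> n (Z n s \<omega>) \<le> 1}" for n s
  have E_sets: "E n s \<in> sets M" if "0 < s" for n s
    unfolding E_def using measurable_compose[OF Z[OF that] \<Phi>] by measurable
  have E_prob: "emeasure M (E n s) = emeasure (\<Pi>\<^sub>M p\<in>{..<2 ^ n} \<times> UNIV. density lborel std_normal_density)
      {z \<in> space (?P n). ?a n * \<Phi> n z \<le> 1}" if "0 < s" for n s
  proof -
    have "emeasure (distr M (?P n) (Z n s)) {z \<in> space (?P n). ?a n * \<Phi> n z \<le> 1} = emeasure M (E n s)"
      using Z[OF that] measurable_space[OF Z[OF that]]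
      by (subst emeasure_distr) (auto simp: E_def intro!: arg_cong[where f="emeasure M"])
    moreover have "distr M (?P n) (Z n s) = (\<Pi>\<^sub>M p\<in>{..<2 ^ n} \<times> UNIV. density lborel std_normal_density)"
      unfolding Z_def using that by (intro distr_normalized_increments) auto
    ultimately show ?thesis by simp
  qed
  \<comment> \<open>A supremum is \<le> 1 iff all its terms are, so the event is a decreasing
    intersection of the \<open>E n s\<close>. The choices s = t, c = 1 and s = 1, c = sqrt t give
    the two sides.\<close>
  have lim: "emeasure M {\<omega>\<in>space M. ennreal c * total_width s \<omega> \<le> 1} = (INF n. emeasure M (E n s))"
    if s: "0 < s" and c: "0 \<le> c" "c * sqrt s = sqrt t" for s c
  proof -
    have mono: "incseq (\<lambda>n. ?a n * \<Phi> n (Z n s \<omega>))" and sup: "ennreal c * total_width s \<omega> = (SUP n. ?a n * \<Phi> n (Z n s \<omega>))"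
      if "\<omega> \<in> space M" for \<omega>
    proof -
      have a: "?a n = ennreal c * ennreal (sqrt (s / 2 ^ n))" for n
      proof -
        have "sqrt (s / 2 ^ n) = sqrt s * sqrt (1 / 2 ^ n)" by (simp add: real_sqrt_divide)
        then show ?thesis unfolding c(2)[symmetric] using c(1) s by (simp add: ennreal_mult mult.assoc)
      qed
      have eq: "?a n * \<Phi> n (Z n s \<omega>) = ennreal c * (\<integral>\<^sup>+e. grid_width (\<lambda>u. W u \<omega>) s n e \<partial>\<mu>)" for n
        unfolding grid[OF s that] a by (simp add: mult.assoc)
      show "incseq (\<lambda>n. ?a n * \<Phi> n (Z n s \<omega>))"
        unfolding eq by (intro incseq_SucI mult_left_mono nn_integral_mono incseq_SucD[OF incseq_grid_width]) simp
      show "ennreal c * total_width s \<omega> = (SUP n. ?a n * \<Phi> n (Z n s \<omega>))"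
        unfolding eq total_width_SUP[OF s that] by (rule SUP_mult_left_ennreal)
    qed
    have "decseq (\<lambda>n. E n s)"
      unfolding decseq_def E_def using mono by (auto simp: incseq_def intro: order_trans)
    moreover have "{\<omega>\<in>space M. ennreal c * total_width s \<omega> \<le> 1} = (\<Inter>n. E n s)"
      using sup by (auto simp: E_def SUP_le_iff)
    ultimately show ?thesis
      using E_sets[OF s] by (subst INF_emeasure_decseq) (auto simp: emeasure_eq_measure)
  qed
  show ?thesis
    using lim[of t 1] lim[of 1 "sqrt t"] assms E_prob by simp
qed

text \<open>For a fixed path the times with
  \<open>ennreal (sqrt t) * total_width 1 \<omega> \<le> 1\<close> have length (total width)^-2;
  Fubini and scaling trade this for probabilities at time \<open>t\<close>.\<close>

lemma nn_integral_inverse_total_width: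
  "(\<integral>\<^sup>+\<omega>. (inverse (total_width 1 \<omega>))\<^sup>2 \<partial>M)
    = (\<integral>\<^sup>+t. indicator {0<..} t * emeasure M {\<omega>\<in>space M. total_width t \<omega> \<le> 1} \<partial>lborel)"
proof -
  interpret pair_sigma_finite M lborel ..
  have [measurable]: "total_width 1 \<in> borel_measurable M" by (rule measurable_total_width) simp
  have "(\<integral>\<^sup>+\<omega>. (inverse (total_width 1 \<omega>))\<^sup>2 \<partial>M)
     = (\<integral>\<^sup>+\<omega>. \<integral>\<^sup>+t. indicator {0<..} t * indicator {\<omega>\<in>space M. ennreal (sqrt t) * total_width 1 \<omega> \<le> 1} \<omega> \<partial>lborel \<partial>M)"
    by (intro nn_integral_cong, subst nn_integral_inverse_square[symmetric], intro nn_integral_cong)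
       (auto simp: indicator_def)
  also have "\<dots> = (\<integral>\<^sup>+t. \<integral>\<^sup>+\<omega>. indicator {0<..} t * indicator {\<omega>\<in>space M. ennreal (sqrt t) * total_width 1 \<omega> \<le> 1} \<omega> \<partial>M \<partial>lborel)"
    by (rule Fubini'[symmetric]) measurable
  also have "\<dots> = (\<integral>\<^sup>+t. indicator {0<..} t * emeasure M {\<omega>\<in>space M. ennreal (sqrt t) * total_width 1 \<omega> \<le> 1} \<partial>lborel)"
    by (intro nn_integral_cong) (simp add: nn_integral_cmult)
  also have "\<dots> = (\<integral>\<^sup>+t. indicator {0<..} t * emeasure M {\<omega>\<in>space M. total_width t \<omega> \<le> 1} \<partial>lborel)"
    by (intro nn_integral_cong) (auto simp: indicator_def emeasure_total_width_scaling)
  finally show ?thesis .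
qed

end

section \<open>Continuity of paths and the mean range\<close>

context planar_brownian_motion
begin

lemma AE_continuous: "AE \<omega> in M. continuous_on {0..} (\<lambda>t. W t \<omega>)"
proof -
  have "AE \<omega> in M. continuous_on {0..} (\<lambda>t. W t \<omega> $ 1)" "AE \<omega> in M. continuous_on {0..} (\<lambda>t. W t \<omega> $ 2)"
    by (rule standard_brownian_motion.continuous_paths[OF coordinates])+
  then show ?thesis
  proof eventually_elim
    case (elim \<omega>)
    then have "continuous_on {0..} (\<lambda>t. \<chi> c. W t \<omega> $ c)"
      using exhaust_2 by (intro continuous_on_vec_lambda) metis
    then show ?case by simp
  qed
qed

text \<open>A single null set, that of the discontinuous paths, serves all times and
  directions.\<close>

lemma AE_path_width:
  "AE \<omega> in M. \<forall>t\<ge>0. \<forall>e. norm e = 1 \<longrightarrow> path_width (\<lambda>s. W s \<omega>) t e = width ((\<lambda>s. W s \<omega>) ` {0..t}) e"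
  using AE_continuous
proof eventually_elim
  case (elim \<omega>)
  then show ?case
    by (auto intro!: path_width_eq_width continuous_on_subset[OF elim])
qed

text \<open>The range is at most the maximum of the walk plus the maximum of the negated walk. Each
  has mean at most sqrt(2/pi) on every grid, since the deviation of a step times the root of the
  number of steps is 1.\<close>

lemma nn_integral_path_width_le:
  assumes "norm e = 1" "\<And>c. e $ c \<noteq> 0"
  shows "(\<integral>\<^sup>+\<omega>. path_width (\<lambda>s. W s \<omega>) 1 e \<partial>M) \<le> ennreal (2 * sqrt (2 / pi))"
proof -
  have meas: "(\<lambda>\<omega>. grid_width (\<lambda>s. W s \<omega>) 1 n e) \<in> borel_measurable M" for n
  proof -
    have "(\<lambda>\<omega>. (\<omega>, e)) \<in> measurable M (M \<Otimes>\<^sub>M borel)" by measurable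
    from measurable_compose[OF this measurable_grid_width[of 1 n]] show ?thesis by simp
  qed
  have "(\<integral>\<^sup>+\<omega>. path_width (\<lambda>s. W s \<omega>) 1 e \<partial>M) = (SUP n. \<integral>\<^sup>+\<omega>. grid_width (\<lambda>s. W s \<omega>) 1 n e \<partial>M)"
    unfolding path_width_def
  proof (rule nn_integral_monotone_convergence_SUP)
    show "incseq (\<lambda>n \<omega>. grid_width (\<lambda>s. W s \<omega>) 1 n e)"
      unfolding incseq_def le_fun_def using incseqD[OF incseq_grid_width] by blast
  qed (rule meas)
  also have "\<dots> \<le> ennreal (2 * sqrt (2 / pi))"
  proof (rule SUP_least)
    fix n :: nat
    define N where "N = (2::nat) ^ n"
    define h where "h = 1 / real N"
    have N: "0 < N" by (simp add: N_def)
    then have h: "0 < h" by (simp add: h_def)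
    have bound: "(\<integral>\<^sup>+\<omega>. (SUP k\<in>{..N}. ennreal ((W (real k * h) \<omega> - W 0 \<omega>) \<bullet> e)) \<partial>M) \<le> ennreal (sqrt (2 / pi))"
       and meas2: "(\<lambda>\<omega>. SUP k\<in>{..N}. ennreal ((W (real k * h) \<omega> - W 0 \<omega>) \<bullet> e)) \<in> borel_measurable M"
      if e: "norm e = 1" "\<And>c. e $ c \<noteq> 0" for e
    proof -
      interpret gaussian_walk M "\<lambda>i \<omega>. (W (real (Suc i) * h) \<omega> - W (real i * h) \<omega>) \<bullet> e" N "sqrt h"
        using h e by (rule gaussian_walk_inner)
      have sum: "(\<Sum>i<k. (W (real (Suc i) * h) \<omega> - W (real i * h) \<omega>) \<bullet> e) = (W (real k * h) \<omega> - W 0 \<omega>) \<bullet> e" for k \<omega>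
        using sum_lessThan_telescope[of "\<lambda>i. W (real i * h) \<omega> \<bullet> e" k] by (simp add: inner_diff_left del: of_nat_Suc)
      have "sqrt h * sqrt N = 1" using N by (simp add: h_def real_sqrt_divide)
      with nn_integral_max_le show "(\<integral>\<^sup>+\<omega>. (SUP k\<in>{..N}. ennreal ((W (real k * h) \<omega> - W 0 \<omega>) \<bullet> e)) \<partial>M) \<le> ennreal (sqrt (2 / pi))"
        by (simp add: sum del: of_nat_Suc)
      show "(\<lambda>\<omega>. SUP k\<in>{..N}. ennreal ((W (real k * h) \<omega> - W 0 \<omega>) \<bullet> e)) \<in> borel_measurable M"
        using measurable_sum unfolding sum by (intro borel_measurable_SUP) auto
    qed
    have e': "norm (- e) = 1" "\<And>c. (- e) $ c \<noteq> 0" using assms by auto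
    have "(\<integral>\<^sup>+\<omega>. grid_width (\<lambda>s. W s \<omega>) 1 n e \<partial>M)
       \<le> (\<integral>\<^sup>+\<omega>. (SUP k\<in>{..N}. ennreal ((W (real k * h) \<omega> - W 0 \<omega>) \<bullet> e)) + (SUP k\<in>{..N}. ennreal ((W (real k * h) \<omega> - W 0 \<omega>) \<bullet> (- e))) \<partial>M)"
    proof (rule nn_integral_mono)
      fix \<omega>
      have "ennreal ((W (real k * h) \<omega> - W (real j * h) \<omega>) \<bullet> e)
         \<le> (SUP k\<in>{..N}. ennreal ((W (real k * h) \<omega> - W 0 \<omega>) \<bullet> e)) + (SUP k\<in>{..N}. ennreal ((W (real k * h) \<omega> - W 0 \<omega>) \<bullet> (- e)))"
        if "k \<le> N" "j \<le> N" for k j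
      proof -
        have "ennreal ((W (real k * h) \<omega> - W (real j * h) \<omega>) \<bullet> e)
           = ennreal ((W (real k * h) \<omega> - W 0 \<omega>) \<bullet> e + (W (real j * h) \<omega> - W 0 \<omega>) \<bullet> (- e))"
          by (simp add: inner_diff_left)
        also have "\<dots> \<le> ennreal ((W (real k * h) \<omega> - W 0 \<omega>) \<bullet> e) + ennreal ((W (real j * h) \<omega> - W 0 \<omega>) \<bullet> (- e))"
          by (rule ennreal_plus_le)
        also have "\<dots> \<le> (SUP k\<in>{..N}. ennreal ((W (real k * h) \<omega> - W 0 \<omega>) \<bullet> e)) + (SUP k\<in>{..N}. ennreal ((W (real k * h) \<omega> - W 0 \<omega>) \<bullet> (- e)))"
          using that by (intro add_mono SUP_upper) auto
        finally show ?thesis .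
      qed
      then show "grid_width (\<lambda>s. W s \<omega>) 1 n e
         \<le> (SUP k\<in>{..N}. ennreal ((W (real k * h) \<omega> - W 0 \<omega>) \<bullet> e)) + (SUP k\<in>{..N}. ennreal ((W (real k * h) \<omega> - W 0 \<omega>) \<bullet> (- e)))"
        unfolding grid_width_def width_def image_image by (intro SUP_least) (auto simp: N_def h_def)
    qed
    also have "\<dots> = (\<integral>\<^sup>+\<omega>. (SUP k\<in>{..N}. ennreal ((W (real k * h) \<omega> - W 0 \<omega>) \<bullet> e)) \<partial>M)
       + (\<integral>\<^sup>+\<omega>. (SUP k\<in>{..N}. ennreal ((W (real k * h) \<omega> - W 0 \<omega>) \<bullet> (- e))) \<partial>M)"
      by (rule nn_integral_add[OF meas2[OF assms] meas2[OF e']])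
    also have "\<dots> \<le> ennreal (sqrt (2 / pi)) + ennreal (sqrt (2 / pi))"
      by (intro add_mono bound[OF assms] bound[OF e'])
    also have "\<dots> = ennreal (2 * sqrt (2 / pi))" by (simp flip: ennreal_plus)
    finally show "(\<integral>\<^sup>+\<omega>. grid_width (\<lambda>s. W s \<omega>) 1 n e \<partial>M) \<le> ennreal (2 * sqrt (2 / pi))" .
  qed
  finally show ?thesis .
qed

end

section \<open>The exit time\<close>

lemma dir_eq: "dir \<theta> = cos \<theta> *\<^sub>R axis 1 1 + sin \<theta> *\<^sub>R axis 2 1"
  by (simp add: dir_def vec_eq_iff forall_2 axis_def)

lemma measurable_dir [measurable]: "dir \<in> measurable angles borel"
  unfolding dir_eq[abs_def]
  by (intro borel_measurable_angles borel_measurable_continuous_onI continuous_intros)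

text \<open>Discards the directions in which a projected increment would lose one of its normal
  summands.\<close>

lemma AE_dir_nonzero: "AE \<theta> in angles. \<forall>c. dir \<theta> $ c \<noteq> 0"
proof -
  have "AE \<theta> in lborel. \<theta> \<notin> {0, pi / 2, pi}"
    by (rule AE_not_in) (simp add: finite_imp_null_set_lborel)
  then have "AE \<theta> in lborel. \<theta> \<in> {0..pi} \<longrightarrow> (\<forall>c. dir \<theta> $ c \<noteq> 0)"
  proof eventually_elim
    case (elim \<theta>)
    show ?case
    proof
      assume \<theta>: "\<theta> \<in> {0..pi}"
      have "sin \<theta> \<noteq> 0" using sin_gt_zero[of \<theta>] \<theta> elim by force
      moreover have "cos \<theta> \<noteq> 0"
      proof
        assume "cos \<theta> = 0"
        then have "cos \<theta> = cos (pi / 2)" by simp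
        then have "\<theta> = pi / 2" using \<theta> cos_inj_pi[of \<theta> "pi / 2"] by simp
        then show False using elim by simp
      qed
      ultimately show "\<forall>c. dir \<theta> $ c \<noteq> 0" by (simp add: forall_2 dir_def)
    qed
  qed
  then show ?thesis
    unfolding angles_def by (subst AE_restrict_space_iff) auto
qed

lemma ennreal_inverse_antimono:
  fixes a b :: ennreal
  assumes "a \<le> b"
  shows "inverse b \<le> inverse a"
proof (cases "a = 0 \<or> b = \<top>")
  case False
  then obtain r s where "a = ennreal r" "b = ennreal s" "0 < r" "0 \<le> s"
    by (cases a; cases b) (use assms in \<open>auto simp: less_le top_unique\<close>)
  then show ?thesis using assms by (auto simp: inverse_ennreal intro!: ennreal_leI le_imp_inverse_le)
qed auto

section \<open>Mean exit time of a one-dimensional range\<close>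

context planar_brownian_motion
begin

text \<open>With a point mass at \<open>e\<close> the total width is the range of the projection, so
  the left side is the integral over t of the probability that the range at time t is at most 1.
  Riemann sums over ever finer grids of a bounded interval reduce it to the walk.\<close>

lemma nn_integral_inverse_path_width_le:
  assumes e: "norm e = 1" "\<And>c. e $ c \<noteq> 0"
  shows "(\<integral>\<^sup>+\<omega>. (inverse (path_width (\<lambda>s. W s \<omega>) 1 e))\<^sup>2 \<partial>M) \<le> ennreal (1 / 2)"
proof -
  interpret return: prob_space "return borel e" by (rule prob_space_return) simp
  interpret D: planar_brownian_motion_directions M W "return borel e"
    by unfold_locales simp
  have tw: "D.total_width t \<omega> = path_width (\<lambda>s. W s \<omega>) t e" if "0 < t" "\<omega> \<in> space M" for t \<omega>
    using measurable_compose[OF measurable_Pair1'[OF that(2)] measurable_path_width[OF that(1)]]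
    unfolding D.total_width_def by (subst nn_integral_return) auto
  have [measurable]: "D.total_width 1 \<in> borel_measurable M" by (rule D.measurable_total_width) simp
  define q where "q t = emeasure M {\<omega>\<in>space M. ennreal (sqrt t) * D.total_width 1 \<omega> \<le> 1}" for t
  have [measurable]: "q \<in> borel_measurable lborel" unfolding q_def[abs_def] by measurable
  have bound: "(\<integral>\<^sup>+t. indicator {0<..T} t * q t \<partial>lborel) \<le> ennreal (1 / 2)" if T: "0 < T" for T :: real
  proof -
    \<comment> \<open>The walk bound with mesh T/n and \<eta> = n^(-1/8). Its overshoot term is of
      order \<eta>^-4 / n = n^(-1/2); any exponent strictly between -1/4 and 0 would make both
      errors vanish.\<close>
    define f where "f n = (1 + 2 * sqrt (T / n) + n powr (-1/8))\<^sup>2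
        + (3 / n powr (-1/8) + 1)\<^sup>2 / (n powr (-1/8))\<^sup>2 * (3 * n * (T / n)\<^sup>2)" for n :: real
    have step: "(\<integral>\<^sup>+t. indicator {0<..T} t * q t \<partial>lborel) \<le> ennreal (f (real n) / 2)" if n: "0 < n" "T \<le> real n" for n :: nat
    proof -
      define h where "h = T / n"
      have h: "0 < h" "h \<le> 1" using T n by (auto simp: h_def)
      interpret walk: gaussian_walk M "\<lambda>i \<omega>. (W (real (Suc i) * h) \<omega> - W (real i * h) \<omega>) \<bullet> e" n "sqrt h"
        using h(1) e by (rule gaussian_walk_inner)
      define Y where "Y \<omega> i = (W (real (Suc i) * h) \<omega> - W (real i * h) \<omega>) \<bullet> e" for \<omega> i
      have sum: "(\<Sum>i<k. Y \<omega> i) = (W (real k * h) \<omega> - W 0 \<omega>) \<bullet> e" for k \<omega>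
        using sum_lessThan_telescope[of "\<lambda>i. W (real i * h) \<omega> \<bullet> e" k]
        by (simp add: Y_def inner_diff_left del: of_nat_Suc)
      define p where "p k = prob {\<omega>\<in>space M. drawrange (Y \<omega>) k \<le> 1}" for k
      have p_sets: "{\<omega>\<in>space M. drawrange (Y \<omega>) k \<le> 1} \<in> events" if "k \<le> n" for k
        using walk.measurable_drawdown_walk[OF that] walk.measurable_drawup_walk[OF that]
        unfolding Y_def by measurable
      \<comment> \<open>A range at most 1 up to time \<open>t\<close> restricts to the grid points
        before \<open>t\<close>, so a cell is bounded by the value at its left end.\<close>
      have q_le: "q t \<le> ennreal (p k)" if k: "k < n" "real k * h < t" for k t
      proof -
        have "0 \<le> real k * h" using h by simp
        then have "0 < t" using k(2) by linarith
        have "q t = emeasure M {\<omega>\<in>space M. D.total_width t \<omega> \<le> 1}"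
          unfolding q_def using \<open>0 < t\<close> by (rule D.emeasure_total_width_scaling[symmetric])
        also have "\<dots> \<le> emeasure M {\<omega>\<in>space M. drawrange (Y \<omega>) k \<le> 1}"
        proof (rule emeasure_mono_AE)
          show "AE \<omega> in M. \<omega> \<in> {\<omega>\<in>space M. D.total_width t \<omega> \<le> 1} \<longrightarrow> \<omega> \<in> {\<omega>\<in>space M. drawrange (Y \<omega>) k \<le> 1}"
            using AE_path_width
          proof eventually_elim
            case (elim \<omega>)
            show ?case
            proof
              assume "\<omega> \<in> {\<omega>\<in>space M. D.total_width t \<omega> \<le> 1}"
              then have \<omega>: "\<omega> \<in> space M" "width ((\<lambda>s. W s \<omega>) ` {0..t}) e \<le> 1"
                using tw[OF \<open>0 < t\<close>] elim \<open>0 < t\<close> e(1) by auto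
              have "(\<Sum>l<i. Y \<omega> l) - (\<Sum>l<j. Y \<omega> l) \<le> 1" if ij: "i \<le> k" "j \<le> k" for i j
              proof -
                have "real l * h \<in> {0..t}" if "l \<le> k" for l
                proof -
                  have "0 \<le> real l * h" "real l * h \<le> real k * h" using that h by auto
                  then show ?thesis using k(2) unfolding atLeastAtMost_iff by linarith
                qed
                from this[OF ij(1)] this[OF ij(2)] have "ennreal ((W (real i * h) \<omega> - W (real j * h) \<omega>) \<bullet> e) \<le> width ((\<lambda>s. W s \<omega>) ` {0..t}) e"
                  by (intro inner_diff_le_width) auto
                then have "ennreal ((W (real i * h) \<omega> - W (real j * h) \<omega>) \<bullet> e) \<le> 1"
                  using \<omega>(2) by (rule order_trans)
                then show ?thesis by (simp add: sum inner_diff_left)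
              qed
              then show "\<omega> \<in> {\<omega>\<in>space M. drawrange (Y \<omega>) k \<le> 1}"
                using \<omega>(1) drawrange_le[of k "Y \<omega>" 1] by simp
            qed
          qed
          show "{\<omega>\<in>space M. drawrange (Y \<omega>) k \<le> 1} \<in> events" using k by (intro p_sets) simp
        qed
        finally show ?thesis by (simp add: p_def emeasure_eq_measure)
      qed
      have pointwise: "indicator {0<..T} t * q t \<le> (\<Sum>k<n. ennreal (p k) * indicator {real k * h<..real (Suc k) * h} t)" for t
      proof (cases "0 < t \<and> t \<le> T")
        case True
        \<comment> \<open>Cells are open on the left and closed on the right, hence the ceiling
          minus one.\<close>
        define k where "k = nat (\<lceil>t / h\<rceil> - 1)"
        have "0 < t / h" using True h by simp
        then have k: "real k < t / h" "t / h \<le> real k + 1"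
          unfolding k_def by (auto simp: of_nat_nat) linarith+
        have kh: "real k * h < t" "t \<le> real (Suc k) * h"
          using k h by (auto simp: field_simps)
        have "t / h \<le> T / h" using True h by (intro divide_right_mono) auto
        also have "T / h = n" using T n by (simp add: h_def)
        finally have "k < n" using k(1) by simp
        have "indicator {0<..T} t * q t \<le> ennreal (p k) * indicator {real k * h<..real (Suc k) * h} t"
          using q_le[OF \<open>k < n\<close> kh(1)] kh True by simp
        also have "\<dots> \<le> (\<Sum>k<n. ennreal (p k) * indicator {real k * h<..real (Suc k) * h} t)"
          using \<open>k < n\<close> by (intro member_le_sum) auto
        finally show ?thesis .
      qed (auto simp: indicator_def)
      have "(\<integral>\<^sup>+t. indicator {0<..T} t * q t \<partial>lborel)
          \<le> (\<integral>\<^sup>+t. (\<Sum>k<n. ennreal (p k) * indicator {real k * h<..real (Suc k) * h} t) \<partial>lborel)"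
        by (intro nn_integral_mono pointwise)
      also have "\<dots> = (\<Sum>k<n. ennreal (p k) * ennreal h)"
        using h by (subst nn_integral_sum) (auto simp: nn_integral_cmult algebra_simps)
      also have "\<dots> = ennreal (h * (\<Sum>k<n. p k))"
        using h by (simp add: p_def sum_nonneg sum_distrib_left mult.commute flip: ennreal_mult)
      also have "\<dots> \<le> ennreal (f (real n) / 2)"
      proof (rule ennreal_leI)
        have "2 * (sqrt h)\<^sup>2 * (\<Sum>k<n. p k) \<le> (1 + 2 * sqrt h + n powr (-1/8))\<^sup>2
           + (3 / n powr (-1/8) + 1)\<^sup>2 / (n powr (-1/8))\<^sup>2 * (3 * n * sqrt h ^ 4)"
          using walk.sum_prob_drawrange_le[of "n powr (-1/8)"] h n unfolding p_def Y_def by simp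
        moreover have "sqrt h ^ 4 = h\<^sup>2"
          using h by (simp add: power4_eq_xxxx power2_eq_square)
        ultimately have "2 * h * (\<Sum>k<n. p k) \<le> f (real n)"
          using h by (simp add: f_def h_def)
        then show "h * (\<Sum>k<n. p k) \<le> f (real n) / 2" by simp
      qed
      finally show ?thesis .
    qed
    have "((\<lambda>n. f n / 2) \<longlongrightarrow> 1 / 2) at_top"
      unfolding f_def using T by real_asymp
    then have "((\<lambda>n. f (real n) / 2) \<longlongrightarrow> 1 / 2) sequentially"
      by (rule filterlim_compose[OF _ filterlim_real_sequentially])
    then have "(\<lambda>n. ennreal (f (real n) / 2)) \<longlonglongrightarrow> ennreal (1 / 2)" by (rule tendsto_ennrealI)
    moreover have "\<exists>N. \<forall>n\<ge>N. (\<integral>\<^sup>+t. indicator {0<..T} t * q t \<partial>lborel) \<le> ennreal (f (real n) / 2)"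
    proof (intro exI allI impI)
      fix n assume "n \<ge> Suc (nat \<lceil>T\<rceil>)"
      then show "(\<integral>\<^sup>+t. indicator {0<..T} t * q t \<partial>lborel) \<le> ennreal (f (real n) / 2)"
        by (intro step) linarith+
    qed
    ultimately show ?thesis by (rule LIMSEQ_le_const)
  qed
  have "(\<integral>\<^sup>+\<omega>. (inverse (path_width (\<lambda>s. W s \<omega>) 1 e))\<^sup>2 \<partial>M) = (\<integral>\<^sup>+\<omega>. (inverse (D.total_width 1 \<omega>))\<^sup>2 \<partial>M)"
    by (intro nn_integral_cong) (simp add: tw)
  also have "\<dots> = (\<integral>\<^sup>+t. indicator {0<..} t * q t \<partial>lborel)"
    unfolding D.nn_integral_inverse_total_width q_def
    by (intro nn_integral_cong) (auto simp: indicator_def D.emeasure_total_width_scaling)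
  \<comment> \<open>Monotone convergence in the horizon; the bound 1/2 is uniform in it.\<close>
  also have "\<dots> = (\<integral>\<^sup>+t. (SUP n. indicator {0<..real (Suc n)} t * q t) \<partial>lborel)"
  proof (intro nn_integral_cong antisym)
    fix t :: real
    show "indicator {0<..} t * q t \<le> (SUP n. indicator {0<..real (Suc n)} t * q t)"
    proof (cases "0 < t")
      case True
      obtain n where "t \<le> real n" using real_arch_simple by blast
      then show ?thesis using True by (intro SUP_upper2[of n]) (auto simp: indicator_def)
    qed simp
    show "(SUP n. indicator {0<..real (Suc n)} t * q t) \<le> indicator {0<..} t * q t"
      by (intro SUP_least) (auto simp: indicator_def)
  qed
  also have "\<dots> = (SUP n. \<integral>\<^sup>+t. indicator {0<..real (Suc n)} t * q t \<partial>lborel)"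
    by (intro nn_integral_monotone_convergence_SUP) (auto simp: incseq_def le_fun_def indicator_def)
  also have "\<dots> \<le> ennreal (1 / 2)" by (intro SUP_least bound) simp
  finally show ?thesis .
qed

section \<open>The perimeter process and its exit time\<close>

lemma measurable_path_width_dir:
  assumes "0 < t"
  shows "(\<lambda>(\<omega>, \<theta>). path_width (\<lambda>s. W s \<omega>) t (dir \<theta>)) \<in> borel_measurable (M \<Otimes>\<^sub>M angles)"
proof -
  have "(\<lambda>x. (fst x, dir (snd x))) \<in> measurable (M \<Otimes>\<^sub>M angles) (M \<Otimes>\<^sub>M borel)" by measurable
  from measurable_compose[OF this measurable_path_width[OF assms]] show ?thesis by (simp add: case_prod_beta)
qed

text \<open>Continuity of the path makes its image compact, so outside one null set the width
  formula holds at all times together; growth in time is inherited from nested images.\<close>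

lemma AE_perimeter:
  "AE \<omega> in M. \<forall>t\<ge>0. perimeter (path_hull W t \<omega>) = (\<integral>\<^sup>+\<theta>. path_width (\<lambda>s. W s \<omega>) t (dir \<theta>) \<partial>angles)
     \<and> (\<forall>s\<in>{0..t}. perimeter (path_hull W s \<omega>) \<le> perimeter (path_hull W t \<omega>))"
  using AE_path_width AE_continuous
proof eventually_elim
  case (elim \<omega>)
  have hull: "path_hull W t \<omega> = convex hull ((\<lambda>s. W s \<omega>) ` {0..t})" for t
    unfolding path_hull_def by (rule arg_cong[where f = "\<lambda>S. convex hull S"]) auto
  have eq: "perimeter (path_hull W t \<omega>) = (\<integral>\<^sup>+\<theta>. width ((\<lambda>s. W s \<omega>) ` {0..t}) (dir \<theta>) \<partial>angles)" if "0 \<le> t" for t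
  proof -
    have "compact ((\<lambda>s. W s \<omega>) ` {0..t})"
      by (intro compact_continuous_image continuous_on_subset[OF elim(2)]) auto
    then have "perimeter (path_hull W t \<omega>) = (\<integral>\<^sup>+\<theta>. width (convex hull ((\<lambda>s. W s \<omega>) ` {0..t})) (dir \<theta>) \<partial>angles)"
      unfolding hull using that by (intro perimeter_eq_nn_integral_width compact_convex_hull) auto
    then show ?thesis by (simp only: width_convex_hull)
  qed
  show ?case
  proof (intro allI impI conjI ballI)
    fix t :: real assume "0 \<le> t"
    show "perimeter (path_hull W t \<omega>) = (\<integral>\<^sup>+\<theta>. path_width (\<lambda>s. W s \<omega>) t (dir \<theta>) \<partial>angles)"
      using elim(1) \<open>0 \<le> t\<close> by (simp add: eq)
    fix s assume "s \<in> {0..t}"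
    then show "perimeter (path_hull W s \<omega>) \<le> perimeter (path_hull W t \<omega>)"
      by (auto simp: eq intro!: nn_integral_mono width_mono)
  qed
qed

end

sublocale planar_brownian_motion \<subseteq> dirs: planar_brownian_motion_directions M W "distr angles borel dir"
proof -
  interpret finite_measure angles by (rule finite_measure_angles)
  interpret distr: finite_measure "distr angles borel dir" by (rule finite_measure_distr) measurable
  show "planar_brownian_motion_directions M W (distr angles borel dir)"
    by unfold_locales simp
qed

context planar_brownian_motion
begin

lemma total_width_eq:
  assumes "0 < t" "\<omega> \<in> space M"
  shows "dirs.total_width t \<omega> = (\<integral>\<^sup>+\<theta>. path_width (\<lambda>s. W s \<omega>) t (dir \<theta>) \<partial>angles)"
  using measurable_compose[OF measurable_Pair1'[OF assms(2)] measurable_path_width[OF assms(1)]]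
  unfolding dirs.total_width_def by (subst nn_integral_distr) auto

lemma AE_total_width:
  "AE \<omega> in M. (\<forall>t>0. dirs.total_width t \<omega> = perimeter (path_hull W t \<omega>))
     \<and> (\<forall>s\<ge>0. \<forall>t\<ge>s. perimeter (path_hull W s \<omega>) \<le> perimeter (path_hull W t \<omega>))"
  using AE_perimeter AE_space
proof eventually_elim
  case (elim \<omega>)
  have "perimeter (path_hull W s \<omega>) \<le> perimeter (path_hull W t \<omega>)" if "0 \<le> s" "s \<le> t" for s t
  proof -
    have "0 \<le> t" "s \<in> {0..t}" using that by auto
    then show ?thesis using elim(1) by blast
  qed
  moreover have "dirs.total_width t \<omega> = perimeter (path_hull W t \<omega>)" if "0 < t" for t
    using elim(1) total_width_eq[OF that elim(2)] that by (metis less_imp_le)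
  ultimately show ?case by blast
qed

text \<open>Unlike the exit time itself, this version is obviously measurable.\<close>
definition rational_exit_time :: "'w \<Rightarrow> ennreal" where
  "rational_exit_time \<omega> = (INF q\<in>{q\<in>\<rat>. 0 < q}. if 1 < dirs.total_width q \<omega> then ennreal q else \<top>)"

lemma measurable_rational_exit_time [measurable]: "rational_exit_time \<in> borel_measurable M"
  unfolding rational_exit_time_def[abs_def]
proof (rule borel_measurable_INF)
  show "countable {q \<in> \<rat>. (0::real) < q}" using countable_rat by (rule countable_subset[rotated]) auto
  fix q :: real assume "q \<in> {q \<in> \<rat>. 0 < q}"
  then have [measurable]: "dirs.total_width q \<in> borel_measurable M" by (intro dirs.measurable_total_width) simp
  show "(\<lambda>\<omega>. if 1 < dirs.total_width q \<omega> then ennreal q else \<top>) \<in> borel_measurable M" by measurable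
qed

text \<open>By monotonicity in time, a perimeter above 1 at \<open>t\<close> is above 1 at every
  rational \<open>q > t\<close>, so rational times approach the infimum from above.\<close>

lemma AE_exit_time_eq: "AE \<omega> in M. perimeter_exit_time W \<omega> = rational_exit_time \<omega>"
  using AE_total_width
proof eventually_elim
  case (elim \<omega>)
  show ?case
  proof (rule antisym)
    show "perimeter_exit_time W \<omega> \<le> rational_exit_time \<omega>"
      unfolding rational_exit_time_def perimeter_exit_time_def
    proof (rule INF_greatest)
      fix q :: real assume q: "q \<in> {q \<in> \<rat>. 0 < q}"
      show "Inf {ennreal t |t. 0 \<le> t \<and> 1 < perimeter (path_hull W t \<omega>)} \<le> (if 1 < dirs.total_width q \<omega> then ennreal q else \<top>)"
        using elim q by (auto intro!: Inf_lower)
    qed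
    show "rational_exit_time \<omega> \<le> perimeter_exit_time W \<omega>"
      unfolding perimeter_exit_time_def
    proof (rule Inf_greatest, elim CollectE exE conjE)
      fix x t assume t: "x = ennreal t" "0 \<le> t" "1 < perimeter (path_hull W t \<omega>)"
      have "rational_exit_time \<omega> \<le> ennreal t"
      proof (rule ennreal_le_epsilon)
        fix \<epsilon> :: real assume "\<epsilon> > 0"
        then obtain q where q: "q \<in> \<rat>" "t < q" "q < t + \<epsilon>" using Rats_dense_in_real[of t "t + \<epsilon>"] by auto
        have "perimeter (path_hull W t \<omega>) \<le> dirs.total_width q \<omega>" using elim q t by auto
        then have "rational_exit_time \<omega> \<le> ennreal q"
          unfolding rational_exit_time_def using q t by (intro INF_lower2[of q]) auto
        also have "\<dots> \<le> ennreal (t + \<epsilon>)" using q by (intro ennreal_leI) simp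
        also have "\<dots> = ennreal t + ennreal \<epsilon>" using t \<open>\<epsilon> > 0\<close> by (intro ennreal_plus) auto
        finally show "rational_exit_time \<omega> \<le> ennreal t + ennreal \<epsilon>" .
      qed
      then show "rational_exit_time \<omega> \<le> x" by (simp only: t)
    qed
  qed
qed

text \<open>Almost surely, exit time > t implies perimeter at t \<le> 1, which implies exit time
  \<ge> t. Strict and weak tails have the same integral, so the sandwich closes.\<close>

lemma nn_integral_exit_time:
  "(\<integral>\<^sup>+\<omega>. perimeter_exit_time W \<omega> \<partial>M) = (\<integral>\<^sup>+\<omega>. (inverse (dirs.total_width 1 \<omega>))\<^sup>2 \<partial>M)"
proof -
  have sf: "sigma_finite_measure M" by unfold_locales
  have "(\<integral>\<^sup>+\<omega>. perimeter_exit_time W \<omega> \<partial>M) = (\<integral>\<^sup>+\<omega>. rational_exit_time \<omega> \<partial>M)"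
    by (intro nn_integral_cong_AE AE_exit_time_eq)
  also have "\<dots> = (\<integral>\<^sup>+t. indicator {0<..} t * emeasure M {\<omega>\<in>space M. dirs.total_width t \<omega> \<le> 1} \<partial>lborel)"
  proof (rule antisym)
    have "emeasure M {\<omega>\<in>space M. ennreal t < rational_exit_time \<omega>} \<le> emeasure M {\<omega>\<in>space M. dirs.total_width t \<omega> \<le> 1}"
      if "0 < t" for t
    proof (rule emeasure_mono_AE)
      have [measurable]: "dirs.total_width t \<in> borel_measurable M" using that by (rule dirs.measurable_total_width)
      show "{\<omega>\<in>space M. dirs.total_width t \<omega> \<le> 1} \<in> events" by measurable
      show "AE \<omega> in M. \<omega> \<in> {\<omega>\<in>space M. ennreal t < rational_exit_time \<omega>} \<longrightarrow> \<omega> \<in> {\<omega>\<in>space M. dirs.total_width t \<omega> \<le> 1}"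
        using AE_total_width AE_exit_time_eq
      proof eventually_elim
        case (elim \<omega>)
        have "perimeter_exit_time W \<omega> \<le> ennreal t" if "1 < perimeter (path_hull W t \<omega>)"
          unfolding perimeter_exit_time_def using that \<open>0 < t\<close> by (intro Inf_lower) auto
        then show ?case using elim \<open>0 < t\<close> by (force simp: not_le[symmetric])
      qed
    qed
    then show "(\<integral>\<^sup>+\<omega>. rational_exit_time \<omega> \<partial>M) \<le> (\<integral>\<^sup>+t. indicator {0<..} t * emeasure M {\<omega>\<in>space M. dirs.total_width t \<omega> \<le> 1} \<partial>lborel)"
      by (subst nn_integral_layer_cake(1)[OF sf]) (auto intro!: nn_integral_mono simp: indicator_def)
    have "emeasure M {\<omega>\<in>space M. dirs.total_width t \<omega> \<le> 1} \<le> emeasure M {\<omega>\<in>space M. ennreal t \<le> rational_exit_time \<omega>}"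
      if "0 < t" for t
    proof (rule emeasure_mono_AE)
      show "{\<omega>\<in>space M. ennreal t \<le> rational_exit_time \<omega>} \<in> events" by measurable
      show "AE \<omega> in M. \<omega> \<in> {\<omega>\<in>space M. dirs.total_width t \<omega> \<le> 1} \<longrightarrow> \<omega> \<in> {\<omega>\<in>space M. ennreal t \<le> rational_exit_time \<omega>}"
        using AE_total_width AE_exit_time_eq
      proof eventually_elim
        case (elim \<omega>)
        have "ennreal t \<le> perimeter_exit_time W \<omega>" if le: "perimeter (path_hull W t \<omega>) \<le> 1"
          unfolding perimeter_exit_time_def
        proof (rule Inf_greatest, elim CollectE exE conjE)
          fix x s assume s: "x = ennreal s" "0 \<le> s" "1 < perimeter (path_hull W s \<omega>)"
          have "\<not> s \<le> t" using elim(1) s le by (meson leD order_trans)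
          then show "ennreal t \<le> x" using s by (simp add: ennreal_leI)
        qed
        then show ?case using elim \<open>0 < t\<close> by auto
      qed
    qed
    then show "(\<integral>\<^sup>+t. indicator {0<..} t * emeasure M {\<omega>\<in>space M. dirs.total_width t \<omega> \<le> 1} \<partial>lborel) \<le> (\<integral>\<^sup>+\<omega>. rational_exit_time \<omega> \<partial>M)"
      by (subst nn_integral_layer_cake(2)[OF sf]) (auto intro!: nn_integral_mono simp: indicator_def)
  qed
  also have "\<dots> = (\<integral>\<^sup>+\<omega>. (inverse (dirs.total_width 1 \<omega>))\<^sup>2 \<partial>M)"
    by (rule dirs.nn_integral_inverse_total_width[symmetric])
  finally show ?thesis .
qed

section \<open>Bounds for the mean exit time\<close>

lemma nn_integral_total_width_le: "(\<integral>\<^sup>+\<omega>. dirs.total_width 1 \<omega> \<partial>M) \<le> ennreal (sqrt (8 * pi))"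
proof -
  interpret angles: finite_measure angles by (rule finite_measure_angles)
  interpret pair_sigma_finite M angles ..
  have "(\<integral>\<^sup>+\<omega>. dirs.total_width 1 \<omega> \<partial>M) = (\<integral>\<^sup>+\<omega>. \<integral>\<^sup>+\<theta>. path_width (\<lambda>s. W s \<omega>) 1 (dir \<theta>) \<partial>angles \<partial>M)"
    by (intro nn_integral_cong total_width_eq) auto
  also have "\<dots> = (\<integral>\<^sup>+\<theta>. \<integral>\<^sup>+\<omega>. path_width (\<lambda>s. W s \<omega>) 1 (dir \<theta>) \<partial>M \<partial>angles)"
    by (rule Fubini'[symmetric]) (rule measurable_path_width_dir, simp)
  also have "\<dots> \<le> (\<integral>\<^sup>+\<theta>. ennreal (2 * sqrt (2 / pi)) \<partial>angles)"
    using AE_dir_nonzero by (intro nn_integral_mono_AE, eventually_elim) (intro nn_integral_path_width_le, auto)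
  also have "\<dots> = ennreal (2 * sqrt (2 / pi) * pi)"
    by (simp add: emeasure_angles ennreal_mult)
  also have "2 * sqrt (2 / pi) * pi = sqrt (8 * pi)"
  proof -
    have "sqrt (8 * pi) = sqrt (2\<^sup>2 * (2 / pi) * pi\<^sup>2)" by (simp add: power2_eq_square)
    then show ?thesis by (simp only: real_sqrt_mult) simp
  qed
  finally show ?thesis .
qed

text \<open>Jensen's inequality leaves the inverse square of the mean total width; since
  \<open>inverse\<close> is decreasing, an upper bound on that mean suffices.\<close>

lemma exit_time_lower: "ennreal (1 / (8 * pi)) \<le> (\<integral>\<^sup>+\<omega>. perimeter_exit_time W \<omega> \<partial>M)"
proof -
  have [measurable]: "dirs.total_width 1 \<in> borel_measurable M" by (rule dirs.measurable_total_width) simp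
  have inv: "(inverse (ennreal s))\<^sup>2 = ennreal (1 / s\<^sup>2)" if "0 < s" for s
    using that by (simp add: inverse_ennreal ennreal_power divide_inverse power_inverse)
  have "ennreal (1 / (8 * pi)) = (inverse (ennreal (sqrt (8 * pi))))\<^sup>2"
    by (subst inv) simp_all
  also have "\<dots> \<le> (inverse (\<integral>\<^sup>+\<omega>. dirs.total_width 1 \<omega> \<partial>M))\<^sup>2"
    by (intro power_mono ennreal_inverse_antimono nn_integral_total_width_le) simp
  also have "\<dots> \<le> (\<integral>\<^sup>+\<omega>. (inverse (dirs.total_width 1 \<omega>))\<^sup>2 \<partial>M)"
    using inverse_square_nn_integral_le[of "dirs.total_width 1" M 1] by (simp add: emeasure_space_1)
  finally show ?thesis by (simp only: nn_integral_exit_time)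
qed

text \<open>Jensen's inequality over directions contributes \<open>pi ^ 3\<close>, and the mean exit
  time 1/2 of the range integrates to \<open>pi / 2\<close>; the quotient is the constant.\<close>

lemma exit_time_upper: "(\<integral>\<^sup>+\<omega>. perimeter_exit_time W \<omega> \<partial>M) \<le> ennreal (1 / (2 * pi\<^sup>2))"
proof -
  interpret angles: finite_measure angles by (rule finite_measure_angles)
  interpret pair_sigma_finite M angles ..
  have [measurable]: "dirs.total_width 1 \<in> borel_measurable M" by (rule dirs.measurable_total_width) simp
  have [measurable]: "(\<lambda>(\<omega>, \<theta>). path_width (\<lambda>s. W s \<omega>) 1 (dir \<theta>)) \<in> borel_measurable (M \<Otimes>\<^sub>M angles)"
    by (rule measurable_path_width_dir) simp
  let ?E = "\<integral>\<^sup>+\<omega>. perimeter_exit_time W \<omega> \<partial>M"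
  have "ennreal (pi ^ 3) * ?E = (\<integral>\<^sup>+\<omega>. ennreal (pi ^ 3) * (inverse (dirs.total_width 1 \<omega>))\<^sup>2 \<partial>M)"
    unfolding nn_integral_exit_time by (rule nn_integral_cmult[symmetric]) measurable
  also have "\<dots> \<le> (\<integral>\<^sup>+\<omega>. \<integral>\<^sup>+\<theta>. (inverse (path_width (\<lambda>s. W s \<omega>) 1 (dir \<theta>)))\<^sup>2 \<partial>angles \<partial>M)"
  proof (rule nn_integral_mono)
    fix \<omega> assume \<omega>: "\<omega> \<in> space M"
    have "(\<lambda>\<theta>. path_width (\<lambda>s. W s \<omega>) 1 (dir \<theta>)) \<in> borel_measurable angles"
      using measurable_compose[OF measurable_Pair1'[OF \<omega>] measurable_path_width_dir[of 1]] by simp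
    then show "ennreal (pi ^ 3) * (inverse (dirs.total_width 1 \<omega>))\<^sup>2
        \<le> (\<integral>\<^sup>+\<theta>. (inverse (path_width (\<lambda>s. W s \<omega>) 1 (dir \<theta>)))\<^sup>2 \<partial>angles)"
      unfolding total_width_eq[OF zero_less_one \<omega>]
      by (intro inverse_square_nn_integral_le) (auto simp: emeasure_angles)
  qed
  also have "\<dots> = (\<integral>\<^sup>+\<theta>. \<integral>\<^sup>+\<omega>. (inverse (path_width (\<lambda>s. W s \<omega>) 1 (dir \<theta>)))\<^sup>2 \<partial>M \<partial>angles)"
    by (rule Fubini'[symmetric]) measurable
  also have "\<dots> \<le> (\<integral>\<^sup>+\<theta>. ennreal (1 / 2) \<partial>angles)"
    using AE_dir_nonzero by (intro nn_integral_mono_AE, eventually_elim) (intro nn_integral_inverse_path_width_le, auto)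
  also have "\<dots> = ennreal (1 / 2) * ennreal pi"
    by (simp add: emeasure_angles)
  also have "\<dots> = ennreal (pi ^ 3) * ennreal (1 / (2 * pi\<^sup>2))"
    unfolding ennreal_half_mult
    by (subst ennreal_mult'[symmetric]) (auto simp: power2_eq_square power3_eq_cube)
  finally show ?thesis by (subst (asm) ennreal_mult_le_mult_iff) auto
qed

end

theorem proposition1p6:
  fixes M :: "'w measure" and W :: "real \<Rightarrow> 'w \<Rightarrow> real ^ 2"
  assumes "planar_brownian_motion M W"
  shows "ennreal (1 / (8 * pi)) \<le> (\<integral>\<^sup>+ \<omega>. perimeter_exit_time W \<omega> \<partial>M) \<and>
         (\<integral>\<^sup>+ \<omega>. perimeter_exit_time W \<omega> \<partial>M) \<le> ennreal (1 / (2 * pi\<^sup>2))"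
  using planar_brownian_motion.exit_time_lower[OF assms] planar_brownian_motion.exit_time_upper[OF assms] by simp

end
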